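(* Let $(x_k)_{k\in\mathbb{N}}$ be distinct real numbers and let $p_{x_k}\geqslant 0$, $k\in\mathbb{N}$, satisfy $\sum_{k=1}^\infty p_{x_k}=1$. Let $F(x)=\sum_{k\in\mathbb{N}:\,x_k\leqslant x}p_{x_k}$, $x\in\mathbb{R}$, be the corresponding discrete distribution function, and let $f(t)=\sum_{k\in\mathbb{N}}p_{x_k}e^{itx_k}$, $t\in\mathbb{R}$, be its characteristic function. Then $F$ is quasi-infinitely divisible if and only if $\inf_{t\in\mathbb{R}}|f(t)|>0$, i.e. there exists $\mu>0$ such that $|f(t)|\geqslant\mu>0$ for all $t\in\mathbb{R}$. Moreover, if $F$ is quasi-infinitely divisible, then $f$ admits the representation $$f(t)=\exp\Bigl\{it\gamma_0+\sum_{u\in\langle X\rangle\setminus\{0\}}\lambda_u\bigl(e^{itu}-1\bigr)\Bigr\},\quad t\in\mathbb{R},$$ with some $\gamma_0\in\langle X\rangle$ and some $\lambda_u\in\mathbb{R}$, $u\in\langle X\rangle\setminus\{0\}$, such that $\sum_{u\in\langle X\rangle\setminus\{0\}}|\lambda_u|<\infty$.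
   Context: $\mathbb{N}$ denotes the set of positive integers and $\mathbb{Z}$ the set of integers. A distribution function $F$ on $\mathbb{R}$ with characteristic function $f$ is called quasi-infinitely divisible if $f$ admits the representation $$f(t)=\exp\Bigl\{it\gamma-\frac{\sigma^2t^2}{2}+\int_{\mathbb{R}\setminus\{0\}}\bigl(e^{itu}-1-it\sin u\bigr)\,d\Lambda(u)\Bigr\},\quad t\in\mathbb{R},$$ for some $\gamma\in\mathbb{R}$, $\sigma^2\geqslant 0$, and some real-valued function $\Lambda$ on $\mathbb{R}\setminus\{0\}$ (the Lévy spectral function, not necessarily monotone) which has finite total variation on every interval $(-\infty,-r]$ and $[r,\infty)$, $r>0$, and satisfies $$\lim_{u\to-\infty}\Lambda(u)=\lim_{u\to+\infty}\Lambda(u)=0\quad\text{and}\quad\int_{0<|u|<\delta}u^2\,d|\Lambda|(u)<+\infty\ \text{ for every }\delta>0.$$ Integrals with respect to $\Lambda$ are Stieltjes integrals, and $d|\Lambda|$ denotes integration with respect to the total variation of $\Lambda$. $X=\{x_k:\ p_{x_k}>0,\ k\in\mathbb{N}\}$ is the (nonempty) set of points of growth of $F$, and $$\langle X\rangle=\Bigl\{\sum_{k=1}^m c_kx_k:\ c_k\in\mathbb{Z},\ x_k\in X,\ m\in\mathbb{N}\Bigr\}$$ is the set of all finite $\mathbb{Z}$-linear combinations of elements of $X$ (the $\mathbb{Z}$-module generated by $X$). *)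

theory Defs
  imports "HOL-Probability.Probability"
begin

definition variation_sums :: "(real \<Rightarrow> real) \<Rightarrow> real set \<Rightarrow> real set" where
  "variation_sums g S =
     {(\<Sum>i<n. \<bar>g (x (Suc i)) - g (x i)\<bar>) | (n :: nat) (x :: nat \<Rightarrow> real).
        (\<forall>i\<le>n. x i \<in> S) \<and> (\<forall>i<n. x i \<le> x (Suc i))}"

definition finite_variation_on :: "(real \<Rightarrow> real) \<Rightarrow> real set \<Rightarrow> bool" where
  "finite_variation_on g S \<longleftrightarrow> bdd_above (variation_sums g S)"

text \<open>Meaningful only if \<^term>\<open>finite_variation_on g S\<close> holds and \<^term>\<open>S\<close> is nonempty.\<close>

definition total_variation :: "(real \<Rightarrow> real) \<Rightarrow> real set \<Rightarrow> real" where
  "total_variation g S = Sup (variation_sums g S)"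

text \<open>The Riemann--Stieltjes integral of \<^term>\<open>f\<close> with respect to \<^term>\<open>g\<close> over the compact
  interval from \<^term>\<open>a\<close> to \<^term>\<open>b\<close>, as the limit of Stieltjes sums when the mesh tends to 0.\<close>

definition has_stieltjes_integral ::
    "(real \<Rightarrow> 'a :: real_normed_vector) \<Rightarrow> (real \<Rightarrow> real) \<Rightarrow> real \<Rightarrow> real \<Rightarrow> 'a \<Rightarrow> bool" where
  "has_stieltjes_integral f g a b I \<longleftrightarrow>
     (\<forall>e>0. \<exists>d>0. \<forall>D. D tagged_division_of {a..b} \<and> (\<forall>(x, K)\<in>D. Sup K - Inf K < d) \<longrightarrow>
        norm ((\<Sum>(x, K)\<in>D. (g (Sup K) - g (Inf K)) *\<^sub>R f x) - I) < e)"

text \<open>The improper integral: the lower and upper end points tend jointly and independently along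
  the filters \<^term>\<open>A\<close> and \<^term>\<open>B\<close>. Below, \<^term>\<open>f\<close> is always continuous, and bounded near
  infinity and \<open>O(u\<^sup>2)\<close> near 0. Hence, with respect to a Levy spectral function in the sense
  below, all these integrals converge absolutely, so that they coincide with the
  Lebesgue--Stieltjes integrals over the open intervals in question, whichever values
  the integrator takes at its jump points.\<close>

definition has_improper_stieltjes_integral ::
    "(real \<Rightarrow> 'a :: real_normed_vector) \<Rightarrow> (real \<Rightarrow> real) \<Rightarrow> real filter \<Rightarrow> real filter \<Rightarrow> 'a \<Rightarrow> bool"
where
  "has_improper_stieltjes_integral f g A B I \<longleftrightarrow>
     (\<exists>J. (\<forall>\<^sub>F (a, b) in A \<times>\<^sub>F B. has_stieltjes_integral f g a b (J (a, b))) \<and>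
          (J \<longlongrightarrow> I) (A \<times>\<^sub>F B))"

text \<open>The integral over the punctured line: the sum of the integrals over the two open half-lines.\<close>

definition has_stieltjes_integral_off_0 ::
    "(real \<Rightarrow> 'a :: real_normed_vector) \<Rightarrow> (real \<Rightarrow> real) \<Rightarrow> 'a \<Rightarrow> bool" where
  "has_stieltjes_integral_off_0 f g I \<longleftrightarrow>
     (\<exists>I1 I2. has_improper_stieltjes_integral f g at_bot (at_left 0) I1 \<and>
              has_improper_stieltjes_integral f g (at_right 0) at_top I2 \<and>
              I = I1 + I2)"

text \<open>A function \<open>|L|\<close> such that, for \<open>a \<le> b\<close> of the same sign, \<open>|L|(b) - |L|(a)\<close> is the total
  variation of \<^term>\<open>L\<close> on the interval from \<open>a\<close> to \<open>b\<close>; so \<open>d|L|\<close> is integration with respect to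
  this function. It is nondecreasing on each half-line; the value at 0 is irrelevant.\<close>

definition variation_function :: "(real \<Rightarrow> real) \<Rightarrow> real \<Rightarrow> real" where
  "variation_function L u =
     (if u < 0 then total_variation L {..u} else - total_variation L {u..})"

text \<open>Spectral functions are functions on the punctured line; they are modelled by functions on the
  whole line whose value at 0 is never used.\<close>

definition levy_spectral_function :: "(real \<Rightarrow> real) \<Rightarrow> bool" where
  "levy_spectral_function L \<longleftrightarrow>
     (\<forall>r>0. finite_variation_on L {..-r} \<and> finite_variation_on L {r..}) \<and>
     (L \<longlongrightarrow> 0) at_bot \<and> (L \<longlongrightarrow> 0) at_top \<and>
     (\<forall>\<delta>>0.
        (\<exists>I :: real. has_improper_stieltjes_integral (\<lambda>u. u\<^sup>2) (variation_function L)
                (at_right (-\<delta>)) (at_left 0) I) \<and>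
        (\<exists>I :: real. has_improper_stieltjes_integral (\<lambda>u. u\<^sup>2) (variation_function L)
                (at_right 0) (at_left \<delta>) I))"

definition quasi_infinitely_divisible :: "(real \<Rightarrow> real) \<Rightarrow> bool" where
  "quasi_infinitely_divisible F \<longleftrightarrow>
     (\<exists>M. real_distribution M \<and> cdf M = F \<and>
        (\<exists>(\<gamma> :: real) (\<sigma> :: real) L. levy_spectral_function L \<and>
           (\<forall>t :: real. \<exists>I :: complex.
              has_stieltjes_integral_off_0
                (\<lambda>u. iexp (t * u) - 1 - \<i> * of_real (t * sin u)) L I \<and>
              char M t = exp (\<i> * of_real (t * \<gamma>) - of_real (\<sigma>\<^sup>2 * t\<^sup>2 / 2) + I))))"

definition int_span :: "real set \<Rightarrow> real set" where
  "int_span X = {(\<Sum>k\<in>{1..m}. of_int (c k) * y k) | (m :: nat) (c :: nat \<Rightarrow> int) (y :: nat \<Rightarrow> real).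
     m \<ge> 1 \<and> (\<forall>k\<in>{1..m}. y k \<in> X)}"

end

theory Submission
  imports Defs
begin

text \<open>
  Three implications prove the theorem: a quasi-infinitely divisible \<open>F\<close> has \<open>|f|\<close> bounded away from 0;
  if \<open>|f|\<close> is bounded away from 0, then \<open>f\<close> has the exponential form with absolutely summable real
  coefficients; and the exponential form is a Levy representation.

  \<^emph>\<open>Lower bound.\<close> Let \<open>f = exp \<psi>\<close> with \<open>\<psi>\<close> given by the Levy representation. The second difference
  \<open>\<psi>(t + s) + \<psi>(t - s) - 2 \<psi>(t)\<close> equals \<open>-\<sigma>\<^sup>2 s\<^sup>2\<close> plus the integral of \<open>cis(tu) (2 cos(su) - 2)\<close> against the
  spectral function; this integrand is bounded and \<open>O(u\<^sup>2)\<close>, so for fixed \<open>s\<close> the second difference is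
  bounded in \<open>t\<close> (\<open>second_difference_bounded\<close>). As \<open>|f| \<le> 1\<close>, this gives \<open>|f(t)| \<ge> c(s) |f(t - s)|\<^sup>2\<close> with
  \<open>c(s) > 0\<close>. Finitely many shifts \<open>s\<close> suffice to have \<open>|f(t - s)| \<ge> 1/2\<close> for one of them, whatever \<open>t\<close> is
  (\<open>finite_translates_bounded_below\<close>), since \<open>f\<close> is almost periodic with \<open>f(0) = 1\<close>.

  \<^emph>\<open>Exponential form.\<close> Let \<open>G\<close> be an additive subgroup of the reals and consider the algebra of all
  \<open>\<Sum> c\<^sub>u cis(tu)\<close> with \<open>\<Sum> |c\<^sub>u| < \<infinity>\<close> and frequencies \<open>u\<close> in \<open>G\<close>. In it the spectral radius of an element is at
  most its supremum norm (\<open>spectral_radius\<close>): the \<open>n\<close>-th power of a polynomial with \<open>N\<close> terms has at most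
  \<open>(n + 1)\<^sup>N\<close> frequencies, and Bessel's inequality bounds its coefficients. Hence an element \<open>f\<close> with
  \<open>|f| \<ge> \<delta> > 0\<close> is invertible, by a geometric series in \<open>1 - |f|\<^sup>2 / K\<^sup>2\<close> (\<open>ap_inverse\<close>). A polynomial \<open>P\<close>
  with \<open>|P| \<ge> \<delta> > 0\<close> has the form \<open>C cis(t\<gamma>) exp g\<close>. No topology of the torus is needed for this: every
  additive \<open>\<phi> :: real \<Rightarrow> real\<close> gives a derivation multiplying the coefficient at \<open>u\<close> by \<open>\<phi> u\<close>; the logarithmic
  derivatives of \<open>P\<close> are compatible with each other, so they integrate to some \<open>g\<close>; and \<open>P exp(-g)\<close>, an
  eigenvector of all derivations, is a single exponential (\<open>smooth_exponential_form\<close>). A general \<open>f\<close> is a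
  small perturbation of such a \<open>P\<close>, and \<open>log(f / P)\<close> is given by its power series
  (\<open>wiener_levy_exponential_form\<close>). Since \<open>f(-t)\<close> is the conjugate of \<open>f(t)\<close>, the coefficients can be replaced
  by their real parts.

  \<^emph>\<open>Converse.\<close> The Stieltjes integral against the pure jump function with jumps \<open>\<lambda>\<^sub>u\<close> is the series
  \<open>\<Sum> \<lambda>\<^sub>u h(u)\<close>, and the total variation of this jump function has the jumps \<open>|\<lambda>\<^sub>u|\<close>. So the jump function is
  a Levy spectral function, and the exponential form is its Levy representation with \<open>\<sigma> = 0\<close>.
\<close>

section \<open>Absolutely convergent trigonometric series\<close>

lemma cesaro_geometric_tendsto_0:
  fixes z :: complex
  assumes "norm z = 1" "z \<noteq> 1"
  shows "(\<lambda>N. (\<Sum>n<N. z ^ n) / of_nat N) \<longlonglongrightarrow> 0"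
proof (rule Lim_null_comparison)
  have b: "norm (\<Sum>n<N. z ^ n) \<le> 2 / norm (1 - z)" for N
  proof -
    have "norm (1 - z ^ N) \<le> norm (1::complex) + norm (z ^ N)"
      by (rule norm_triangle_ineq4)
    then have "norm (1 - z ^ N) \<le> 2"
      using assms by (simp add: norm_power)
    then show ?thesis
      using assms by (simp add: sum_gp_strict norm_divide divide_right_mono)
  qed
  show "\<forall>\<^sub>F N in sequentially. norm ((\<Sum>n<N. z ^ n) / of_nat N) \<le> (2 / norm (1 - z)) / real N"
    using divide_right_mono[OF b] by (simp add: norm_divide del: divide_divide_eq_left)
  show "(\<lambda>N. (2 / norm (1 - z)) / real N) \<longlonglongrightarrow> 0"
    by (rule lim_const_over_n)
qed

text \<open>A step \<open>h\<close> so small that distinct frequencies remain distinct on the progression \<open>n h\<close>.\<close>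
lemma exists_nonresonant_step:
  fixes W :: "real set"
  assumes "finite W"
  obtains h :: real where "\<And>u v. u \<in> W \<Longrightarrow> v \<in> W \<Longrightarrow> u \<noteq> v \<Longrightarrow> cis (h * (u - v)) \<noteq> 1"
proof -
  define K where "K = (\<Sum>u\<in>W. \<bar>u\<bar>)"
  define h where "h = 1 / (1 + 2 * K)"
  have K: "\<bar>u\<bar> \<le> K" if "u \<in> W" for u
    using assms that unfolding K_def by (intro member_le_sum) auto
  show ?thesis
  proof
    fix u v assume uv: "u \<in> W" "v \<in> W" "u \<noteq> v"
    have "K \<ge> 0"
      using K[OF uv(1)] by linarith
    have "\<bar>u - v\<bar> \<le> 2 * K"
      using K[OF uv(1)] K[OF uv(2)] by linarith
    then have less: "\<bar>h * (u - v)\<bar> < 1"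
      using \<open>K \<ge> 0\<close> by (simp add: h_def abs_mult field_simps)
    have "h * (u - v) \<noteq> 0"
      using uv \<open>K \<ge> 0\<close> by (simp add: h_def)
    then have "sin (h * (u - v)) \<noteq> 0"
      using sin_eq_0_pi[of "h * (u - v)"] less pi_gt3 by (auto simp: abs_less_iff)
    then show "cis (h * (u - v)) \<noteq> 1"
      by (metis cis.sel(2) one_complex.sel(2))
  qed
qed

text \<open>Bessel's inequality. The mean value of \<open>|T|\<^sup>2\<close> is taken along an arithmetic progression with a
  nonresonant step, so that all cross terms average to 0.\<close>
lemma Bessel_trig_polynomial:
  fixes c :: "real \<Rightarrow> complex"
  assumes fin: "finite W" and M: "\<And>t. norm (\<Sum>u\<in>W. c u * cis (t * u)) \<le> M"
  shows "(\<Sum>u\<in>W. (norm (c u))\<^sup>2) \<le> M\<^sup>2"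
proof -
  obtain h where h: "\<And>u v. u \<in> W \<Longrightarrow> v \<in> W \<Longrightarrow> u \<noteq> v \<Longrightarrow> cis (h * (u - v)) \<noteq> 1"
    using exists_nonresonant_step[OF fin] by blast
  define T where "T n = (\<Sum>u\<in>W. c u * cis ((real n * h) * u))" for n
  define z where "z u v = cis (h * (u - v))" for u v
  have TT: "T n * cnj (T n) = (\<Sum>u\<in>W. \<Sum>v\<in>W. (c u * cnj (c v)) * z u v ^ n)" for n
  proof -
    have "T n * cnj (T n)
        = (\<Sum>u\<in>W. \<Sum>v\<in>W. (c u * cis ((real n * h) * u)) * cnj (c v * cis ((real n * h) * v)))"
      by (simp add: T_def sum_product)
    also have "\<dots> = (\<Sum>u\<in>W. \<Sum>v\<in>W. (c u * cnj (c v)) * z u v ^ n)"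
    proof (intro sum.cong refl)
      fix u v
      have "z u v ^ n = cis (real n * h * u) * cis (- (real n * h * v))"
        unfolding cis_mult z_def Complex.DeMoivre by (rule arg_cong[of _ _ cis]) (simp add: algebra_simps)
      then show "(c u * cis ((real n * h) * u)) * cnj (c v * cis ((real n * h) * v))
          = (c u * cnj (c v)) * z u v ^ n"
          by (simp add: cis_cnj)
    qed
    finally show ?thesis .
  qed
  have lim: "(\<lambda>N. (\<Sum>n<N. z u v ^ n) / of_nat N) \<longlonglongrightarrow> (if u = v then 1 else 0)"
    if "u \<in> W" "v \<in> W" for u v
  proof (cases "u = v")
    case True
    have "(\<lambda>N. (\<Sum>n<N. z u v ^ n) / of_nat N) = (\<lambda>N. of_nat N / of_nat N :: complex)"
      using True by (simp add: z_def)
    moreover have "(\<lambda>N. of_nat N / of_nat N :: complex) \<longlonglongrightarrow> 1"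
      by (rule tendsto_eventually) (auto simp: eventually_at_top_linorder intro: exI[of _ 1])
    ultimately show ?thesis
      using True by simp
  next
    case False
    then show ?thesis
      using cesaro_geometric_tendsto_0[of "z u v"] h that by (simp add: z_def)
  qed
  have "(\<lambda>N. \<Sum>u\<in>W. \<Sum>v\<in>W. (c u * cnj (c v)) * ((\<Sum>n<N. z u v ^ n) / of_nat N))
      \<longlonglongrightarrow> (\<Sum>u\<in>W. \<Sum>v\<in>W. (c u * cnj (c v)) * (if u = v then 1 else 0))"
    by (intro tendsto_sum tendsto_mult tendsto_const lim)
  also have "(\<Sum>u\<in>W. \<Sum>v\<in>W. (c u * cnj (c v)) * (if u = v then 1 else 0))
      = of_real (\<Sum>u\<in>W. (norm (c u))\<^sup>2)"
    using fin by (simp add: if_distrib sum.delta complex_norm_square del: of_real_power cong: if_cong)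
  also have "(\<lambda>N. \<Sum>u\<in>W. \<Sum>v\<in>W. (c u * cnj (c v)) * ((\<Sum>n<N. z u v ^ n) / of_nat N))
      = (\<lambda>N. of_real ((\<Sum>n<N. (norm (T n))\<^sup>2) / real N))"
  proof
    fix N
    have "(\<Sum>n<N. T n * cnj (T n)) = (\<Sum>u\<in>W. \<Sum>v\<in>W. (c u * cnj (c v)) * (\<Sum>n<N. z u v ^ n))"
      unfolding TT sum_distrib_left
      by (subst sum.swap, intro sum.cong refl, subst sum.swap) simp
    then have "of_real (\<Sum>n<N. (norm (T n))\<^sup>2)
        = (\<Sum>u\<in>W. \<Sum>v\<in>W. (c u * cnj (c v)) * (\<Sum>n<N. z u v ^ n))"
      by (simp add: complex_norm_square del: of_real_power)
    then show "(\<Sum>u\<in>W. \<Sum>v\<in>W. (c u * cnj (c v)) * ((\<Sum>n<N. z u v ^ n) / of_nat N))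
        = of_real ((\<Sum>n<N. (norm (T n))\<^sup>2) / real N)"
      by (simp add: sum_divide_distrib[symmetric])
  qed
  finally have lim2: "(\<lambda>N. (\<Sum>n<N. (norm (T n))\<^sup>2) / real N) \<longlonglongrightarrow> (\<Sum>u\<in>W. (norm (c u))\<^sup>2)"
    by (simp only: tendsto_of_real_iff)
  show ?thesis
  proof (rule LIMSEQ_le_const2[OF lim2], intro exI[of _ 1] allI impI)
    fix N :: nat assume "1 \<le> N"
    have "(\<Sum>n<N. (norm (T n))\<^sup>2) \<le> (\<Sum>n<N. M\<^sup>2)"
      by (intro sum_mono power_mono) (simp_all add: T_def M)
    then show "(\<Sum>n<N. (norm (T n))\<^sup>2) / real N \<le> M\<^sup>2"
      using \<open>1 \<le> N\<close> by (simp add: field_simps)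
  qed
qed

text \<open>The sum of the trigonometric series with coefficient \<open>c u\<close> at the frequency \<open>u\<close>, over all real
  frequencies; only countably many coefficients of a summable family are nonzero.\<close>
definition trig :: "(real \<Rightarrow> complex) \<Rightarrow> real \<Rightarrow> complex" where
  "trig c t = (\<Sum>\<^sub>\<infinity>u. c u * cis (t * u))"

text \<open>Absolute summability, spelled out as summability of the norms.\<close>
abbreviation absum :: "('a \<Rightarrow> 'b::real_normed_vector) \<Rightarrow> 'a set \<Rightarrow> bool" where
  "absum f A \<equiv> (\<lambda>x. norm (f x)) summable_on A"

lemmas absum_comparison = Infinite_Sum.abs_summable_on_comparison_test
lemmas absum_comparison' = Infinite_Sum.abs_summable_on_comparison_test'

abbreviation ell1 :: "(real \<Rightarrow> complex) \<Rightarrow> bool" where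
  "ell1 c \<equiv> absum c UNIV"

abbreviation abs_summable :: "(real \<Rightarrow> real) \<Rightarrow> bool" where
  "abs_summable l \<equiv> (\<lambda>u. \<bar>l u\<bar>) summable_on UNIV"

abbreviation l1norm :: "(real \<Rightarrow> complex) \<Rightarrow> real" where
  "l1norm c \<equiv> \<Sum>\<^sub>\<infinity>u. norm (c u)"

lemma ell1_trig_abs_summable: "ell1 c \<Longrightarrow> absum (\<lambda>u. c u * cis (t * u)) (A)"
  by (simp add: norm_mult summable_on_subset_banach[of _ UNIV])

lemma ell1_trig_summable: "ell1 c \<Longrightarrow> (\<lambda>u. c u * cis (t * u)) summable_on A"
  by (rule abs_summable_summable[OF ell1_trig_abs_summable])

lemma norm_trig_le: "ell1 c \<Longrightarrow> norm (trig c t) \<le> l1norm c"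
  unfolding trig_def using norm_infsum_bound[OF ell1_trig_abs_summable, of c t UNIV] by (simp add: norm_mult)

lemma ell1_add: "ell1 c \<Longrightarrow> ell1 d \<Longrightarrow> ell1 (\<lambda>u. c u + d u)"
  by (rule absum_comparison'[OF summable_on_add, of "\<lambda>u. norm (c u)" _ "\<lambda>u. norm (d u)"])
     (auto intro: norm_triangle_ineq)

lemma ell1_cmult: "ell1 c \<Longrightarrow> ell1 (\<lambda>u. a * c u)"
  by (simp add: norm_mult summable_on_cmult_right)

lemma trig_add: "ell1 c \<Longrightarrow> ell1 d \<Longrightarrow> trig (\<lambda>u. c u + d u) t = trig c t + trig d t"
  unfolding trig_def by (simp add: distrib_right infsum_add ell1_trig_summable)

lemma trig_cmult: "trig (\<lambda>u. a * c u) t = a * trig c t"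
  unfolding trig_def by (simp add: mult.assoc infsum_cmult_right')

lemma trig_finite_support:
  assumes "finite W" "\<And>u. u \<notin> W \<Longrightarrow> c u = 0"
  shows "ell1 c" and "trig c t = (\<Sum>u\<in>W. c u * cis (t * u))"
    and "l1norm c = (\<Sum>u\<in>W. norm (c u))"
proof -
  show "ell1 c"
    using assms by (subst summable_on_cong_neutral[where T = W and g = "\<lambda>u. norm (c u)"]) auto
  have "trig c t = infsum (\<lambda>u. c u * cis (t * u)) W"
    unfolding trig_def using assms by (intro infsum_cong_neutral) auto
  then show "trig c t = (\<Sum>u\<in>W. c u * cis (t * u))"
    using assms by simp
  have "l1norm c = infsum (\<lambda>u. norm (c u)) W"
    using assms by (intro infsum_cong_neutral) auto
  then show "l1norm c = (\<Sum>u\<in>W. norm (c u))"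
    using assms by simp
qed

lemma ell1_split_finite:
  assumes "ell1 c" "e > 0"
  obtains S where "finite S" "(\<Sum>\<^sub>\<infinity>u\<in>-S. norm (c u)) < e"
proof -
  obtain S where S: "finite S" "dist (\<Sum>u\<in>S. norm (c u)) (l1norm c) \<le> e / 2"
    using infsum_finite_approximation[of "\<lambda>u. norm (c u)" UNIV "e/2"] assms by auto
  have "l1norm c = (\<Sum>\<^sub>\<infinity>u\<in>S. norm (c u)) + (\<Sum>\<^sub>\<infinity>u\<in>-S. norm (c u))"
    using infsum_Un_disjoint[of "\<lambda>u. norm (c u)" S "-S"] assms
    by (metis Compl_disjoint Compl_partition subset_UNIV summable_on_subset_banach)
  then have "(\<Sum>\<^sub>\<infinity>u\<in>-S. norm (c u)) < e"
    using S assms(2) by (simp add: dist_real_def)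
  with S show ?thesis using that by blast
qed

text \<open>A summable family is a finitely supported one plus one of small norm.\<close>
lemma ell1_split:
  assumes c: "ell1 c" and "e > 0"
  shows "\<exists>S a b. finite S \<and> a = (\<lambda>u. if u \<in> S then c u else 0) \<and> b = (\<lambda>u. if u \<in> S then 0 else c u) \<and>
    ell1 a \<and> ell1 b \<and> l1norm b < e \<and> (\<forall>t. trig c t = trig a t + trig b t)"
proof -
  obtain S where S: "finite S" "(\<Sum>\<^sub>\<infinity>u\<in>-S. norm (c u)) < e"
    using ell1_split_finite[OF assms] .
  define a b where "a = (\<lambda>u. if u \<in> S then c u else 0)" and "b = (\<lambda>u. if u \<in> S then 0 else c u)"
  have l: "ell1 a" "ell1 b"
    by (rule absum_comparison[OF c]; simp add: a_def b_def)+
  have "l1norm b = (\<Sum>\<^sub>\<infinity>u\<in>-S. norm (c u))"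
    by (rule infsum_cong_neutral) (auto simp: b_def)
  then have n: "l1norm b < e" using S(2) by simp
  have "c = (\<lambda>u. a u + b u)"
    by (auto simp: a_def b_def)
  then have t: "trig c t = trig a t + trig b t" for t
    using trig_add[OF l, of t] by metis
  show ?thesis
    by (rule exI[of _ S], rule exI[of _ a], rule exI[of _ b])
       (intro conjI S(1) l n allI t, simp_all only: a_def b_def)
qed

text \<open>Uniqueness of coefficients: if the series vanishes, its finite part is as small as the remainder, and
  Bessel's inequality makes each coefficient small.\<close>
lemma trig_eq_0_imp:
  assumes "ell1 c" "\<And>t. trig c t = 0"
  shows "c u = 0"
proof (rule ccontr)
  assume "c u \<noteq> 0"
  then have pos: "norm (c u) / 3 > 0" by simp
  obtain S a b where S: "finite S" and ab: "a = (\<lambda>u. if u \<in> S then c u else 0)" "b = (\<lambda>u. if u \<in> S then 0 else c u)"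
    and l: "ell1 a" "ell1 b" and bn: "l1norm b < norm (c u) / 3"
    and t: "\<And>t. trig c t = trig a t + trig b t"
    using ell1_split[OF assms(1) pos] by blast
  have a0: "a v = 0" if "v \<notin> S" for v using that by (simp add: ab(1))
  have "norm (trig a t) \<le> norm (c u) / 3" for t
  proof -
    have "trig a t = - trig b t"
      using t[of t] assms(2) by (simp add: eq_neg_iff_add_eq_0)
    then show ?thesis
      using norm_trig_le[OF l(2), of t] bn by simp
  qed
  then have *: "(\<Sum>v\<in>S. (norm (a v))\<^sup>2) \<le> (norm (c u) / 3)\<^sup>2"
    using trig_finite_support(2)[of S a, OF S a0] by (intro Bessel_trig_polynomial S) simp
  have "norm (a u) \<le> norm (c u) / 3"
  proof (cases "u \<in> S")
    case True
    then have "(norm (a u))\<^sup>2 \<le> (\<Sum>v\<in>S. (norm (a v))\<^sup>2)"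
      using S by (intro member_le_sum) auto
    then have "(norm (a u))\<^sup>2 \<le> (norm (c u) / 3)\<^sup>2"
      using * by linarith
    then show ?thesis by (rule power2_le_imp_le) simp
  qed (use a0 in auto)
  moreover have "norm (b u) \<le> l1norm b"
    using finite_sum_le_infsum[of "\<lambda>u. norm (b u)" UNIV "{u}"] l(2) by simp
  moreover have "norm (c u) \<le> norm (a u) + norm (b u)"
    by (simp add: ab)
  ultimately show False
    using bn pos by linarith
qed

lemma trig_inject:
  assumes "ell1 c" "ell1 d" "trig c = trig d"
  shows "c = d"
proof
  fix u
  have e: "ell1 (\<lambda>u. - 1 * d u)"
    using ell1_cmult[OF assms(2), of "-1"] .
  have "trig (\<lambda>u. c u + - 1 * d u) t = 0" for t
    unfolding trig_add[OF assms(1) e] using trig_cmult[of "-1" d t] assms(3) by simp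
  then show "c u = d u"
    using trig_eq_0_imp[OF ell1_add[OF assms(1) e], of u] by simp
qed

text \<open>Products of series correspond to convolutions of coefficients. The last clause makes the convolution
  sums themselves absolutely convergent.\<close>
lemma ell1_conv:
  fixes c d :: "real \<Rightarrow> complex"
  assumes c: "ell1 c" and d: "ell1 d"
  defines "e \<equiv> (\<lambda>w. \<Sum>\<^sub>\<infinity>u. c u * d (w - u))"
  shows "ell1 e" and "trig e t = trig c t * trig d t"
    and "l1norm e \<le> l1norm c * l1norm d"
    and "absum (\<lambda>u. c u * d (w - u)) (UNIV)"
proof -
  have bij: "bij_betw (\<lambda>w. w - u) UNIV (UNIV :: real set)" for u :: real
    by (rule bij_betw_byWitness[where f' = "\<lambda>w. w + u"]) auto
  have in1: "(\<lambda>w. norm (c u * d (w - u))) summable_on UNIV" for u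
    using summable_on_cmult_right[OF d, of "norm (c u)"]
      summable_on_reindex_bij_betw[OF bij, of "\<lambda>w. norm (c u) * norm (d w)" u]
    by (simp add: norm_mult)
  have in2: "(\<Sum>\<^sub>\<infinity>w. norm (c u * d (w - u))) = norm (c u) * l1norm d" for u
    using infsum_reindex_bij_betw[OF bij, of "\<lambda>w. norm (c u) * norm (d w)" u]
    by (simp add: norm_mult infsum_cmult_right')
  have S: "absum (\<lambda>(u, w). c u * d (w - u)) (UNIV \<times> UNIV)"
    unfolding Infinite_Sum.abs_summable_on_Sigma_iff
  proof (intro conjI ballI)
    show "absum (\<lambda>y. case (u, y) of (u, w) \<Rightarrow> c u * d (w - u)) (UNIV)" for u
      using in1[of u] by simp
    show "absum (\<lambda>u. \<Sum>\<^sub>\<infinity>y. norm (case (u, y) of (u, w) \<Rightarrow> c u * d (w - u))) (UNIV)"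
      using summable_on_cmult_left[OF c, of "\<Sum>\<^sub>\<infinity>w. norm (d w)"]
      by (simp add: in2 abs_mult infsum_nonneg)
  qed
  then have S': "(\<lambda>(u, w). norm (c u * d (w - u))) summable_on UNIV \<times> UNIV"
    by (simp add: case_prod_unfold)
  have Ssw: "(\<lambda>(w, u). norm (c u * d (w - u))) summable_on UNIV \<times> UNIV"
    using S' summable_on_swap[of "\<lambda>(u, w). norm (c u * d (w - u))" UNIV UNIV] by (simp add: case_prod_unfold)
  then have Ssw': "absum (\<lambda>(w, u). c u * d (w - u)) (UNIV \<times> UNIV)"
    by (simp add: case_prod_unfold)
  show w: "absum (\<lambda>u. c u * d (w - u)) (UNIV)" for w
    using Ssw' unfolding Infinite_Sum.abs_summable_on_Sigma_iff by auto
  have sumw: "(\<lambda>w. \<Sum>\<^sub>\<infinity>u. norm (c u * d (w - u))) summable_on UNIV"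
    by (rule summable_on_Sigma_banach[OF Ssw])
  have le: "norm (e w) \<le> (\<Sum>\<^sub>\<infinity>u. norm (c u * d (w - u)))" for w
    unfolding e_def by (rule norm_infsum_bound[OF w])
  show ell1e: "ell1 e"
    by (rule absum_comparison'[OF sumw le])
  have "l1norm e \<le> (\<Sum>\<^sub>\<infinity>w. \<Sum>\<^sub>\<infinity>u. norm (c u * d (w - u)))"
    by (rule infsum_mono[OF ell1e sumw le])
  also have "\<dots> = (\<Sum>\<^sub>\<infinity>u. \<Sum>\<^sub>\<infinity>w. norm (c u * d (w - u)))"
    by (rule infsum_swap_banach[OF Ssw])
  also have "\<dots> = l1norm c * l1norm d"
    by (simp add: in2 infsum_cmult_left')
  finally show "l1norm e \<le> l1norm c * l1norm d" .
  have T: "(\<lambda>(w, u). c u * d (w - u) * cis (t * w)) summable_on UNIV \<times> UNIV"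
    by (rule abs_summable_summable, rule summable_on_cong[THEN iffD1, OF _ Ssw])
       (auto simp: norm_mult)
  have "trig e t = (\<Sum>\<^sub>\<infinity>w. \<Sum>\<^sub>\<infinity>u. c u * d (w - u) * cis (t * w))"
    unfolding trig_def e_def by (simp add: infsum_cmult_left')
  also have "\<dots> = (\<Sum>\<^sub>\<infinity>u. \<Sum>\<^sub>\<infinity>w. c u * d (w - u) * cis (t * w))"
    by (rule infsum_swap_banach[OF T])
  also have "\<dots> = (\<Sum>\<^sub>\<infinity>u. c u * cis (t * u) * trig d t)"
  proof (rule infsum_cong)
    fix u
    have "(\<Sum>\<^sub>\<infinity>w. c u * d (w - u) * cis (t * w))
        = (\<Sum>\<^sub>\<infinity>w. (\<lambda>v. c u * cis (t * u) * (d v * cis (t * v))) (w - u))"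
    proof (rule infsum_cong)
      fix w
      have "cis (t * w) = cis (t * u) * cis (t * (w - u))"
        unfolding cis_mult by (simp add: algebra_simps)
      then show "c u * d (w - u) * cis (t * w) = c u * cis (t * u) * (d (w - u) * cis (t * (w - u)))"
        by simp
    qed
    also have "\<dots> = (\<Sum>\<^sub>\<infinity>v. c u * cis (t * u) * (d v * cis (t * v)))"
      by (rule infsum_reindex_bij_betw[OF bij])
    also have "\<dots> = c u * cis (t * u) * trig d t"
      by (simp add: infsum_cmult_right' trig_def)
    finally show "(\<Sum>\<^sub>\<infinity>w. c u * d (w - u) * cis (t * w)) = c u * cis (t * u) * trig d t" .
  qed
  also have "\<dots> = trig c t * trig d t"
    by (simp add: trig_def infsum_cmult_left')
  finally show "trig e t = trig c t * trig d t" .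
qed

text \<open>Countable sums of series whose norms are dominated by a summable sequence.\<close>
lemma ell1_suminf:
  fixes c :: "nat \<Rightarrow> real \<Rightarrow> complex"
  assumes c: "\<And>n. ell1 (c n)" and B: "\<And>n. (\<Sum>\<^sub>\<infinity>u. norm (c n u)) \<le> B n" and sB: "summable B"
  defines "e \<equiv> (\<lambda>u. \<Sum>n. c n u)"
  shows "ell1 e" and "(\<lambda>n. trig (c n) t) sums trig e t"
    and "\<And>u. (\<lambda>n. c n u) sums e u"
proof -
  let ?N = "\<lambda>n. \<Sum>\<^sub>\<infinity>u. norm (c n u)"
  have N0: "0 \<le> ?N n" for n by (simp add: infsum_nonneg)
  have sN: "summable ?N"
    by (rule summable_comparison_test'[OF sB, of 0]) (use N0 B in auto)
  then have sN': "?N summable_on UNIV"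
    by (rule summable_nonneg_imp_summable_on) (simp add: N0)
  have S: "absum (\<lambda>(n, u). c n u) (UNIV \<times> UNIV)"
    unfolding Infinite_Sum.abs_summable_on_Sigma_iff using c sN' by (simp add: N0)
  then have S': "(\<lambda>(n, u). norm (c n u)) summable_on UNIV \<times> UNIV"
    by (simp add: case_prod_unfold)
  have Ssw: "(\<lambda>(u, n). norm (c n u)) summable_on UNIV \<times> UNIV"
    using S' summable_on_swap[of "\<lambda>(n, u). norm (c n u)" UNIV UNIV] by (simp add: case_prod_unfold)
  then have Ssw': "absum (\<lambda>(u, n). c n u) (UNIV \<times> UNIV)"
    by (simp add: case_prod_unfold)
  have w: "absum (\<lambda>n. c n u) (UNIV)" for u
    using Ssw' unfolding Infinite_Sum.abs_summable_on_Sigma_iff by auto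
  have sums: "(\<lambda>n. c n u) sums (\<Sum>\<^sub>\<infinity>n. c n u)" for u
    by (rule has_sum_imp_sums, rule has_sum_infsum, rule abs_summable_summable[OF w])
  then have e: "e u = (\<Sum>\<^sub>\<infinity>n. c n u)" for u
    unfolding e_def by (simp add: sums_iff)
  show "(\<lambda>n. c n u) sums e u" for u
    using sums e by simp
  have sumw: "(\<lambda>u. \<Sum>\<^sub>\<infinity>n. norm (c n u)) summable_on UNIV"
    by (rule summable_on_Sigma_banach[OF Ssw])
  have le: "norm (e u) \<le> (\<Sum>\<^sub>\<infinity>n. norm (c n u))" for u
    unfolding e by (rule norm_infsum_bound[OF w])
  show ell1e: "ell1 e"
    by (rule absum_comparison'[OF sumw le])
  have T: "absum (\<lambda>(n, u). c n u * cis (t * u)) (UNIV \<times> UNIV)"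
    by (rule summable_on_cong[THEN iffD1, OF _ S']) (auto simp: norm_mult)
  have T2: "(\<lambda>n. trig (c n) t) summable_on UNIV"
    unfolding trig_def by (rule summable_on_Sigma_banach[OF abs_summable_summable[OF T]])
  have "(\<Sum>\<^sub>\<infinity>n. trig (c n) t) = (\<Sum>\<^sub>\<infinity>u. \<Sum>\<^sub>\<infinity>n. c n u * cis (t * u))"
    unfolding trig_def by (rule infsum_swap_banach[OF abs_summable_summable[OF T]])
  also have "\<dots> = trig e t"
    by (simp add: trig_def e infsum_cmult_left')
  finally show "(\<lambda>n. trig (c n) t) sums trig e t"
    using has_sum_imp_sums[OF has_sum_infsum[OF T2]] by simp
qed

section \<open>The Wiener algebra of almost periodic functions\<close>

text \<open>\<open>ap W f\<close>: the function \<open>f\<close> is an absolutely convergent trigonometric series with all its frequencies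
  in \<open>W\<close>.\<close>
definition ap :: "real set \<Rightarrow> (real \<Rightarrow> complex) \<Rightarrow> bool" where
  "ap W f \<longleftrightarrow> (\<exists>c. ell1 c \<and> (\<forall>u. c u \<noteq> 0 \<longrightarrow> u \<in> W) \<and> f = trig c)"

text \<open>The coefficients of such a function, well defined by uniqueness (and meaningless for other functions),
  and its norm in the algebra, the sum of their absolute values.\<close>
definition coef :: "(real \<Rightarrow> complex) \<Rightarrow> real \<Rightarrow> complex" where
  "coef f = (THE c. ell1 c \<and> f = trig c)"

definition apnorm :: "(real \<Rightarrow> complex) \<Rightarrow> real" where
  "apnorm f = (\<Sum>\<^sub>\<infinity>u. norm (coef f u))"

lemma coef_trig: "ell1 c \<Longrightarrow> coef (trig c) = c"
  unfolding coef_def by (rule the_equality) (auto intro: trig_inject)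

lemma apI: "ell1 c \<Longrightarrow> (\<And>u. c u \<noteq> 0 \<Longrightarrow> u \<in> W) \<Longrightarrow> (\<And>t. f t = trig c t) \<Longrightarrow> ap W f"
  unfolding ap_def by blast

lemma coef_eqI: "ell1 c \<Longrightarrow> (\<And>t. f t = trig c t) \<Longrightarrow> coef f = c"
  using coef_trig[of c] by (metis ext)

lemma ap_coef:
  assumes "ap W f"
  shows "ell1 (coef f)" "f = trig (coef f)" "coef f u \<noteq> 0 \<Longrightarrow> u \<in> W" "\<And>A. coef f summable_on A"
proof -
  obtain c where "ell1 c" "\<forall>u. c u \<noteq> 0 \<longrightarrow> u \<in> W" "f = trig c"
    using assms unfolding ap_def by blast
  then show 1: "ell1 (coef f)" "f = trig (coef f)" "coef f u \<noteq> 0 \<Longrightarrow> u \<in> W"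
    by (auto simp: coef_trig)
  show "coef f summable_on A" for A
    by (rule summable_on_subset_banach[OF abs_summable_summable[OF 1(1)]]) simp
qed

lemma ap_mono: "ap V f \<Longrightarrow> V \<subseteq> W \<Longrightarrow> ap W f"
  unfolding ap_def by blast

lemma apnorm_nonneg [simp]: "0 \<le> apnorm f"
  unfolding apnorm_def by (rule infsum_nonneg) simp

lemma norm_le_apnorm: "ap W f \<Longrightarrow> norm (f t) \<le> apnorm f"
  unfolding apnorm_def by (subst ap_coef(2)) (auto intro: norm_trig_le dest: ap_coef(1))

lemma
  assumes f: "ap A f" and g: "ap B g"
  shows ap_mult: "ap {a + b |a b. a \<in> A \<and> b \<in> B} (\<lambda>t. f t * g t)"
    and coef_mult: "coef (\<lambda>t. f t * g t) = (\<lambda>w. \<Sum>\<^sub>\<infinity>u. coef f u * coef g (w - u))"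
    and apnorm_mult: "apnorm (\<lambda>t. f t * g t) \<le> apnorm f * apnorm g"
proof -
  let ?e = "\<lambda>w. \<Sum>\<^sub>\<infinity>u. coef f u * coef g (w - u)"
  note cf = ap_coef[OF f] and cg = ap_coef[OF g]
  note conv = ell1_conv[OF cf(1) cg(1)]
  have fg: "f t * g t = trig ?e t" for t
    using conv(2)[of t] cf(2) cg(2) by simp
  show c: "coef (\<lambda>t. f t * g t) = ?e"
    by (rule coef_eqI[OF conv(1) fg])
  show "ap {a + b |a b. a \<in> A \<and> b \<in> B} (\<lambda>t. f t * g t)"
  proof (rule apI[OF conv(1) _ fg])
    fix w assume "?e w \<noteq> 0"
    then obtain u where "coef f u * coef g (w - u) \<noteq> 0"
      by (metis (no_types, lifting) infsum_0)
    then have "u \<in> A" "w - u \<in> B"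
      using cf(3) cg(3) by auto
    then show "w \<in> {a + b |a b. a \<in> A \<and> b \<in> B}"
      by (intro CollectI exI[of _ u] exI[of _ "w - u"]) simp
  qed
  show "apnorm (\<lambda>t. f t * g t) \<le> apnorm f * apnorm g"
    unfolding apnorm_def c by (rule conv(3))
qed

lemma
  assumes f: "ap W f" and g: "ap W g"
  shows ap_add: "ap W (\<lambda>t. f t + g t)"
    and coef_add: "coef (\<lambda>t. f t + g t) = (\<lambda>u. coef f u + coef g u)"
    and apnorm_add: "apnorm (\<lambda>t. f t + g t) \<le> apnorm f + apnorm g"
proof -
  note cf = ap_coef[OF f] and cg = ap_coef[OF g]
  note e = ell1_add[OF cf(1) cg(1)]
  have fg: "f t + g t = trig (\<lambda>u. coef f u + coef g u) t" for t
    using trig_add[OF cf(1) cg(1), of t] cf(2) cg(2) by simp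
  show c: "coef (\<lambda>t. f t + g t) = (\<lambda>u. coef f u + coef g u)"
    by (rule coef_eqI[OF e fg])
  show "ap W (\<lambda>t. f t + g t)"
    by (rule apI[OF e _ fg]) (metis cf(3) cg(3) add_0)
  have "(\<Sum>\<^sub>\<infinity>u. norm (coef f u + coef g u)) \<le> (\<Sum>\<^sub>\<infinity>u. norm (coef f u) + norm (coef g u))"
    by (rule infsum_mono[OF e summable_on_add[OF cf(1) cg(1)]]) (rule norm_triangle_ineq)
  then show "apnorm (\<lambda>t. f t + g t) \<le> apnorm f + apnorm g"
    unfolding apnorm_def c using infsum_add[OF cf(1) cg(1)] by simp
qed

lemma
  assumes f: "ap W f"
  shows ap_cmult: "ap W (\<lambda>t. a * f t)"
    and coef_cmult: "coef (\<lambda>t. a * f t) = (\<lambda>u. a * coef f u)"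
    and apnorm_cmult: "apnorm (\<lambda>t. a * f t) = norm a * apnorm f"
proof -
  note cf = ap_coef[OF f]
  note e = ell1_cmult[OF cf(1), of a]
  have fg: "a * f t = trig (\<lambda>u. a * coef f u) t" for t
    using trig_cmult[of a "coef f" t] cf(2) by simp
  show c: "coef (\<lambda>t. a * f t) = (\<lambda>u. a * coef f u)"
    by (rule coef_eqI[OF e fg])
  show "ap W (\<lambda>t. a * f t)"
    by (rule apI[OF e _ fg]) (metis cf(3) mult_zero_right)
  show "apnorm (\<lambda>t. a * f t) = norm a * apnorm f"
    unfolding apnorm_def c norm_mult by (rule infsum_cmult_right')
qed

lemma
  shows ap_cis: "u \<in> W \<Longrightarrow> ap W (\<lambda>t. a * cis (t * u))"
    and coef_cis: "coef (\<lambda>t. a * cis (t * u)) = (\<lambda>v. if v = u then a else 0)"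
proof -
  let ?c = "\<lambda>v. if v = u then a else 0"
  have s: "finite {u}" "\<And>v. v \<notin> {u} \<Longrightarrow> ?c v = 0"
    by auto
  have fg: "a * cis (t * u) = trig ?c t" for t
    using trig_finite_support(2)[OF s] by simp
  show c: "coef (\<lambda>t. a * cis (t * u)) = ?c"
    by (rule coef_eqI[OF trig_finite_support(1)[OF s] fg])
  show "ap W (\<lambda>t. a * cis (t * u))" if "u \<in> W"
    by (rule apI[OF trig_finite_support(1)[OF s] _ fg]) (use that in \<open>auto split: if_splits\<close>)
qed

lemma
  shows ap_const: "0 \<in> W \<Longrightarrow> ap W (\<lambda>t. a)"
    and coef_const: "coef (\<lambda>t. a) = (\<lambda>v. if v = 0 then a else 0)"
    and apnorm_const: "apnorm (\<lambda>t. a) = norm a"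
proof -
  show "0 \<in> W \<Longrightarrow> ap W (\<lambda>t. a)"
    using ap_cis[of 0 W a] by simp
  show c: "coef (\<lambda>t. a) = (\<lambda>v. if v = 0 then a else 0)"
    using coef_cis[of a 0] by simp
  have "(\<Sum>\<^sub>\<infinity>u::real. norm (if u = 0 then a else 0)) = (\<Sum>\<^sub>\<infinity>u\<in>{0::real}. norm a)"
    by (rule infsum_cong_neutral) auto
  then show "apnorm (\<lambda>t. a) = norm a"
    unfolding apnorm_def c by simp
qed

lemma
  assumes f: "\<And>i. i \<in> I \<Longrightarrow> ap W (f i)" and I: "finite I"
  shows apnorm_sum: "apnorm (\<lambda>t. \<Sum>i\<in>I. f i t) \<le> (\<Sum>i\<in>I. apnorm (f i))"
proof -
  have z: "ap W (\<lambda>t. 0)"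
    by (rule apI[of "\<lambda>_. 0"]) (auto simp: trig_def)
  have "ap W (\<lambda>t. \<Sum>i\<in>I. f i t) \<and> apnorm (\<lambda>t. \<Sum>i\<in>I. f i t) \<le> (\<Sum>i\<in>I. apnorm (f i))"
    using I f
  proof (induction I rule: finite_induct)
    case empty
    then show ?case using z by (simp add: apnorm_const)
  next
    case (insert i I)
    then have *: "ap W (f i)" "ap W (\<lambda>t. \<Sum>i\<in>I. f i t)"
       "apnorm (\<lambda>t. \<Sum>i\<in>I. f i t) \<le> (\<Sum>i\<in>I. apnorm (f i))"
      by auto
    show ?case
      using insert(1,2) ap_add[OF *(1,2)] apnorm_add[OF *(1,2)] *(3) by simp
  qed
  then show ?thesis by blast
qed

lemma
  fixes f :: "nat \<Rightarrow> real \<Rightarrow> complex"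
  assumes f: "\<And>n. ap W (f n)" and B: "\<And>n. apnorm (f n) \<le> B n" and sB: "summable B"
  shows ap_suminf: "ap W (\<lambda>t. \<Sum>n. f n t)"
    and coef_suminf: "(\<lambda>n. coef (f n) u) sums coef (\<lambda>t. \<Sum>n. f n t) u"
    and ap_summable: "summable (\<lambda>n. f n t)"
proof -
  note cf = ap_coef[OF f]
  let ?e = "\<lambda>u. \<Sum>n. coef (f n) u"
  note S = ell1_suminf[OF cf(1) B[unfolded apnorm_def] sB]
  have st: "(\<lambda>n. f n t) sums trig ?e t" for t
    using S(2)[of t] cf(2) by simp
  have fg: "(\<Sum>n. f n t) = trig ?e t" for t
    using st[of t] by (simp add: sums_iff)
  show "summable (\<lambda>n. f n t)" using st[of t] by (simp add: sums_iff)
  have c: "coef (\<lambda>t. \<Sum>n. f n t) = ?e"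
    by (rule coef_eqI[OF S(1) fg])
  show "(\<lambda>n. coef (f n) u) sums coef (\<lambda>t. \<Sum>n. f n t) u"
    unfolding c by (rule S(3))
  show "ap W (\<lambda>t. \<Sum>n. f n t)"
  proof (rule apI[OF S(1) _ fg])
    fix u assume "?e u \<noteq> 0"
    then obtain n where "coef (f n) u \<noteq> 0"
      by (metis (mono_tags, lifting) suminf_cong suminf_zero)
    then show "u \<in> W" by (rule cf(3))
  qed
qed

text \<open>Subgroups of the additive group of the reals, as sets.\<close>
definition real_subgroup :: "real set \<Rightarrow> bool" where
  "real_subgroup G \<longleftrightarrow> 0 \<in> G \<and> (\<forall>a\<in>G. \<forall>b\<in>G. a + b \<in> G) \<and> (\<forall>a\<in>G. - a \<in> G)"

lemma ap_mult_subgroup: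
  assumes "real_subgroup G" "ap G f" "ap G g"
  shows "ap G (\<lambda>t. f t * g t)"
  by (rule ap_mono[OF ap_mult[OF assms(2,3)]]) (use assms(1) in \<open>auto simp: real_subgroup_def\<close>)

lemma
  assumes G: "real_subgroup G" and f: "ap G f"
  shows ap_power: "ap G (\<lambda>t. f t ^ n)" and apnorm_power: "apnorm (\<lambda>t. f t ^ n) \<le> apnorm f ^ n"
proof -
  have "ap G (\<lambda>t. f t ^ n) \<and> apnorm (\<lambda>t. f t ^ n) \<le> apnorm f ^ n"
  proof (induction n)
    case 0
    then show ?case using G by (simp add: ap_const apnorm_const real_subgroup_def)
  next
    case (Suc n)
    then show ?case
      using ap_mult_subgroup[OF G f, of "\<lambda>t. f t ^ n"] apnorm_mult[OF f, of G "\<lambda>t. f t ^ n"]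
      mult_left_mono[of "apnorm (\<lambda>t. f t ^ n)" "apnorm f ^ n" "apnorm f"]
      by auto
  qed
  then show "ap G (\<lambda>t. f t ^ n)" "apnorm (\<lambda>t. f t ^ n) \<le> apnorm f ^ n" by auto
qed

lemma real_subgroup_UNIV [simp]: "real_subgroup UNIV"
  by (simp add: real_subgroup_def)

section \<open>Derivations\<close>

text \<open>For an additive \<open>\<phi>\<close>, \<open>f'\<close> is the image of \<open>f\<close> under the derivation that multiplies the coefficient at
  \<open>u\<close> by \<open>\<phi> u\<close>. It is a relation, since the coefficients obtained in this way need not be summable. For
  \<open>\<phi> u = u\<close> it is the usual derivative up to the factor \<open>\<i>\<close>.\<close>
definition ap_deriv :: "(real \<Rightarrow> real) \<Rightarrow> (real \<Rightarrow> complex) \<Rightarrow> (real \<Rightarrow> complex) \<Rightarrow> bool" where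
  "ap_deriv \<phi> f f' \<longleftrightarrow> ap UNIV f \<and> ap UNIV f' \<and> (\<forall>u. coef f' u = of_real (\<phi> u) * coef f u)"

lemma ap_deriv_unique: "ap_deriv \<phi> f f' \<Longrightarrow> ap_deriv \<phi> f f'' \<Longrightarrow> f' = f''"
  unfolding ap_deriv_def by (metis ap_coef(2) ext)

lemma ap_deriv_const:
  assumes "\<phi> 0 = 0" shows "ap_deriv \<phi> (\<lambda>t. a) (\<lambda>t. 0)"
  using assms by (simp add: ap_deriv_def ap_const coef_const)

lemma ap_deriv_add:
  assumes "ap_deriv \<phi> f f'" "ap_deriv \<phi> g g'"
  shows "ap_deriv \<phi> (\<lambda>t. f t + g t) (\<lambda>t. f' t + g' t)"
  using assms by (simp add: ap_deriv_def ap_add coef_add[of UNIV] distrib_left)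

lemma ap_deriv_cmult:
  assumes "ap_deriv \<phi> f f'"
  shows "ap_deriv \<phi> (\<lambda>t. a * f t) (\<lambda>t. a * f' t)"
  using assms by (simp add: ap_deriv_def ap_cmult coef_cmult[of UNIV])

text \<open>The Leibniz rule: inside the convolution, \<open>\<phi> w = \<phi> u + \<phi> (w - u)\<close>.\<close>
lemma ap_deriv_mult:
  assumes phi: "\<And>a b. \<phi> (a + b) = \<phi> a + \<phi> b" and f: "ap_deriv \<phi> f f'" and g: "ap_deriv \<phi> g g'"
  shows "ap_deriv \<phi> (\<lambda>t. f t * g t) (\<lambda>t. f' t * g t + f t * g' t)"
proof -
  have ap: "ap UNIV f" "ap UNIV f'" "ap UNIV g" "ap UNIV g'"
    and c: "coef f' u = of_real (\<phi> u) * coef f u" "coef g' u = of_real (\<phi> u) * coef g u" for u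
    using f g by (auto simp: ap_deriv_def)
  note G = real_subgroup_UNIV
  note ap' = ap_mult_subgroup[OF G ap(2,3)] ap_mult_subgroup[OF G ap(1,4)]
  have s1: "(\<lambda>u. coef f' u * coef g (w - u)) summable_on UNIV" for w
    by (rule abs_summable_summable[OF ell1_conv(4)[OF ap_coef(1)[OF ap(2)] ap_coef(1)[OF ap(3)]]])
  have s2: "(\<lambda>u. coef f u * coef g' (w - u)) summable_on UNIV" for w
    by (rule abs_summable_summable[OF ell1_conv(4)[OF ap_coef(1)[OF ap(1)] ap_coef(1)[OF ap(4)]]])
  have "coef (\<lambda>t. f' t * g t + f t * g' t) w = of_real (\<phi> w) * coef (\<lambda>t. f t * g t) w" for w
  proof -
    have "coef (\<lambda>t. f' t * g t + f t * g' t) w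
        = (\<Sum>\<^sub>\<infinity>u. coef f' u * coef g (w - u)) + (\<Sum>\<^sub>\<infinity>u. coef f u * coef g' (w - u))"
      unfolding coef_add[OF ap'] coef_mult[OF ap(2,3)] coef_mult[OF ap(1,4)] ..
    also have "\<dots> = (\<Sum>\<^sub>\<infinity>u. coef f' u * coef g (w - u) + coef f u * coef g' (w - u))"
      by (rule infsum_add[OF s1 s2, symmetric])
    also have "\<dots> = (\<Sum>\<^sub>\<infinity>u. of_real (\<phi> w) * (coef f u * coef g (w - u)))"
    proof (rule infsum_cong)
      fix u
      have "\<phi> w = \<phi> u + \<phi> (w - u)"
        using phi[of u "w - u"] by simp
      then show "coef f' u * coef g (w - u) + coef f u * coef g' (w - u)
          = of_real (\<phi> w) * (coef f u * coef g (w - u))"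
        by (simp add: c algebra_simps)
    qed
    also have "\<dots> = of_real (\<phi> w) * coef (\<lambda>t. f t * g t) w"
      unfolding coef_mult[OF ap(1,3)] by (rule infsum_cmult_right')
    finally show ?thesis .
  qed
  then show ?thesis
    unfolding ap_deriv_def using ap_add[OF ap'] ap_mult_subgroup[OF G ap(1,3)] by blast
qed

lemma ap_deriv_power:
  assumes phi: "\<And>a b. \<phi> (a + b) = \<phi> a + \<phi> b" and f: "ap_deriv \<phi> f f'"
  shows "ap_deriv \<phi> (\<lambda>t. f t ^ n) (\<lambda>t. of_nat n * f t ^ (n - 1) * f' t)"
proof (induction n)
  case 0
  have "\<phi> 0 = 0" using phi[of 0 0] by simp
  then show ?case using ap_deriv_const by simp
next
  case (Suc n)
  have "of_nat (Suc n) * f t ^ (Suc n - 1) * f' t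
      = f' t * f t ^ n + f t * (of_nat n * f t ^ (n - 1) * f' t)" for t
    by (cases n) (simp_all add: algebra_simps)
  then show ?case
    using ap_deriv_mult[OF phi f Suc] by simp
qed

lemma ap_deriv_suminf:
  fixes f f' :: "nat \<Rightarrow> real \<Rightarrow> complex"
  assumes f: "\<And>n. ap_deriv \<phi> (f n) (f' n)" and B: "\<And>n. apnorm (f n) \<le> B n" and sB: "summable B"
    and B': "\<And>n. apnorm (f' n) \<le> B' n" and sB': "summable B'"
  shows "ap_deriv \<phi> (\<lambda>t. \<Sum>n. f n t) (\<lambda>t. \<Sum>n. f' n t)"
proof -
  have ap: "ap UNIV (f n)" "ap UNIV (f' n)" "coef (f' n) u = of_real (\<phi> u) * coef (f n) u" for n u
    using f by (auto simp: ap_deriv_def)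
  have "coef (\<lambda>t. \<Sum>n. f' n t) u = of_real (\<phi> u) * coef (\<lambda>t. \<Sum>n. f n t) u" for u
    using sums_unique2[OF coef_suminf[OF ap(2) B' sB', where u = u]]
      sums_mult[OF coef_suminf[OF ap(1) B sB, where u = u], of "of_real (\<phi> u)"] by (simp add: ap(3))
  then show ?thesis
    unfolding ap_deriv_def using ap_suminf[OF ap(1) B sB] ap_suminf[OF ap(2) B' sB'] by blast
qed

section \<open>The spectral radius\<close>

lemma apnorm_finite_frequencies:
  assumes "ap W f" "finite W" "\<And>t. norm (f t) \<le> M"
  shows "apnorm f \<le> real (card W) * M"
proof -
  have c: "coef f u = 0" if "u \<notin> W" for u
    using ap_coef(3)[OF assms(1)] that by blast
  note F = trig_finite_support[where c = "coef f", OF assms(2) c]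
  have "f t = (\<Sum>u\<in>W. coef f u * cis (t * u))" for t
    using F(2)[of t] ap_coef(2)[OF assms(1)] by simp
  then have "norm (\<Sum>u\<in>W. coef f u * cis (t * u)) \<le> M" for t
    using assms(3)[of t] by simp
  then have bes: "(\<Sum>u\<in>W. (norm (coef f u))\<^sup>2) \<le> M\<^sup>2"
    by (rule Bessel_trig_polynomial[OF assms(2)])
  have M0: "0 \<le> M"
    using order_trans[OF norm_ge_zero assms(3)[of 0]] .
  have "norm (coef f u) \<le> M" if "u \<in> W" for u
  proof -
    have "(norm (coef f u))\<^sup>2 \<le> (\<Sum>u\<in>W. (norm (coef f u))\<^sup>2)"
      using assms(2) that by (intro member_le_sum) auto
    then show ?thesis
      using bes M0 power2_le_imp_le[of "norm (coef f u)" M] by linarith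
  qed
  then have "(\<Sum>u\<in>W. norm (coef f u)) \<le> real (card W) * M"
    using sum_bounded_above[of W "\<lambda>u. norm (coef f u)" M] by simp
  then show ?thesis
    unfolding apnorm_def using F(3) by simp
qed

text \<open>The frequencies of the \<open>n\<close>-th power are sums \<open>\<Sum> k\<^sub>u u\<close> over \<open>S\<close> with all \<open>k\<^sub>u \<le> n\<close>.\<close>
lemma ap_power_finite_frequencies:
  assumes f: "ap S f" and S: "finite S"
  obtains W where "finite W" "card W \<le> Suc n ^ card S" "ap W (\<lambda>t. f t ^ n)"
proof -
  define W where "W n = (\<lambda>k. \<Sum>u\<in>S. real (k u) * u) ` (S \<rightarrow>\<^sub>E {..n})" for n
  have "ap (W n) (\<lambda>t. f t ^ n)"
  proof (induction n)
    case 0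
    have "0 \<in> W 0"
      unfolding W_def by (rule image_eqI[of _ _ "\<lambda>u\<in>S. 0"]) auto
    then show ?case by (simp add: ap_const)
  next
    case (Suc n)
    have "{a + b |a b. a \<in> S \<and> b \<in> W n} \<subseteq> W (Suc n)"
    proof clarify
      fix a b assume "a \<in> S" "b \<in> W n"
      then obtain k where k: "k \<in> S \<rightarrow>\<^sub>E {..n}" "b = (\<Sum>u\<in>S. real (k u) * u)"
        unfolding W_def by blast
      have "(\<Sum>u\<in>S. real ((k(a := Suc (k a))) u) * u) = (\<Sum>u\<in>S. real (k u) * u + (if u = a then a else 0))"
        by (rule sum.cong) (auto simp: algebra_simps)
      also have "\<dots> = a + b"
        using \<open>a \<in> S\<close> S by (simp add: sum.distrib k(2))
      finally show "a + b \<in> W (Suc n)"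
        unfolding W_def
        by (intro image_eqI[of _ _ "k(a := Suc (k a))"])
           (use k(1) \<open>a \<in> S\<close> in \<open>auto simp: PiE_iff extensional_def intro: le_SucI\<close>)
    qed
    then show ?case
      using ap_mono[OF ap_mult[OF f Suc]] by simp
  qed
  moreover have "finite (W n)"
    unfolding W_def using S by (intro finite_imageI finite_PiE) auto
  moreover have "card (W n) \<le> Suc n ^ card S"
    unfolding W_def by (rule order_trans[OF card_image_le]) (use S in \<open>simp_all add: finite_PiE card_PiE\<close>)
  ultimately show ?thesis using that by blast
qed

lemma Suc_power_le_exponential:
  fixes s :: real
  assumes "1 < s"
  obtains C where "\<And>n. real (Suc n) ^ N \<le> C * s ^ n"
proof (cases "N = 0")
  case True
  then show ?thesis
    using assms by (intro that[of 1]) simp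
next
  case False
  define q where "q = root N s"
  have q: "q > 1" "q ^ N = s"
    using assms False by (simp_all add: q_def)
  have le: "real (Suc n) \<le> (1 + 1 / (q - 1)) * q ^ n" for n
  proof -
    have B: "1 + real n * (q - 1) \<le> q ^ n"
      using Bernoulli_inequality[of "q - 1" n] q by simp
    have "real n * (q - 1) \<le> q ^ n"
      using B by linarith
    then have "real n \<le> 1 / (q - 1) * q ^ n"
      using q by (simp add: field_simps)
    moreover have "1 \<le> q ^ n" using q by simp
    ultimately show ?thesis
      by (simp add: distrib_right)
  qed
  show ?thesis
  proof (rule that)
    fix n
    have "real (Suc n) ^ N \<le> ((1 + 1 / (q - 1)) * q ^ n) ^ N"
      by (rule power_mono[OF le]) simp
    also have "\<dots> = (1 + 1 / (q - 1)) ^ N * s ^ n"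
      using q(2) by (simp add: power_mult_distrib flip: power_mult) (simp add: power_mult mult.commute)
    finally show "real (Suc n) ^ N \<le> (1 + 1 / (q - 1)) ^ N * s ^ n" .
  qed
qed

lemma ap_split:
  assumes g: "ap G g" and e: "e > 0"
  shows "\<exists>S T R. finite S \<and> S \<subseteq> G \<and> ap S T \<and> ap G T \<and> ap G R \<and> apnorm R < e \<and> (\<forall>t. g t = T t + R t)"
proof -
  let ?c = "coef g"
  obtain S a b where S: "finite S" and ab: "a = (\<lambda>u. if u \<in> S then ?c u else 0)" "b = (\<lambda>u. if u \<in> S then 0 else ?c u)"
    and l: "ell1 a" "ell1 b" and n: "l1norm b < e" and t: "\<And>t. trig ?c t = trig a t + trig b t"
    using ell1_split[OF ap_coef(1)[OF g] e] by blast
  have supp: "?c u \<noteq> 0 \<Longrightarrow> u \<in> G" for u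
    by (rule ap_coef(3)[OF g])
  have gt: "g t = trig a t + trig b t" for t
    using t ap_coef(2)[OF g] by metis
  have nb: "apnorm (trig b) < e"
    unfolding apnorm_def coef_trig[OF l(2)] by (rule n)
  have a: "ap (S \<inter> G) (trig a)"
    by (rule apI[OF l(1) _ refl]) (use supp in \<open>auto simp: ab(1) split: if_splits\<close>)
  have aG: "ap G (trig a)"
    by (rule ap_mono[OF a]) simp
  have b: "ap G (trig b)"
    by (rule apI[OF l(2) _ refl]) (use supp in \<open>auto simp: ab(2) split: if_splits\<close>)
  show ?thesis
    by (rule exI[of _ "S \<inter> G"], rule exI[of _ "trig a"], rule exI[of _ "trig b"])
       (use S a aG b nb gt in auto)
qed

text \<open>The spectral radius is at most the supremum norm. Write \<open>g = T + R\<close> with a polynomial \<open>T\<close> and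
  \<open>\<parallel>R\<parallel> < \<epsilon>\<close>, and expand \<open>(T + R)\<^sup>n\<close> by the binomial theorem; the norm of \<open>T\<^sup>k\<close> exceeds its supremum norm
  only by the number of its frequencies, which is polynomial in \<open>n\<close>.\<close>
lemma spectral_radius:
  assumes G: "real_subgroup G" and g: "ap G g" and r: "\<And>t. norm (g t) \<le> r" "r < \<rho>"
  obtains C where "\<And>n. apnorm (\<lambda>t. g t ^ n) \<le> C * \<rho> ^ n"
proof -
  define \<epsilon> where "\<epsilon> = (\<rho> - r) / 3"
  have \<epsilon>: "\<epsilon> > 0" "r + 2 * \<epsilon> < \<rho>" and r0: "r \<ge> 0"
    using r(2) order_trans[OF norm_ge_zero r(1)[of 0]] by (simp_all add: \<epsilon>_def field_simps)
  obtain S T R where S: "finite S" and apa: "ap S T" "ap G T" and apb: "ap G R" and nb': "apnorm R < \<epsilon>"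
    and gt: "\<And>t. g t = T t + R t"
    using ap_split[OF g \<epsilon>(1)] by blast
  then have nb: "apnorm R \<le> \<epsilon>" by simp
  have na: "norm (T t) \<le> r + \<epsilon>" for t
  proof -
    have "norm (T t) \<le> norm (g t) + norm (R t)"
      using norm_triangle_ineq4[of "g t" "R t"] gt[of t] by simp
    then show ?thesis
      using r(1)[of t] norm_le_apnorm[OF apb, of t] nb by linarith
  qed
  let ?N = "card S"
  have pa: "apnorm (\<lambda>t. T t ^ k) \<le> real (Suc n) ^ ?N * (r + \<epsilon>) ^ k" if "k \<le> n" for k n
  proof -
    obtain W where W: "finite W" "card W \<le> Suc k ^ ?N" "ap W (\<lambda>t. T t ^ k)"
      using ap_power_finite_frequencies[OF apa(1) S] .
    have "apnorm (\<lambda>t. T t ^ k) \<le> real (card W) * (r + \<epsilon>) ^ k"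
      by (rule apnorm_finite_frequencies[OF W(3,1)]) (simp add: norm_power power_mono na)
    also have "real (card W) \<le> real (Suc k ^ ?N)"
      using W(2) of_nat_le_iff by blast
    also have "real (Suc k ^ ?N) \<le> real (Suc n ^ ?N)"
      using that by (intro of_nat_mono power_mono) auto
    finally show ?thesis
      using r0 \<epsilon>(1) by (simp add: mult_right_mono)
  qed
  have gn: "apnorm (\<lambda>t. g t ^ n) \<le> real (Suc n) ^ ?N * (r + 2 * \<epsilon>) ^ n" for n
  proof -
    let ?F = "\<lambda>k t. of_nat (n choose k) * (T t ^ k * R t ^ (n - k))"
    note p = ap_mult_subgroup[OF G ap_power[OF G apa(2)] ap_power[OF G apb]]
    have apF: "ap G (?F k)" for k
      by (rule ap_cmult[OF p])
    have "apnorm (\<lambda>t. g t ^ n) = apnorm (\<lambda>t. \<Sum>k\<le>n. ?F k t)"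
      unfolding gt binomial_ring by (simp add: mult.assoc)
    also have "\<dots> \<le> (\<Sum>k\<le>n. apnorm (?F k))"
      by (rule apnorm_sum[OF apF]) simp
    also have "\<dots> \<le> (\<Sum>k\<le>n. real (n choose k) * (real (Suc n) ^ ?N * (r + \<epsilon>) ^ k * \<epsilon> ^ (n - k)))"
    proof (rule sum_mono)
      fix k assume "k \<in> {..n}"
      then have "k \<le> n" by simp
      have "apnorm (\<lambda>t. R t ^ (n - k)) \<le> \<epsilon> ^ (n - k)"
        using apnorm_power[OF G apb, of "n - k"] power_mono[OF nb, of "n - k"] by simp
      then have "apnorm (\<lambda>t. T t ^ k * R t ^ (n - k)) \<le> (real (Suc n) ^ ?N * (r + \<epsilon>) ^ k) * \<epsilon> ^ (n - k)"
        using pa[OF \<open>k \<le> n\<close>] r0 \<epsilon>(1)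
        by (intro order_trans[OF apnorm_mult[OF ap_power[OF G apa(2)] ap_power[OF G apb]]] mult_mono) auto
      then show "apnorm (?F k) \<le> real (n choose k) * (real (Suc n) ^ ?N * (r + \<epsilon>) ^ k * \<epsilon> ^ (n - k))"
        unfolding apnorm_cmult[OF p] by (simp add: mult_left_mono)
    qed
    also have "\<dots> = real (Suc n) ^ ?N * ((r + \<epsilon>) + \<epsilon>) ^ n"
      unfolding binomial_ring[of "r + \<epsilon>" \<epsilon> n] sum_distrib_left by (intro sum.cong refl) (simp add: mult_ac)
    finally show ?thesis by (simp add: algebra_simps)
  qed
  define s where "s = \<rho> / (r + 2 * \<epsilon>)"
  have pos: "r + 2 * \<epsilon> > 0"
    using r0 \<epsilon>(1) by simp
  then have s: "s > 1" "s * (r + 2 * \<epsilon>) = \<rho>"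
    using \<epsilon>(2) by (simp_all add: s_def)
  obtain C where C: "\<And>n. real (Suc n) ^ ?N \<le> C * s ^ n"
    using Suc_power_le_exponential[OF s(1)] by blast
  show ?thesis
  proof (rule that)
    fix n
    have "apnorm (\<lambda>t. g t ^ n) \<le> (C * s ^ n) * (r + 2 * \<epsilon>) ^ n"
      using pos by (intro order_trans[OF gn] mult_right_mono C) simp
    also have "\<dots> = C * \<rho> ^ n"
      by (simp add: s(2)[symmetric] power_mult_distrib)
    finally show "apnorm (\<lambda>t. g t ^ n) \<le> C * \<rho> ^ n" .
  qed
qed

section \<open>Power series, exponentials and inverses in the algebra\<close>

lemma ap_eqI: "ap V f \<Longrightarrow> ap W g \<Longrightarrow> (\<And>u. coef f u = coef g u) \<Longrightarrow> f = g"
  by (metis ap_coef(2) ext)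

lemma ap_power_series:
  fixes a :: "nat \<Rightarrow> complex"
  assumes G: "real_subgroup G" and x: "ap G x" and C: "\<And>n. apnorm (\<lambda>t. x t ^ n) \<le> C * q ^ n"
    and s: "summable (\<lambda>n. norm (a n) * q ^ n)"
  shows "ap G (\<lambda>t. \<Sum>n. a n * x t ^ n)" "summable (\<lambda>n. a n * x t ^ n)"
proof -
  have n: "apnorm (\<lambda>t. a n * x t ^ n) \<le> C * (norm (a n) * q ^ n)" for n
    using mult_left_mono[OF C[of n], of "norm (a n)"]
    by (simp add: apnorm_cmult[OF ap_power[OF G x]] mult_ac)
  note S = ap_cmult[OF ap_power[OF G x]] n summable_mult[OF s, of C]
  show "ap G (\<lambda>t. \<Sum>n. a n * x t ^ n)" by (rule ap_suminf[OF S])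
  show "summable (\<lambda>n. a n * x t ^ n)" by (rule ap_summable[OF S])
qed

lemma ap_deriv_power_series:
  fixes a :: "nat \<Rightarrow> complex"
  assumes phi: "\<And>a b. \<phi> (a + b) = \<phi> a + \<phi> b"
    and x: "ap_deriv \<phi> x x'" and C: "\<And>n. apnorm (\<lambda>t. x t ^ n) \<le> C * q ^ n"
    and s: "summable (\<lambda>n. norm (a n) * q ^ n)"
    and s': "summable (\<lambda>n. norm (a n) * (real n * q ^ (n - 1)))"
  shows "ap_deriv \<phi> (\<lambda>t. \<Sum>n. a n * x t ^ n) (\<lambda>t. \<Sum>n. a n * (of_nat n * x t ^ (n - 1) * x' t))"
proof (rule ap_deriv_suminf)
  have ap: "ap UNIV x" "ap UNIV x'"
    using x by (auto simp: ap_deriv_def)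
  note G = real_subgroup_UNIV
  note p = ap_power[OF G ap(1)]
  show "ap_deriv \<phi> (\<lambda>t. a n * x t ^ n) (\<lambda>t. a n * (of_nat n * x t ^ (n - 1) * x' t))" for n
    by (rule ap_deriv_cmult[OF ap_deriv_power[OF phi x]])
  show "apnorm (\<lambda>t. a n * x t ^ n) \<le> C * (norm (a n) * q ^ n)" for n
    using mult_left_mono[OF C[of n], of "norm (a n)"] by (simp add: apnorm_cmult[OF p] mult_ac)
  show "summable (\<lambda>n. C * (norm (a n) * q ^ n))"
    by (rule summable_mult[OF s])
  show "apnorm (\<lambda>t. a n * (of_nat n * x t ^ (n - 1) * x' t))
      \<le> C * apnorm x' * (norm (a n) * (real n * q ^ (n - 1)))" for n
  proof -
    have "apnorm (\<lambda>t. (a n * of_nat n) * (x t ^ (n - 1) * x' t))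
        = norm (a n) * real n * apnorm (\<lambda>t. x t ^ (n - 1) * x' t)"
      using apnorm_cmult[OF ap_mult[OF p ap(2)]] by (simp add: norm_mult)
    also have "\<dots> \<le> norm (a n) * real n * (C * q ^ (n - 1) * apnorm x')"
      by (intro mult_left_mono order_trans[OF apnorm_mult[OF p ap(2)]] mult_right_mono C) auto
    finally show ?thesis by (simp add: mult_ac)
  qed
  show "summable (\<lambda>n. C * apnorm x' * (norm (a n) * (real n * q ^ (n - 1))))"
    by (rule summable_mult[OF s'])
qed

lemma exp_complex_series: "exp z = (\<Sum>n. (1 / fact n) * z ^ n :: complex)"
  unfolding exp_def by (rule suminf_cong) (simp add: scaleR_conv_of_real divide_inverse)

lemma summable_exp_shifted: "summable (\<lambda>n. norm (1 / fact n :: complex) * (real n * q ^ (n - 1)))"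
proof -
  have "(\<lambda>n. norm (1 / fact (Suc n) :: complex) * (real (Suc n) * q ^ (Suc n - 1))) = (\<lambda>n. inverse (fact n) * q ^ n)"
  proof
    fix n
    have "norm (1 / fact (Suc n) :: complex) = 1 / (real (Suc n) * fact n)"
      unfolding norm_divide norm_one norm_fact by (simp add: norm_mult del: of_nat_Suc)
    then show "norm (1 / fact (Suc n) :: complex) * (real (Suc n) * q ^ (Suc n - 1)) = inverse (fact n) * q ^ n"
      by (simp add: field_simps del: of_nat_Suc)
  qed
  then show ?thesis
    using summable_Suc_iff[of "\<lambda>n. norm (1 / fact n :: complex) * (real n * q ^ (n - 1))"] summable_exp[of q]
    by simp
qed

lemma ap_exp:
  assumes G: "real_subgroup G" and x: "ap G x"
  shows "ap G (\<lambda>t. exp (x t))"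
proof -
  have "norm (1 / fact n :: complex) * apnorm x ^ n = inverse (fact n) * apnorm x ^ n" for n
    by (simp add: norm_divide inverse_eq_divide)
  then have s: "summable (\<lambda>n. norm (1 / fact n :: complex) * apnorm x ^ n)"
    using summable_exp[of "apnorm x"] by (simp only:)
  have "ap G (\<lambda>t. \<Sum>n. (1 / fact n) * x t ^ n)"
    by (rule ap_power_series(1)[OF G x _ s, where C = 1]) (simp add: apnorm_power[OF G x])
  then show ?thesis
    by (simp only: exp_complex_series[symmetric])
qed

lemma ap_deriv_exp:
  assumes phi: "\<And>a b. \<phi> (a + b) = \<phi> a + \<phi> b" and x: "ap_deriv \<phi> x x'"
  shows "ap_deriv \<phi> (\<lambda>t. exp (x t)) (\<lambda>t. exp (x t) * x' t)"
proof -
  have ap: "ap UNIV x"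
    using x by (auto simp: ap_deriv_def)
  have "ap_deriv \<phi> (\<lambda>t. \<Sum>n. (1 / fact n) * x t ^ n)
      (\<lambda>t. \<Sum>n. (1 / fact n) * (of_nat n * x t ^ (n - 1) * x' t))"
    by (rule ap_deriv_power_series[OF phi x, of 1 "apnorm x"])
       (use apnorm_power[OF real_subgroup_UNIV ap] summable_exp[of "apnorm x"] summable_exp_shifted in
         \<open>simp_all add: norm_divide inverse_eq_divide\<close>)
  moreover have "(\<Sum>n. (1 / fact n) * (of_nat n * x t ^ (n - 1) * x' t)) = exp (x t) * x' t" for t
  proof -
    have "(\<lambda>n. (1 / fact n) * x t ^ n) sums exp (x t)"
      using exp_converges[of "x t"] by (simp add: scaleR_conv_of_real field_simps)
    then have "(\<lambda>n. (1 / fact n) * x t ^ n * x' t) sums (exp (x t) * x' t)"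
      by (rule sums_mult2)
    moreover have "(1 / fact n) * x t ^ n * x' t = (1 / fact (Suc n)) * (of_nat (Suc n) * x t ^ (Suc n - 1) * x' t)" for n
      by (simp add: field_simps del: of_nat_Suc)
    ultimately have "(\<lambda>n. (1 / fact (Suc n)) * (of_nat (Suc n) * x t ^ (Suc n - 1) * x' t)) sums (exp (x t) * x' t)"
      by simp
    then have "(\<lambda>n. (1 / fact n) * (of_nat n * x t ^ (n - 1) * x' t)) sums (exp (x t) * x' t)"
      using sums_Suc_iff[of "\<lambda>n. (1 / fact n) * (of_nat n * x t ^ (n - 1) * x' t)"] by simp
    then show ?thesis by (simp add: sums_iff)
  qed
  ultimately show ?thesis
    by (simp only: exp_complex_series[symmetric])
qed

lemma
  assumes G: "real_subgroup G" and f: "ap G f"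
  shows ap_cnj: "ap G (\<lambda>t. cnj (f t))" and coef_cnj: "coef (\<lambda>t. cnj (f t)) = (\<lambda>u. cnj (coef f (- u)))"
proof -
  have bij: "bij_betw uminus UNIV (UNIV :: real set)"
    by (rule bij_betw_byWitness[where f' = uminus]) auto
  have l: "ell1 (\<lambda>u. cnj (coef f (- u)))"
    using summable_on_reindex_bij_betw[OF bij, of "\<lambda>u. norm (coef f u)"] ap_coef(1)[OF f] by simp
  have e: "cnj (f t) = trig (\<lambda>u. cnj (coef f (- u))) t" for t
  proof -
    have "trig (\<lambda>u. cnj (coef f (- u))) t = (\<Sum>\<^sub>\<infinity>u. (\<lambda>u. cnj (coef f u * cis (t * u))) (- u))"
      unfolding trig_def by (simp add: cis_cnj)
    also have "\<dots> = (\<Sum>\<^sub>\<infinity>u. cnj (coef f u * cis (t * u)))"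
      by (rule infsum_reindex_bij_betw[OF bij])
    also have "\<dots> = cnj (trig (coef f) t)"
      unfolding trig_def by (rule infsum_cnj)
    finally show ?thesis
      using ap_coef(2)[OF f] by simp
  qed
  show "coef (\<lambda>t. cnj (f t)) = (\<lambda>u. cnj (coef f (- u)))"
    by (rule coef_eqI[OF l e])
  show "ap G (\<lambda>t. cnj (f t))"
  proof (rule apI[OF l _ e])
    fix u assume "cnj (coef f (- u)) \<noteq> 0"
    then have "- u \<in> G" using ap_coef(3)[OF f] by simp
    then have "- (- u) \<in> G" using G unfolding real_subgroup_def by blast
    then show "u \<in> G" by simp
  qed
qed

lemma ap_deriv_cnj:
  assumes phi: "\<And>a b. \<phi> (a + b) = \<phi> a + \<phi> b" and f: "ap_deriv \<phi> f f'"
  shows "ap_deriv \<phi> (\<lambda>t. cnj (f t)) (\<lambda>t. - 1 * cnj (f' t))"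
proof -
  note G = real_subgroup_UNIV
  have ap: "ap UNIV f" "ap UNIV f'" and c: "coef f' u = of_real (\<phi> u) * coef f u" for u
    using f by (auto simp: ap_deriv_def)
  have "\<phi> 0 = 0" using phi[of 0 0] by simp
  then have "\<phi> (- u) = - \<phi> u" for u
    using phi[of u "- u"] by simp
  then show ?thesis
    unfolding ap_deriv_def coef_cmult[OF ap_cnj[OF G ap(2)]] coef_cnj[OF G ap(1)] coef_cnj[OF G ap(2)]
    by (intro conjI allI ap_cmult ap_cnj G ap) (simp add: c)
qed

lemma summable_geometric_derivative:
  fixes q :: real
  assumes "0 \<le> q" "q < 1"
  shows "summable (\<lambda>n. real n * q ^ (n - 1))"
proof -
  have "summable (\<lambda>n. diffs (\<lambda>n. 1) n * q ^ n)"
    by (rule termdiff_converges[of q 1]) (use assms in \<open>auto simp: summable_geometric_iff\<close>)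
  then have "summable (\<lambda>n. real (Suc n) * q ^ (Suc n - 1))"
    by (simp add: diffs_def)
  then show ?thesis
    using summable_Suc_iff[of "\<lambda>n. real n * q ^ (n - 1)"] by blast
qed

text \<open>Wiener's lemma. With \<open>K\<close> the norm of \<open>f\<close>, the function \<open>x = 1 - |f|\<^sup>2 / K\<^sup>2\<close> has supremum norm less
  than 1, and \<open>1 / f = (cnj f / K\<^sup>2) \<Sum> x\<^sup>n\<close>. The same series shows that the inverse is in the domain of
  every derivation that is defined at \<open>f\<close>.\<close>
lemma
  assumes G: "real_subgroup G" and f: "ap G f" and \<delta>: "\<delta> > 0" "\<And>t. \<delta> \<le> norm (f t)"
  shows ap_inverse: "ap G (\<lambda>t. inverse (f t))"
    and ap_deriv_inverse: "\<And>\<phi> f'. (\<And>a b. \<phi> (a + b) = \<phi> a + \<phi> b) \<Longrightarrow> ap_deriv \<phi> f f' \<Longrightarrow>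
         \<exists>R. ap_deriv \<phi> (\<lambda>t. inverse (f t)) R"
proof -
  define K where "K = apnorm f"
  have fK: "norm (f t) \<le> K" for t
    unfolding K_def by (rule norm_le_apnorm[OF f])
  have K: "0 < \<delta>" "\<delta> \<le> K"
    using \<delta>(1) order_trans[OF \<delta>(2)[of 0] fK[of 0]] by auto
  define x where "x t = 1 + of_real (- 1 / K\<^sup>2) * (f t * cnj (f t))" for t
  have x_eq: "x t = of_real (1 - (norm (f t))\<^sup>2 / K\<^sup>2)" for t
    by (simp add: x_def complex_norm_square[symmetric])
  have apx: "ap G x"
    unfolding x_def using G
    by (intro ap_add ap_const ap_cmult ap_mult_subgroup[OF G] ap_cnj f) (auto simp: real_subgroup_def)
  define r where "r = 1 - \<delta>\<^sup>2 / K\<^sup>2"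
  have "\<delta>\<^sup>2 \<le> K\<^sup>2" using K by (intro power_mono) auto
  then have r: "0 \<le> r" "r < 1"
    using K by (simp_all add: r_def)
  have xr: "norm (x t) \<le> r" for t
  proof -
    have "(norm (f t))\<^sup>2 \<le> K\<^sup>2" "\<delta>\<^sup>2 \<le> (norm (f t))\<^sup>2"
      using \<delta> fK[of t] by (auto intro!: power_mono)
    then have "(norm (f t))\<^sup>2 / K\<^sup>2 \<le> 1" "\<delta>\<^sup>2 / K\<^sup>2 \<le> (norm (f t))\<^sup>2 / K\<^sup>2"
      using K by (auto simp: divide_simps)
    then show ?thesis
      unfolding x_eq norm_of_real r_def by simp
  qed
  define q where "q = (1 + r) / 2"
  have q: "r < q" "0 \<le> q" "q < 1"
    using r by (simp_all add: q_def)
  obtain C where C: "\<And>n. apnorm (\<lambda>t. x t ^ n) \<le> C * q ^ n"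
    using spectral_radius[OF G apx xr q(1)] by metis
  have s: "summable (\<lambda>n. norm (1::complex) * q ^ n)"
    using q by (simp add: summable_geometric_iff)
  have s': "summable (\<lambda>n. norm (1::complex) * (real n * q ^ (n - 1)))"
    using summable_geometric_derivative[OF q(2,3)] by simp
  have inv: "inverse (f t) = of_real (1 / K\<^sup>2) * (cnj (f t) * (\<Sum>n. 1 * x t ^ n))" for t
  proof -
    have "f t \<noteq> 0" using \<delta>(1) \<delta>(2)[of t] by auto
    have "norm (x t) < 1" using xr[of t] r by simp
    then have "(\<Sum>n. 1 * x t ^ n) = 1 / (1 - x t)"
      using suminf_geometric by simp
    also have "1 - x t = f t * cnj (f t) / of_real (K\<^sup>2)"
      by (simp add: x_def)
    finally show ?thesis
      using \<open>f t \<noteq> 0\<close> K by (simp add: field_simps)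
  qed
  show "ap G (\<lambda>t. inverse (f t))"
    unfolding inv by (intro ap_cmult ap_mult_subgroup[OF G] ap_cnj G f ap_power_series(1)[OF G apx C s])
  fix \<phi> :: "real \<Rightarrow> real" and f' assume phi: "\<And>a b. \<phi> (a + b) = \<phi> a + \<phi> b" and f': "ap_deriv \<phi> f f'"
  have "\<phi> 0 = 0" using phi[of 0 0] by simp
  note cn = ap_deriv_cnj[OF phi f']
  obtain x' where x': "ap_deriv \<phi> x x'"
    unfolding x_def
    using ap_deriv_add[OF ap_deriv_const[where \<phi> = \<phi>, OF \<open>\<phi> 0 = 0\<close>] ap_deriv_cmult[OF ap_deriv_mult[OF phi f' cn]]]
    by blast
  show "\<exists>R. ap_deriv \<phi> (\<lambda>t. inverse (f t)) R"
    unfolding inv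
    using ap_deriv_cmult[OF ap_deriv_mult[OF phi cn ap_deriv_power_series[OF phi x' C s s']]] by blast
qed

section \<open>The exponential form of differentiable elements\<close>

lemma ap_deriv_support:
  assumes "ap_deriv \<phi> f f'" "ap G f" shows "ap G f'"
proof (rule apI[of "coef f'"])
  have ap: "ap UNIV f'" and c: "coef f' u = of_real (\<phi> u) * coef f u" for u
    using assms(1) by (auto simp: ap_deriv_def)
  show "ell1 (coef f')" "f' t = trig (coef f') t" for t
    using ap_coef(1,2)[OF ap] by auto
  show "u \<in> G" if "coef f' u \<noteq> 0" for u
    using that ap_coef(3)[OF assms(2), of u] by (auto simp: c)
qed

text \<open>Elements bounded away from 0 that are twice differentiable for a finite family of derivations. The
  family has to separate the points of \<open>G\<close> uniformly: dividing the coefficients of a logarithmic derivative by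
  \<open>\<phi> u\<close> then preserves summability.\<close>
lemma smooth_exponential_form:
  assumes G: "real_subgroup G" and f: "ap G f" and \<delta>: "\<delta> > 0" "\<And>t. \<delta> \<le> norm (f t)"
    and \<Phi>: "finite \<Phi>" "\<And>\<phi> a b. \<phi> \<in> \<Phi> \<Longrightarrow> \<phi> (a + b) = \<phi> a + \<phi> b"
    and sep: "\<And>u. u \<in> G \<Longrightarrow> u \<noteq> 0 \<Longrightarrow> \<exists>\<phi>\<in>\<Phi>. 1 \<le> \<bar>\<phi> u\<bar>"
    and d1: "\<And>\<phi>. \<phi> \<in> \<Phi> \<Longrightarrow> ap_deriv \<phi> f (f1 \<phi>)"
    and d2: "\<And>\<phi> \<psi>. \<phi> \<in> \<Phi> \<Longrightarrow> \<psi> \<in> \<Phi> \<Longrightarrow> ap_deriv \<psi> (f1 \<phi>) (f2 \<phi> \<psi>)"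
  shows "\<exists>\<gamma> C g. \<gamma> \<in> G \<and> ap G g \<and> (\<forall>t. f t = C * cis (t * \<gamma>) * exp (g t))"
proof -
  define R where "R t = inverse (f t)" for t
  have f0: "f t \<noteq> 0" for t using \<delta>(1) \<delta>(2)[of t] by auto
  have phi0: "\<phi> 0 = 0" if "\<phi> \<in> \<Phi>" for \<phi>
    using \<Phi>(2)[OF that, of 0 0] by simp
  have phi_diff: "\<phi> (a - b) = \<phi> a - \<phi> b" if "\<phi> \<in> \<Phi>" for \<phi> a b
    using \<Phi>(2)[OF that, of "a - b" b] by simp
  have apR: "ap G R"
    unfolding R_def by (rule ap_inverse[OF G f \<delta>])
  have "\<exists>R1. ap_deriv \<phi> R R1" if "\<phi> \<in> \<Phi>" for \<phi>
    unfolding R_def by (rule ap_deriv_inverse[OF G f \<delta> \<Phi>(2)[OF that] d1[OF that]])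
  then obtain R1 where R1: "\<And>\<phi>. \<phi> \<in> \<Phi> \<Longrightarrow> ap_deriv \<phi> R (R1 \<phi>)"
    by metis
  have R1_eq: "R1 \<phi> t = - f1 \<phi> t * R t * R t" if "\<phi> \<in> \<Phi>" for \<phi> t
  proof -
    have "ap_deriv \<phi> (\<lambda>t. f t * R t) (\<lambda>t. f1 \<phi> t * R t + f t * R1 \<phi> t)"
      by (rule ap_deriv_mult[OF \<Phi>(2)[OF that] d1[OF that] R1[OF that]])
    moreover have "(\<lambda>t. f t * R t) = (\<lambda>t. 1)"
      using f0 by (simp add: R_def)
    ultimately have "(\<lambda>t. f1 \<phi> t * R t + f t * R1 \<phi> t) = (\<lambda>t. 0)"
      using ap_deriv_unique ap_deriv_const[where \<phi> = \<phi> and a = 1, OF phi0[OF that]] by metis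
    then have "f1 \<phi> t * R t + f t * R1 \<phi> t = 0"
      by metis
    then have "f t * R1 \<phi> t = - (f1 \<phi> t * R t)"
      by (simp add: eq_neg_iff_add_eq_0 add.commute)
    then have "R t * f t * R1 \<phi> t = - f1 \<phi> t * R t * R t"
      by (simp add: mult.assoc)
    then show ?thesis
      using f0[of t] by (simp add: R_def)
  qed
  \<comment> \<open>the logarithmic derivatives of \<open>f\<close>\<close>
  define b where "b \<phi> t = f1 \<phi> t * R t" for \<phi> t
  have apb: "ap G (b \<phi>)" if "\<phi> \<in> \<Phi>" for \<phi>
    unfolding b_def by (rule ap_mult_subgroup[OF G ap_deriv_support[OF d1[OF that] f] apR])
  have db: "ap_deriv \<psi> (b \<phi>) (\<lambda>t. f2 \<phi> \<psi> t * R t - f1 \<phi> t * f1 \<psi> t * R t * R t)"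
    if "\<phi> \<in> \<Phi>" "\<psi> \<in> \<Phi>" for \<phi> \<psi>
    using ap_deriv_mult[OF \<Phi>(2)[OF that(2)] d2[OF that] R1[OF that(2)]] R1_eq[OF that(2)]
    by (simp add: b_def[abs_def] mult.assoc)
  have f2: "f2 \<phi> \<psi> = f2 \<psi> \<phi>" if "\<phi> \<in> \<Phi>" "\<psi> \<in> \<Phi>" for \<phi> \<psi>
    using d1[OF that(1)] d1[OF that(2)] d2[OF that] d2[OF that(2,1)]
    by (intro ap_eqI[of UNIV _ UNIV]) (simp_all add: ap_deriv_def mult.left_commute)
  \<comment> \<open>they form a closed family: their mixed derivatives agree\<close>
  have sym: "of_real (\<psi> u) * coef (b \<phi>) u = of_real (\<phi> u) * coef (b \<psi>) u"
    if "\<phi> \<in> \<Phi>" "\<psi> \<in> \<Phi>" for \<phi> \<psi> u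
  proof -
    have "(\<lambda>t. f2 \<phi> \<psi> t * R t - f1 \<phi> t * f1 \<psi> t * R t * R t)
        = (\<lambda>t. f2 \<psi> \<phi> t * R t - f1 \<psi> t * f1 \<phi> t * R t * R t)"
      unfolding f2[OF that] by (simp add: mult.commute mult.left_commute)
    then show ?thesis
      using db[OF that] db[OF that(2,1)] unfolding ap_deriv_def by metis
  qed
  \<comment> \<open>the coefficients of the common primitive; by closedness the choice of \<open>\<phi>\<close> at \<open>u\<close> does not matter\<close>
  define ch where "ch u = (SOME \<phi>. \<phi> \<in> \<Phi> \<and> 1 \<le> \<bar>\<phi> u\<bar>)" for u
  have ch: "ch u \<in> \<Phi>" "1 \<le> \<bar>ch u u\<bar>" if "u \<in> G" "u \<noteq> 0" for u
    using someI_ex[of "\<lambda>\<phi>. \<phi> \<in> \<Phi> \<and> 1 \<le> \<bar>\<phi> u\<bar>"] sep[OF that] unfolding ch_def by blast+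
  define h where "h u = (if u \<in> G \<and> u \<noteq> 0 then coef (b (ch u)) u / of_real (ch u u) else 0)" for u
  have h_mult: "of_real (\<phi> u) * h u = (if u = 0 then 0 else coef (b \<phi>) u)" if "\<phi> \<in> \<Phi>" for \<phi> u
  proof (cases "u \<in> G \<and> u \<noteq> 0")
    case True
    note c = ch[OF conjunct1[OF True] conjunct2[OF True]]
    then have "of_real (ch u u) \<noteq> (0 :: complex)" by auto
    then show ?thesis
      using True sym[OF c(1) that, of u] by (simp add: h_def field_simps)
  next
    case False
    then show ?thesis
      using ap_coef(3)[OF apb[OF that], of u] phi0[OF that] by (auto simp: h_def)
  qed
  have hle: "norm (h u) \<le> (\<Sum>\<phi>\<in>\<Phi>. norm (coef (b \<phi>) u))" for u
  proof (cases "u \<in> G \<and> u \<noteq> 0")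
    case True
    note c = ch[OF conjunct1[OF True] conjunct2[OF True]]
    have "norm (h u) \<le> norm (coef (b (ch u)) u)"
      using True c(2) by (simp add: h_def norm_divide divide_le_eq mult_right_le_one_le mult_le_cancel_left1)
    also have "\<dots> \<le> (\<Sum>\<phi>\<in>\<Phi>. norm (coef (b \<phi>) u))"
      using c(1) \<Phi>(1) by (intro member_le_sum) auto
    finally show ?thesis .
  qed (auto simp: h_def intro: sum_nonneg)
  have "(\<lambda>u. \<Sum>\<phi>\<in>F. norm (coef (b \<phi>) u)) summable_on UNIV" if "finite F" "F \<subseteq> \<Phi>" for F
    using that
  proof (induction F rule: finite_induct)
    case (insert \<phi> F)
    then show ?case
      using summable_on_add[OF ap_coef(1)[OF apb[of \<phi>]]] by simp
  qed simp
  from this[OF \<Phi>(1) order.refl]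
  have lh: "ell1 h"
    by (rule absum_comparison'[OF _ hle])
  define g where "g = trig h"
  have coefg: "coef g = h" unfolding g_def by (rule coef_trig[OF lh])
  have apg: "ap G g"
    unfolding g_def by (rule apI[OF lh _ refl]) (auto simp: h_def split: if_splits)
  have dg: "ap_deriv \<phi> g (\<lambda>t. b \<phi> t + - coef (b \<phi>) 0)" if "\<phi> \<in> \<Phi>" for \<phi>
  proof -
    have u: "ap UNIV (b \<phi>)" "ap UNIV (\<lambda>t. - coef (b \<phi>) 0)" "ap UNIV g"
      using ap_mono[OF apb[OF that]] ap_mono[OF apg] by (auto simp: ap_const)
    show ?thesis
      unfolding ap_deriv_def coefg h_mult[OF that] coef_add[OF u(1,2)] coef_const
      using ap_add[OF u(1,2)] u(3) by simp
  qed
  \<comment> \<open>the quotient of \<open>f\<close> by the exponential has constant logarithmic derivatives, the mean values of \<open>b \<phi>\<close>\<close>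
  define w where "w t = f t * exp (- 1 * g t)" for t
  have apw: "ap G w"
    unfolding w_def by (intro ap_mult_subgroup[OF G] f ap_exp[OF G] ap_cmult apg)
  have dw: "of_real (\<phi> u) * coef w u = coef (b \<phi>) 0 * coef w u" if "\<phi> \<in> \<Phi>" for \<phi> u
  proof -
    let ?e = "\<lambda>t. exp (- 1 * g t)" and ?c = "coef (b \<phi>) 0"
    have "ap_deriv \<phi> w (\<lambda>t. f1 \<phi> t * ?e t + f t * (?e t * (- 1 * (b \<phi> t + - ?c))))"
      unfolding w_def[abs_def]
      by (rule ap_deriv_mult[OF \<Phi>(2)[OF that] d1[OF that] ap_deriv_exp[OF \<Phi>(2)[OF that] ap_deriv_cmult[OF dg[OF that]]]])
    moreover have "f1 \<phi> t * ?e t + f t * (?e t * (- 1 * (b \<phi> t + - ?c))) = ?c * w t" for t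
    proof -
      have "f t * b \<phi> t = f1 \<phi> t"
        using f0[of t] by (simp add: b_def R_def)
      then show ?thesis
        unfolding w_def by (simp only: \<open>f t * b \<phi> t = f1 \<phi> t\<close>[symmetric]) (simp add: algebra_simps)
    qed
    ultimately have "ap_deriv \<phi> w (\<lambda>t. ?c * w t)" by simp
    then show ?thesis
      unfolding ap_deriv_def coef_cmult[OF apw] by metis
  qed
  have "\<exists>\<gamma>. coef w \<gamma> \<noteq> 0"
  proof (rule ccontr)
    assume "\<not> ?thesis"
    then have "w 0 = 0"
      using ap_coef(2)[OF apw] by (metis (no_types, lifting) infsum_0 mult_zero_left trig_def)
    then show False using f0[of 0] by (simp add: w_def)
  qed
  then obtain \<gamma> where \<gamma>: "coef w \<gamma> \<noteq> 0" by blast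
  then have \<gamma>G: "\<gamma> \<in> G" by (rule ap_coef(3)[OF apw])
  \<comment> \<open>two frequencies of \<open>w\<close> have the same image under every \<open>\<phi>\<close>, so they coincide\<close>
  have single: "coef w u = (if u = \<gamma> then coef w \<gamma> else 0)" for u
  proof (cases "coef w u = 0")
    case False
    then have "u \<in> G" by (rule ap_coef(3)[OF apw])
    have "- \<gamma> \<in> G" using \<gamma>G G unfolding real_subgroup_def by blast
    then have "u + - \<gamma> \<in> G" using \<open>u \<in> G\<close> G unfolding real_subgroup_def by blast
    moreover have "\<phi> (u - \<gamma>) = 0" if "\<phi> \<in> \<Phi>" for \<phi>
    proof -
      have "of_real (\<phi> u) = coef (b \<phi>) 0" "of_real (\<phi> \<gamma>) = coef (b \<phi>) 0"
        using dw[OF that, of u] dw[OF that, of \<gamma>] False \<gamma> by simp_all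
      then show ?thesis
        using phi_diff[OF that] by (metis of_real_eq_iff diff_self)
    qed
    ultimately have "u - \<gamma> = 0"
      using sep[of "u - \<gamma>"] by force
    then show ?thesis by simp
  qed (use \<gamma> in auto)
  have w_eq: "w = (\<lambda>t. coef w \<gamma> * cis (t * \<gamma>))"
  proof (rule ap_eqI[OF apw ap_cis[OF \<gamma>G]])
    show "coef w u = coef (\<lambda>t. coef w \<gamma> * cis (t * \<gamma>)) u" for u
      unfolding coef_cis by (rule single)
  qed
  show ?thesis
  proof (intro exI conjI allI)
    show "\<gamma> \<in> G" "ap G g" by fact+
    fix t
    have "f t = w t * exp (g t)"
      unfolding w_def by (simp add: exp_minus mult.assoc)
    then show "f t = coef w \<gamma> * cis (t * \<gamma>) * exp (g t)"
      using w_eq by metis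
  qed
qed

section \<open>Separating the points of a finitely generated subgroup\<close>

lemma common_denominator:
  assumes "finite (Q :: rat set)"
  shows "\<exists>N::int. N > 0 \<and> (\<forall>q\<in>Q. of_int N * q \<in> \<int>)"
  using assms
proof (induction Q rule: finite_induct)
  case empty
  show ?case by (intro exI[of _ 1]) simp
next
  case (insert q Q)
  then obtain N :: int where N: "N > 0" "\<And>q. q \<in> Q \<Longrightarrow> of_int N * q \<in> \<int>" by blast
  obtain a d :: int where q: "q = of_int a / of_int d" "d > 0"
    by (metis Fract_of_int_quotient Rat_cases)
  have 1: "of_int (N * d) * q = of_int (N * a)"
    using q by simp
  have "of_int (N * d) * r \<in> \<int>" if "r \<in> insert q Q" for r
  proof (cases "r = q")
    case True
    then show ?thesis using 1 Ints_of_int[of "N * a"] by metis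
  next
    case False
    then have "of_int d * (of_int N * r) \<in> \<int>"
      using that by (intro Ints_mult Ints_of_int N(2)) auto
    then show ?thesis by (simp add: mult_ac)
  qed
  then show ?case
    using N(1) q(2) by (intro exI[of _ "N * d"]) auto
qed

text \<open>Coordinates of the reals with respect to a basis over the rationals.\<close>
lemma rational_coordinates_exist:
  "\<exists>rep :: real \<Rightarrow> real \<Rightarrow> rat. (\<forall>u v b. rep (u + v) b = rep u b + rep v b) \<and>
     (\<forall>q u b. rep (of_rat q * u) b = q * rep u b) \<and>
     (\<forall>u. finite {b. rep u b \<noteq> 0}) \<and> (\<forall>u. (\<forall>b. rep u b = 0) \<longrightarrow> u = 0)"
proof -
  interpret Q: vector_space "\<lambda>(q::rat) (x::real). of_rat q * x"
    by unfold_locales (simp_all add: of_rat_add of_rat_mult algebra_simps)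
  define B where "B = Q.extend_basis {}"
  have B: "Q.independent B" "Q.span B = UNIV"
    unfolding B_def using Q.independent_extend_basis[of "{}"] Q.span_extend_basis[of "{}"]
    by (auto simp: Q.independent_empty)
  let ?r = "Q.representation B"
  have "?r (u + v) b = ?r u b + ?r v b" for u v b
    using Q.representation_add[OF B(1)] B(2) by simp
  moreover have "?r (of_rat q * u) b = q * ?r u b" for q u b
    using Q.representation_scale[OF B(1)] B(2) by simp
  moreover have "finite {b. ?r u b \<noteq> 0}" for u
    by (rule Q.finite_representation)
  moreover have "u = 0" if "\<forall>b. ?r u b = 0" for u
    using Q.sum_nonzero_representation_eq[OF B(1), of u] B(2) that by simp
  ultimately show ?thesis by blast
qed

lemma int_span_subgroup:
  assumes "X \<noteq> {}"
  shows "real_subgroup (int_span X)"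
  unfolding real_subgroup_def
proof (intro conjI ballI)
  obtain x0 where x0: "x0 \<in> X" using assms by blast
  show "0 \<in> int_span X"
    unfolding int_span_def
    by (intro CollectI exI[of _ 1] exI[of _ "\<lambda>_. 0"] exI[of _ "\<lambda>_. x0"]) (use x0 in simp)
  fix a assume a: "a \<in> int_span X"
  then obtain m c y where mcy: "a = (\<Sum>k\<in>{1..m}. of_int (c k) * y k)" "m \<ge> (1::nat)" "\<forall>k\<in>{1..m}. y k \<in> X"
    unfolding int_span_def by blast
  then show "- a \<in> int_span X"
    unfolding int_span_def
    by (intro CollectI exI[of _ m] exI[of _ "\<lambda>k. - c k"] exI[of _ y]) (simp add: sum_negf)
  fix b assume "b \<in> int_span X"
  then obtain n d z where ndz: "b = (\<Sum>k\<in>{1..n}. of_int (d k) * z k)" "n \<ge> (1::nat)" "\<forall>k\<in>{1..n}. z k \<in> X"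
    unfolding int_span_def by blast
  define c' where "c' k = (if k \<le> m then c k else d (k - m))" for k
  define y' where "y' k = (if k \<le> m then y k else z (k - m))" for k
  have "(\<Sum>k\<in>{1..m + n}. of_int (c' k) * y' k)
      = (\<Sum>k\<in>{1..m}. of_int (c' k) * y' k) + (\<Sum>k\<in>{m + 1..m + n}. of_int (c' k) * y' k)"
    by (rule sum.ub_add_nat) simp
  also have "(\<Sum>k\<in>{1..m}. of_int (c' k) * y' k) = a"
    unfolding mcy(1) by (rule sum.cong) (auto simp: c'_def y'_def)
  also have "(\<Sum>k\<in>{m + 1..m + n}. of_int (c' k) * y' k) = (\<Sum>k\<in>{1..n}. of_int (c' (k + m)) * y' (k + m))"
    using sum.shift_bounds_cl_nat_ivl[of "\<lambda>k. of_int (c' k) * y' k" 1 m n] by (simp add: add.commute)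
  also have "\<dots> = b"
    unfolding ndz(1) by (rule sum.cong) (auto simp: c'_def y'_def)
  finally have s: "a + b = (\<Sum>k\<in>{1..m + n}. of_int (c' k) * y' k)" ..
  have "\<forall>k\<in>{1..m + n}. y' k \<in> X"
  proof
    fix k assume k: "k \<in> {1..m + n}"
    show "y' k \<in> X"
    proof (cases "k \<le> m")
      case True
      then show ?thesis using mcy(3) k by (simp add: y'_def)
    next
      case False
      then have "k - m \<in> {1..n}" using k by auto
      then show ?thesis using ndz(3) False by (simp add: y'_def)
    qed
  qed
  then show "a + b \<in> int_span X"
    unfolding int_span_def using s mcy(2)
    by (intro CollectI exI[of _ "m + n"] exI[of _ c'] exI[of _ y']) simp
qed

lemma subset_int_span: "X \<subseteq> int_span X"
proof
  fix x assume "x \<in> X"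
  then show "x \<in> int_span X"
    unfolding int_span_def
    by (intro CollectI exI[of _ 1] exI[of _ "\<lambda>_. 1"] exI[of _ "\<lambda>_. x"]) simp
qed

lemma real_subgroup_of_int_mult:
  assumes G: "real_subgroup G" and s: "s \<in> G" shows "of_int k * s \<in> G"
proof -
  have n: "of_nat n * s \<in> G" for n
    by (induction n) (use G s in \<open>auto simp: real_subgroup_def distrib_right\<close>)
  show ?thesis
  proof (cases "k \<ge> 0")
    case True
    then show ?thesis using n[of "nat k"] by simp
  next
    case False
    then have "of_int k * s = - (of_nat (nat (- k)) * s)" by simp
    then show ?thesis using n[of "nat (- k)"] G unfolding real_subgroup_def by metis
  qed
qed

lemma int_span_subset:
  assumes G: "real_subgroup G" and "S \<subseteq> G"
  shows "int_span S \<subseteq> G"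
proof -
  have "(\<Sum>k\<in>{1..m}. of_int (c k) * y k) \<in> G" if "\<forall>k\<in>{1..m}. y k \<in> S" for m :: nat and c y
    using that
  proof (induction m)
    case (Suc m)
    then have "(\<Sum>k\<in>{1..m}. of_int (c k) * y k) \<in> G" "y (Suc m) \<in> G"
      using assms(2) by auto
    then show ?case
      using real_subgroup_of_int_mult[OF G, of "y (Suc m)" "c (Suc m)"]
      using G unfolding real_subgroup_def by simp
  qed (use G in \<open>simp add: real_subgroup_def\<close>)
  then show ?thesis by (auto simp: int_span_def)
qed

text \<open>The rational coordinates that occur in \<open>S\<close>, multiplied by a common denominator, are integers on the
  subgroup generated by \<open>S\<close>; so at a nonzero element one of them has absolute value at least 1.\<close>
lemma separating_homomorphisms:
  assumes S: "finite S"
  obtains \<Phi> :: "(real \<Rightarrow> real) set" where "finite \<Phi>"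
    "\<And>\<phi> a b. \<phi> \<in> \<Phi> \<Longrightarrow> \<phi> (a + b) = \<phi> a + \<phi> b"
    "\<And>u. u \<in> int_span S \<Longrightarrow> u \<noteq> 0 \<Longrightarrow> \<exists>\<phi>\<in>\<Phi>. 1 \<le> \<bar>\<phi> u\<bar>"
proof -
  obtain rep :: "real \<Rightarrow> real \<Rightarrow> rat" where
    add: "\<And>u v b. rep (u + v) b = rep u b + rep v b" and
    scale: "\<And>q u b. rep (of_rat q * u) b = q * rep u b" and
    fin: "\<And>u. finite {b. rep u b \<noteq> 0}" and nz: "\<And>u. (\<And>b. rep u b = 0) \<Longrightarrow> u = 0"
    using rational_coordinates_exist by blast
  define B where "B = (\<Union>s\<in>S. {b. rep s b \<noteq> 0})"
  have B: "finite B" using S fin by (simp add: B_def)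
  have "finite ((\<lambda>(s, b). rep s b) ` (S \<times> B))"
    using S B by simp
  from common_denominator[OF this] obtain N :: int where N: "N > 0"
    and "\<forall>q\<in>(\<lambda>(s, b). rep s b) ` (S \<times> B). of_int N * q \<in> \<int>" by blast
  then have NI: "of_int N * rep s b \<in> \<int>" if "s \<in> S" "b \<in> B" for s b
    using that by force
  have rep0: "rep 0 b = 0" for b
    using add[of 0 0 b] by simp
  have rep_sum: "rep (\<Sum>k\<in>A. of_int (c k) * y k) b = (\<Sum>k\<in>A. of_int (c k) * rep (y k) b)"
    if "finite A" for A :: "nat set" and c y b
    using that
  proof (induction A rule: finite_induct)
    case (insert k A)
    then show ?case using scale[of "of_int (c k)" "y k" b] by (simp add: add)
  qed (simp add: rep0)
  define \<phi> where "\<phi> b u = (of_rat (of_int N * rep u b) :: real)" for b u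
  show ?thesis
  proof (rule that[of "\<phi> ` B"])
    show "finite (\<phi> ` B)" using B by simp
    show "f (a + b) = f a + f b" if "f \<in> \<phi> ` B" for f a b
      using that by (auto simp: \<phi>_def add distrib_left of_rat_add)
    fix u assume u: "u \<in> int_span S" "u \<noteq> 0"
    then obtain m :: nat and c y where k: "u = (\<Sum>k\<in>{1..m}. of_int (c k) * y k)" "\<And>k. k \<in> {1..m} \<Longrightarrow> y k \<in> S"
      by (auto simp: int_span_def)
    obtain b where b: "rep u b \<noteq> 0" using nz u(2) by blast
    have "b \<in> B"
    proof (rule ccontr)
      assume "b \<notin> B"
      then have "rep u b = 0"
        unfolding k(1) rep_sum[OF finite_atLeastAtMost] using k(2) by (intro sum.neutral) (auto simp: B_def)
      then show False using b by simp
    qed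
    have "of_int N * rep u b = (\<Sum>k\<in>{1..m}. of_int (c k) * (of_int N * rep (y k) b))"
      unfolding k(1) rep_sum[OF finite_atLeastAtMost] sum_distrib_left by (intro sum.cong) (auto simp: mult_ac)
    also have "\<dots> \<in> \<int>"
      using \<open>b \<in> B\<close> k(2) by (intro Ints_sum Ints_mult Ints_of_int NI)
    finally obtain n where n: "of_int N * rep u b = of_int n"
      by (auto elim: Ints_cases)
    have "n \<noteq> 0"
      using n b N by auto
    then have "1 \<le> \<bar>\<phi> b u\<bar>"
      unfolding \<phi>_def n by simp
    then show "\<exists>f\<in>\<phi> ` B. 1 \<le> \<bar>f u\<bar>"
      using \<open>b \<in> B\<close> by blast
  qed
qed

section \<open>The exponential form of functions bounded away from 0\<close>

lemma ap_deriv_finite_frequencies: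
  assumes "finite S" "ap S f"
  shows "ap S (trig (\<lambda>u. of_real (\<phi> u) * coef f u))" "ap_deriv \<phi> f (trig (\<lambda>u. of_real (\<phi> u) * coef f u))"
proof -
  let ?c = "\<lambda>u. of_real (\<phi> u) * coef f u"
  have z: "?c u = 0" if "u \<notin> S" for u
    using ap_coef(3)[OF assms(2), of u] that by auto
  have l: "ell1 ?c" by (rule trig_finite_support(1)[of S]) (use assms(1) z in auto)
  show 1: "ap S (trig ?c)"
    by (rule apI[OF l _ refl]) (use z in blast)
  show "ap_deriv \<phi> f (trig ?c)"
    unfolding ap_deriv_def coef_trig[OF l] using ap_mono[OF 1] ap_mono[OF assms(2)] by simp
qed

lemma polynomial_exponential_form:
  assumes G: "real_subgroup G" and S: "finite S" "S \<subseteq> G" and f: "ap S f"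
    and \<delta>: "\<delta> > 0" "\<And>t. \<delta> \<le> norm (f t)"
  shows "\<exists>\<gamma> C g. \<gamma> \<in> G \<and> ap G g \<and> (\<forall>t. f t = C * cis (t * \<gamma>) * exp (g t))"
proof -
  \<comment> \<open>\<open>int_span\<close> of the empty set is empty, hence the additional generator 0\<close>
  let ?S = "insert 0 S"
  have S': "finite ?S" "?S \<subseteq> G" using S G by (auto simp: real_subgroup_def)
  obtain \<Phi> :: "(real \<Rightarrow> real) set" where \<Phi>: "finite \<Phi>"
    "\<And>\<phi> a b. \<phi> \<in> \<Phi> \<Longrightarrow> \<phi> (a + b) = \<phi> a + \<phi> b"
    "\<And>u. u \<in> int_span ?S \<Longrightarrow> u \<noteq> 0 \<Longrightarrow> \<exists>\<phi>\<in>\<Phi>. 1 \<le> \<bar>\<phi> u\<bar>"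
    using separating_homomorphisms[OF S'(1)] by blast
  have H: "real_subgroup (int_span ?S)" by (rule int_span_subgroup) simp
  have f': "ap (int_span ?S) f" by (rule ap_mono[OF f]) (use subset_int_span[of ?S] in auto)
  note d1 = ap_deriv_finite_frequencies[OF S(1) f]
  note d2 = ap_deriv_finite_frequencies[OF S(1) d1(1)]
  from smooth_exponential_form[OF H f' \<delta> \<Phi> d1(2) d2(2)]
  show ?thesis
    using int_span_subset[OF G S'(2)] ap_mono by blast
qed

text \<open>A polynomial \<open>T\<close> close to \<open>f\<close> has the exponential form, and \<open>f = T (1 + y)\<close> with \<open>|y| \<le> 1/3\<close>.\<close>
lemma wiener_levy_exponential_form:
  assumes G: "real_subgroup G" and f: "ap G f" and \<mu>: "\<mu> > 0" "\<And>t. \<mu> \<le> norm (f t)"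
  shows "\<exists>\<gamma> C g. \<gamma> \<in> G \<and> ap G g \<and> (\<forall>t. f t = C * cis (t * \<gamma>) * exp (g t))"
proof -
  obtain S T R where S: "finite S" "S \<subseteq> G" and T: "ap S T" "ap G T" and R: "ap G R" "apnorm R < \<mu> / 4"
    and fTR: "\<And>t. f t = T t + R t"
    using ap_split[OF f, of "\<mu> / 4"] \<mu>(1) by auto
  have Rle: "norm (R t) \<le> \<mu> / 4" for t
    using norm_le_apnorm[OF R(1), of t] R(2) by linarith
  have Tge: "3 * \<mu> / 4 \<le> norm (T t)" for t
    using norm_triangle_ineq[of "T t" "R t"] fTR[of t] \<mu>(2)[of t] Rle[of t] by simp
  have pos: "3 * \<mu> / 4 > 0" using \<mu>(1) by simp
  obtain \<gamma> C g where g: "\<gamma> \<in> G" "ap G g" "\<And>t. T t = C * cis (t * \<gamma>) * exp (g t)"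
    using polynomial_exponential_form[OF G S T(1) pos Tge] by blast
  define y where "y t = R t * inverse (T t)" for t
  have apy: "ap G y"
    unfolding y_def by (rule ap_mult_subgroup[OF G R(1) ap_inverse[OF G T(2) pos Tge]])
  have T0: "T t \<noteq> 0" for t using Tge[of t] pos by auto
  have yle: "norm (y t) \<le> 1 / 3" for t
  proof -
    have "norm (y t) = norm (R t) / norm (T t)"
      by (simp add: y_def norm_mult norm_inverse divide_inverse)
    also have "\<dots> \<le> (\<mu> / 4) / (3 * \<mu> / 4)"
      using Rle[of t] Tge[of t] \<mu>(1) by (intro frac_le) auto
    finally show ?thesis using \<mu>(1) by simp
  qed
  obtain K where K: "\<And>n. apnorm (\<lambda>t. y t ^ n) \<le> K * (1 / 2) ^ n"
    using spectral_radius[OF G apy yle, of "1 / 2"] by auto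
  define a :: "nat \<Rightarrow> complex" where "a n = (-1) ^ Suc n / of_nat n" for n
  have "norm (a n) * (1 / 2) ^ n \<le> (1 / 2) ^ n" for n
    by (cases n) (simp_all add: a_def norm_divide norm_mult norm_power field_simps del: of_nat_Suc)
  then have s: "summable (\<lambda>n. norm (a n) * (1 / 2 :: real) ^ n)"
    by (intro summable_comparison_test'[of "\<lambda>n. (1 / 2 :: real) ^ n" 0 "\<lambda>n. norm (a n) * (1 / 2) ^ n"])
       (simp_all add: summable_geometric)
  define L where "L t = (\<Sum>n. a n * y t ^ n)" for t
  have apL: "ap G L"
    unfolding L_def by (rule ap_power_series(1)[OF G apy K s])
  have expL: "exp (L t) = 1 + y t" for t
  proof -
    have y1: "norm (y t) < 1" using yle[of t] by simp
    have "(\<lambda>n. a n * y t ^ n) sums ln (1 + y t)"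
      using Ln_series[OF y1] by (simp add: a_def)
    then have "L t = ln (1 + y t)"
      by (simp add: L_def sums_iff)
    moreover have "1 + y t \<noteq> 0"
    proof
      assume "1 + y t = 0"
      then have "y t = - 1" by (simp add: eq_neg_iff_add_eq_0 add.commute)
      then show False using y1 by simp
    qed
    ultimately show ?thesis by simp
  qed
  have "f t = C * cis (t * \<gamma>) * exp (g t + L t)" for t
  proof -
    have "f t = T t * exp (L t)"
      using T0[of t] by (simp add: fTR expL y_def distrib_left)
    then show ?thesis
      by (simp add: g(3) exp_add mult.assoc)
  qed
  then show ?thesis
    using g(1) ap_add[OF g(2) apL] by blast
qed

lemma continuous_trig:
  assumes "ell1 c" shows "continuous_on UNIV (trig c)"
proof -
  have "uniform_limit UNIV (\<lambda>X t. \<Sum>u\<in>X. c u * cis (t * u)) (\<lambda>t. \<Sum>\<^sub>\<infinity>u\<in>UNIV. c u * cis (t * u))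
      (finite_subsets_at_top UNIV)"
    by (rule Weierstrass_m_test_general[where M = "\<lambda>u. norm (c u)"]) (use assms in \<open>simp_all add: norm_mult\<close>)
  then have "continuous_on UNIV (\<lambda>t. \<Sum>\<^sub>\<infinity>u\<in>UNIV. c u * cis (t * u))"
    by (rule uniform_limit_theorem[rotated])
       (auto simp: cis_conv_exp intro!: always_eventually continuous_intros)
  then show ?thesis
    unfolding trig_def[abs_def] .
qed

text \<open>A continuous logarithm of the constant 1 takes its values in a discrete set.\<close>
lemma continuous_logarithm_of_1_trivial:
  fixes D :: "real \<Rightarrow> complex"
  assumes "continuous_on UNIV D" "\<And>t. exp (D t) = 1" "D 0 = 0"
  shows "D t = 0"
proof -
  have "D constant_on UNIV"
  proof (rule continuous_discrete_range_constant[OF _ assms(1)])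
    fix x
    have "2 * pi \<le> norm (D y - D x)" if "D y \<noteq> D x" for y
    proof -
      have "exp (D y) = exp (D x)" using assms(2) by simp
      then obtain n :: int where n: "D y = D x + of_int (2 * n) * pi * \<i>"
        by (auto simp: exp_eq)
      then have "norm (D y - D x) = 2 * pi * \<bar>real_of_int n\<bar>"
        by (simp add: norm_mult)
      moreover have "1 \<le> \<bar>real_of_int n\<bar>"
        using that n by (cases "n = 0") auto
      ultimately show ?thesis by simp
    qed
    then show "\<exists>e>0. \<forall>y. y \<in> UNIV \<and> D y \<noteq> D x \<longrightarrow> e \<le> norm (D y - D x)"
      by (intro exI[of _ "2 * pi"]) auto
  qed simp
  then show ?thesis
    using assms(3) unfolding constant_on_def by (metis UNIV_I)
qed

text \<open>If \<open>f(-t)\<close> is the conjugate of \<open>f(t)\<close>, conjugation of the exponential form gives a second one with the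
  same \<open>\<gamma>\<close>. The two exponents agree up to a continuous logarithm of 1 that vanishes at 0, hence agree, and so does their
  average, whose coefficients are real.\<close>
lemma hermitian_exponential_form:
  assumes G: "real_subgroup G" and f: "ap G f" and \<mu>: "\<mu> > 0" "\<And>t. \<mu> \<le> norm (f t)"
    and f0: "f 0 = 1" and herm: "\<And>t. cnj (f (- t)) = f t"
  shows "\<exists>\<gamma>\<in>G. \<exists>l :: real \<Rightarrow> real. abs_summable l \<and> (\<forall>u. l u \<noteq> 0 \<longrightarrow> u \<in> G) \<and>
    (\<forall>t. f t = cis (t * \<gamma>) * exp (\<Sum>\<^sub>\<infinity>u. of_real (l u) * (cis (t * u) - 1)))"
proof -
  obtain \<gamma> C g where \<gamma>: "\<gamma> \<in> G" and g: "ap G g" and fg: "\<And>t. f t = C * cis (t * \<gamma>) * exp (g t)"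
    using wiener_levy_exponential_form[OF G f \<mu>] by blast
  define c where "c = coef g"
  have c: "ell1 c" "g = trig c" "c summable_on UNIV" "\<And>u. c u \<noteq> 0 \<Longrightarrow> u \<in> G"
    unfolding c_def using ap_coef[OF g] by auto
  define E where "E t = (\<Sum>\<^sub>\<infinity>u. c u * (cis (t * u) - 1))" for t
  have sE: "(\<lambda>u. c u * (cis (t * u) - 1)) summable_on UNIV" for t
    using summable_on_add[OF ell1_trig_summable[OF c(1)] summable_on_uminus[THEN iffD2, OF c(3)], of t]
    by (simp add: algebra_simps)
  have g0: "g 0 = infsum c UNIV"
    by (simp add: c(2) trig_def)
  have E: "E t = g t - g 0" for t
  proof -
    have "E t = (\<Sum>\<^sub>\<infinity>u. c u * cis (t * u) + - c u)"
      unfolding E_def by (simp add: algebra_simps)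
    also have "\<dots> = trig c t + - infsum c UNIV"
      using infsum_add[OF ell1_trig_summable[OF c(1)] summable_on_uminus[THEN iffD2, OF c(3)], of t]
      by (simp add: trig_def infsum_uminus)
    finally show ?thesis by (simp add: g0 fun_cong[OF c(2), of t])
  qed
  have fE: "f t = cis (t * \<gamma>) * exp (E t)" for t
  proof -
    have "C * exp (g 0) = 1" using f0 fg[of 0] by simp
    then have "C = exp (- g 0)" by (metis exp_minus inverse_unique mult.commute)
    then show ?thesis
      unfolding fg E by (simp add: exp_diff exp_minus field_simps)
  qed
  define D where "D t = E t - cnj (E (- t))" for t
  have D0: "D t = 0" for t
  proof (rule continuous_logarithm_of_1_trivial)
    have "continuous_on UNIV g"
      unfolding c(2) by (rule continuous_trig[OF c(1)])
    then have "continuous_on UNIV (\<lambda>t. g (- t))"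
      by (rule continuous_on_compose2[OF _ continuous_on_minus[OF continuous_on_id]]) simp
    with \<open>continuous_on UNIV g\<close> show "continuous_on UNIV D"
      unfolding D_def[abs_def] E by (intro continuous_intros)
    show "D 0 = 0" by (simp add: D_def E)
    show "exp (D t) = 1" for t
    proof -
      have "cis (t * \<gamma>) * exp (E t) = cis (t * \<gamma>) * exp (cnj (E (- t)))"
        using herm[of t] unfolding fE by (simp add: cis_cnj exp_cnj)
      then have "exp (E t) = exp (cnj (E (- t)))" by simp
      then show ?thesis by (simp add: D_def exp_diff)
    qed
  qed
  define l where "l u = Re (c u)" for u
  have l: "abs_summable l"
    by (rule absum_comparison[OF c(1), of l, unfolded real_norm_def])
       (simp add: l_def abs_Re_le_cmod)
  have El: "(\<Sum>\<^sub>\<infinity>u. of_real (l u) * (cis (t * u) - 1)) = E t" for t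
  proof -
    have cn: "cnj (E (- t)) = (\<Sum>\<^sub>\<infinity>u. cnj (c u) * (cis (t * u) - 1))"
      unfolding E_def infsum_cnj[symmetric] by (simp add: cis_cnj)
    have scn: "(\<lambda>u. cnj (c u) * (cis (t * u) - 1)) summable_on UNIV"
      using sE[of "- t"] summable_on_cnj_iff[of "\<lambda>u. c u * (cis (- t * u) - 1)" UNIV] by (simp add: cis_cnj)
    have "of_real (l u) * (cis (t * u) - 1) = (1/2) * (c u * (cis (t * u) - 1) + cnj (c u) * (cis (t * u) - 1))" for u
    proof -
      have "complex_of_real (l u) = (1/2) * (c u + cnj (c u))"
        unfolding l_def complex_add_cnj by simp
      then show ?thesis by (simp only: distrib_right mult.assoc)
    qed
    then have "(\<Sum>\<^sub>\<infinity>u. of_real (l u) * (cis (t * u) - 1))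
        = (1/2) * (\<Sum>\<^sub>\<infinity>u. c u * (cis (t * u) - 1) + cnj (c u) * (cis (t * u) - 1))"
      by (simp only: infsum_cmult_right')
    also have "\<dots> = (1/2) * (E t + cnj (E (- t)))"
      unfolding cn using infsum_add[OF sE scn] by (simp add: E_def)
    also have "\<dots> = E t"
      using D0[of t] by (simp add: D_def)
    finally show ?thesis .
  qed
  have lG: "u \<in> G" if "l u \<noteq> 0" for u
    using that by (intro c(4)) (auto simp: l_def)
  show ?thesis
    using \<gamma> l lG fE by (intro bexI[of _ \<gamma>] exI[of _ l]) (auto simp: El)
qed

section \<open>Estimates of Stieltjes integrals\<close>

text \<open>The Stieltjes sum and the mesh of a tagged division, as in the definition of the integral.\<close>
abbreviation stieltjes_sum :: "(real \<Rightarrow> 'a::real_normed_vector) \<Rightarrow> (real \<Rightarrow> real) \<Rightarrow> (real \<times> real set) set \<Rightarrow> 'a" where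
  "stieltjes_sum f g D \<equiv> \<Sum>(x, K)\<in>D. (g (Sup K) - g (Inf K)) *\<^sub>R f x"

abbreviation mesh_less :: "real \<Rightarrow> (real \<times> real set) set \<Rightarrow> bool" where
  "mesh_less d D \<equiv> \<forall>(x, K)\<in>D. Sup K - Inf K < d"

lemma tagged_interval_real:
  assumes "D tagged_division_of {a..b::real}" "(x, K) \<in> D"
  shows "K = {Inf K..Sup K}" "Inf K \<le> x" "x \<le> Sup K" "a \<le> Inf K" "Sup K \<le> b"
proof -
  obtain u v where K: "K = {u..v}"
    using tagged_division_ofD(4)[OF assms] by auto
  have x: "x \<in> K" "K \<subseteq> {a..b}"
    using tagged_division_ofD(2,3)[OF assms] .
  then have "u \<le> v" using K by auto
  then show "K = {Inf K..Sup K}" "Inf K \<le> x" "x \<le> Sup K" "a \<le> Inf K" "Sup K \<le> b"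
    using K x by auto
qed

lemma fine_tagged_division_exists:
  fixes a b d :: real
  assumes "d > 0"
  obtains D where "D tagged_division_of {a..b}" "\<And>x K. (x, K) \<in> D \<Longrightarrow> Sup K - Inf K < d"
proof -
  obtain D where D: "D tagged_division_of {a..b}" "(\<lambda>x. ball x (d / 3)) fine D"
    using fine_division_exists_real[of "\<lambda>x. ball x (d / 3)" a b] gauge_ball[of "d / 3"] assms by auto
  show ?thesis
  proof (rule that[OF D(1)])
    fix x K assume xK: "(x, K) \<in> D"
    note t = tagged_interval_real[OF D(1) xK]
    have "K \<subseteq> ball x (d / 3)" using D(2) xK by (auto simp: fine_def)
    moreover have "Inf K \<in> K" "Sup K \<in> K" using t(1,2,3) by (metis atLeastAtMost_iff order.trans order.refl)+
    ultimately have "dist x (Inf K) < d / 3" "dist x (Sup K) < d / 3" by auto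
    then show "Sup K - Inf K < d" unfolding dist_real_def by linarith
  qed
qed

abbreviation abs_stieltjes_sum :: "(real \<Rightarrow> 'a::real_normed_vector) \<Rightarrow> (real \<Rightarrow> real) \<Rightarrow> (real \<times> real set) set \<Rightarrow> real" where
  "abs_stieltjes_sum h L D \<equiv> \<Sum>(x, K)\<in>D. \<bar>L (Sup K) - L (Inf K)\<bar> * norm (h x)"

text \<open>On the interval from \<open>a\<close> to \<open>b\<close> there are arbitrarily fine tagged divisions for which the absolute
  Stieltjes sum of \<open>h\<close> with respect to \<open>L\<close> is at most \<open>B\<close>. Existence is enough to bound an integral that is known
  to exist, and it leaves the choice of the divisions free.\<close>
definition fine_sums_le :: "(real \<Rightarrow> 'a::real_normed_vector) \<Rightarrow> (real \<Rightarrow> real) \<Rightarrow> real \<Rightarrow> real \<Rightarrow> real \<Rightarrow> bool" where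
  "fine_sums_le h L a b B \<longleftrightarrow> (\<forall>d>0. \<exists>D. D tagged_division_of {a..b} \<and>
     mesh_less d D \<and> abs_stieltjes_sum h L D \<le> B)"

text \<open>The integral over the whole interval is tested on unions of fine divisions of its two parts; this
  avoids splitting the integral itself.\<close>
lemma norm_stieltjes_integral_le:
  assumes I: "has_stieltjes_integral h L a b J" and m: "a \<le> m" "m \<le> b"
    and B1: "fine_sums_le h L a m B1" and B2: "fine_sums_le h L m b B2"
  shows "norm J \<le> B1 + B2"
proof (rule field_le_epsilon)
  fix e :: real assume "e > 0"
  then obtain d where d: "d > 0" and dJ: "\<And>D. D tagged_division_of {a..b} \<Longrightarrow> mesh_less d D \<Longrightarrow>
      norm (stieltjes_sum h L D - J) < e"
    using I unfolding has_stieltjes_integral_def by meson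
  obtain D1 where D1: "D1 tagged_division_of {a..m}" "mesh_less d D1"
      "abs_stieltjes_sum h L D1 \<le> B1"
    using B1 d unfolding fine_sums_le_def by meson
  obtain D2 where D2: "D2 tagged_division_of {m..b}" "mesh_less d D2"
      "abs_stieltjes_sum h L D2 \<le> B2"
    using B2 d unfolding fine_sums_le_def by meson
  have D: "(D1 \<union> D2) tagged_division_of {a..b}"
    using tagged_division_Un[OF D1(1) D2(1)] m by (simp add: ivl_disj_un_two_touch(4))
  have fin: "finite D1" "finite D2"
    using D1(1) D2(1) by (auto intro: tagged_division_of_finite)
  let ?F = "\<lambda>(x, K). \<bar>L (Sup K) - L (Inf K)\<bar> * norm (h x)"
  let ?S = "stieltjes_sum h L (D1 \<union> D2)"
  have "norm ?S \<le> sum ?F (D1 \<union> D2)"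
    by (rule order_trans[OF norm_sum]) (simp add: case_prod_unfold)
  also have "\<dots> \<le> sum ?F D1 + sum ?F D2"
    using sum.union_inter[OF fin, of ?F] sum_nonneg[of "D1 \<inter> D2" ?F] by (simp add: case_prod_unfold)
  also have "\<dots> \<le> B1 + B2" using D1(3) D2(3) by simp
  finally have "norm ?S \<le> B1 + B2" .
  moreover have "norm (?S - J) < e"
    using D1(2) D2(2) by (intro dJ[OF D]) blast
  ultimately show "norm J \<le> B1 + B2 + e"
    using norm_triangle_ineq4[of ?S "?S - J"] by simp
qed

lemma fine_sums_leI:
  assumes d0: "d0 > 0"
    and B: "\<And>D. D tagged_division_of {a..b} \<Longrightarrow> mesh_less d0 D \<Longrightarrow> abs_stieltjes_sum h L D \<le> B"
  shows "fine_sums_le h L a b B"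
  unfolding fine_sums_le_def
proof (intro allI impI)
  fix d :: real assume d: "d > 0"
  obtain D where D: "D tagged_division_of {a..b}" "\<And>x K. (x, K) \<in> D \<Longrightarrow> Sup K - Inf K < min d d0"
    using fine_tagged_division_exists[of "min d d0"] d d0 by auto
  then have "mesh_less d D" "mesh_less d0 D" by fastforce+
  with D(1) B show "\<exists>D. D tagged_division_of {a..b} \<and> mesh_less d D \<and> abs_stieltjes_sum h L D \<le> B"
    by blast
qed

lemma abs_stieltjes_sum_le:
  assumes D: "D tagged_division_of {a..b}"
    and V: "\<And>u v. a \<le> u \<Longrightarrow> u \<le> v \<Longrightarrow> v \<le> b \<Longrightarrow> \<bar>L v - L u\<bar> \<le> V v - V u"
    and h: "\<And>x. a \<le> x \<Longrightarrow> x \<le> b \<Longrightarrow> norm (h x) \<le> k x"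
  shows "abs_stieltjes_sum h L D \<le> stieltjes_sum k V D"
proof (intro sum_mono, clarify)
  fix x K assume "(x, K) \<in> D"
  note t = tagged_interval_real(2-)[OF D this]
  show "\<bar>L (Sup K) - L (Inf K)\<bar> * norm (h x) \<le> (V (Sup K) - V (Inf K)) *\<^sub>R k x"
    unfolding real_scaleR_def
    using t order_trans[OF abs_ge_zero V[of "Inf K" "Sup K"]] by (intro mult_mono V h) auto
qed

text \<open>For later use away from 0 and near 0, respectively: a bounded integrand is estimated by the increment of a function \<open>V\<close> dominating the
  increments of \<open>L\<close>; an integrand \<open>O(u\<^sup>2)\<close> is estimated by the Stieltjes integral of \<open>u\<^sup>2\<close> with respect
  to \<open>V\<close>.\<close>
lemma fine_sums_le_uniform:
  assumes ab: "a \<le> b" and V: "\<And>u v. a \<le> u \<Longrightarrow> u \<le> v \<Longrightarrow> v \<le> b \<Longrightarrow> \<bar>L v - L u\<bar> \<le> V v - V u"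
    and h: "\<And>x. a \<le> x \<Longrightarrow> x \<le> b \<Longrightarrow> norm (h x) \<le> C"
  shows "fine_sums_le h L a b (C * (V b - V a))"
proof (rule fine_sums_leI[of 1])
  fix D assume D: "D tagged_division_of {a..b}"
  have "stieltjes_sum (\<lambda>x. C) V D = C * (V b - V a)"
    using additive_tagged_division_1[OF ab D, of V]
    by (simp add: case_prod_unfold sum_distrib_right[symmetric])
  moreover have "abs_stieltjes_sum h L D \<le> stieltjes_sum (\<lambda>x. C) V D"
    by (rule abs_stieltjes_sum_le[OF D]) (auto intro: V h)
  ultimately show "abs_stieltjes_sum h L D \<le> C * (V b - V a)" by simp
qed simp

lemma fine_sums_le_quadratic:
  fixes J :: real
  assumes J: "has_stieltjes_integral (\<lambda>u. u\<^sup>2) V a b J"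
    and V: "\<And>u v. a \<le> u \<Longrightarrow> u \<le> v \<Longrightarrow> v \<le> b \<Longrightarrow> \<bar>L v - L u\<bar> \<le> V v - V u"
    and h: "\<And>x. a \<le> x \<Longrightarrow> x \<le> b \<Longrightarrow> norm (h x) \<le> C * x\<^sup>2" and C: "C \<ge> 0"
  shows "fine_sums_le h L a b (C * (\<bar>J\<bar> + 1))"
proof -
  let ?S = "stieltjes_sum (\<lambda>x. x\<^sup>2) V"
  obtain d0 where d0: "d0 > 0" and dJ: "\<And>D. D tagged_division_of {a..b} \<Longrightarrow> mesh_less d0 D \<Longrightarrow>
      norm (?S D - J) < 1"
    using J unfolding has_stieltjes_integral_def by (meson zero_less_one)
  show ?thesis
  proof (rule fine_sums_leI[OF d0])
    fix D assume D: "D tagged_division_of {a..b}" "mesh_less d0 D"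
    have S: "?S D \<le> \<bar>J\<bar> + 1"
      using dJ[OF D] unfolding real_norm_def by linarith
    have "abs_stieltjes_sum h L D \<le> stieltjes_sum (\<lambda>x. C * x\<^sup>2) V D"
      by (rule abs_stieltjes_sum_le[OF D(1)]) (auto intro: V h)
    also have "\<dots> = C * ?S D"
      unfolding sum_distrib_left by (intro sum.cong) auto
    also have "\<dots> \<le> C * (\<bar>J\<bar> + 1)"
      by (rule mult_left_mono[OF S C])
    finally show "abs_stieltjes_sum h L D \<le> C * (\<bar>J\<bar> + 1)" .
  qed
qed

lemma has_stieltjes_integral_add_scaleR:
  assumes "has_stieltjes_integral f g a b I" "has_stieltjes_integral f' g a b I'"
  shows "has_stieltjes_integral (\<lambda>u. f u + c *\<^sub>R f' u) g a b (I + c *\<^sub>R I')"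
  unfolding has_stieltjes_integral_def
proof (intro allI impI)
  fix e :: real assume "e > 0"
  then have e: "e / 2 > 0" "e / 2 / (\<bar>c\<bar> + 1) > 0" by simp_all
  have c1: "\<bar>c\<bar> + 1 \<noteq> 0" by linarith
  let ?D = "\<lambda>D d. D tagged_division_of {a..b} \<and> mesh_less d D"
  obtain d where d: "d > 0" "\<And>D. ?D D d \<Longrightarrow> norm (stieltjes_sum f g D - I) < e / 2"
    using assms(1) e(1) unfolding has_stieltjes_integral_def by meson
  obtain d' where d': "d' > 0" "\<And>D. ?D D d' \<Longrightarrow> norm (stieltjes_sum f' g D - I') < e / 2 / (\<bar>c\<bar> + 1)"
    using assms(2) e(2) unfolding has_stieltjes_integral_def by meson
  show "\<exists>d>0. \<forall>D. ?D D d \<longrightarrow> norm (stieltjes_sum (\<lambda>x. f x + c *\<^sub>R f' x) g D - (I + c *\<^sub>R I')) < e"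
  proof (intro exI[of _ "min d d'"] conjI allI impI)
    show "0 < min d d'" using d d' by simp
    fix D assume "?D D (min d d')"
    then have D: "?D D d" "?D D d'" by fastforce+
    let ?S = "stieltjes_sum f g D" and ?S' = "stieltjes_sum f' g D"
    have "stieltjes_sum (\<lambda>x. f x + c *\<^sub>R f' x) g D = ?S + c *\<^sub>R ?S'"
      by (simp add: case_prod_unfold scaleR_add_right sum.distrib scaleR_sum_right mult.commute)
    then have eq: "stieltjes_sum (\<lambda>x. f x + c *\<^sub>R f' x) g D - (I + c *\<^sub>R I') = (?S - I) + c *\<^sub>R (?S' - I')"
      by (simp add: scaleR_diff_right)
    have "norm (c *\<^sub>R (?S' - I')) \<le> (\<bar>c\<bar> + 1) * norm (?S' - I')"
      unfolding norm_scaleR by (rule mult_right_mono) auto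
    also have "\<dots> < (\<bar>c\<bar> + 1) * (e / 2 / (\<bar>c\<bar> + 1))"
      by (rule mult_strict_left_mono[OF d'(2)[OF D(2)]]) simp
    also have "\<dots> = e / 2"
      using nonzero_mult_div_cancel_left[OF c1, of "e / 2"] by (simp only: times_divide_eq_right)
    finally have "norm ((?S - I) + c *\<^sub>R (?S' - I')) < e / 2 + e / 2"
      by (intro order.strict_trans1[OF norm_triangle_ineq] add_strict_mono d(2)[OF D(1)])
    then show "norm (stieltjes_sum (\<lambda>x. f x + c *\<^sub>R f' x) g D - (I + c *\<^sub>R I')) < e"
      by (simp only: eq field_sum_of_halves)
  qed
qed

lemma improper_stieltjes_add_scaleR:
  assumes "has_improper_stieltjes_integral f g A B I" "has_improper_stieltjes_integral f' g A B I'"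
  shows "has_improper_stieltjes_integral (\<lambda>u. f u + c *\<^sub>R f' u) g A B (I + c *\<^sub>R I')"
proof -
  obtain J J' where J: "\<forall>\<^sub>F (a, b) in A \<times>\<^sub>F B. has_stieltjes_integral f g a b (J (a, b))" "(J \<longlongrightarrow> I) (A \<times>\<^sub>F B)"
    and J': "\<forall>\<^sub>F (a, b) in A \<times>\<^sub>F B. has_stieltjes_integral f' g a b (J' (a, b))" "(J' \<longlongrightarrow> I') (A \<times>\<^sub>F B)"
    using assms unfolding has_improper_stieltjes_integral_def by blast
  have "\<forall>\<^sub>F (a, b) in A \<times>\<^sub>F B. has_stieltjes_integral (\<lambda>u. f u + c *\<^sub>R f' u) g a b (J (a, b) + c *\<^sub>R J' (a, b))"
    using J(1) J'(1) by eventually_elim (auto intro: has_stieltjes_integral_add_scaleR)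
  moreover have "((\<lambda>p. J p + c *\<^sub>R J' p) \<longlongrightarrow> I + c *\<^sub>R I') (A \<times>\<^sub>F B)"
    by (intro tendsto_intros J J')
  ultimately show ?thesis
    unfolding has_improper_stieltjes_integral_def by (intro exI[of _ "\<lambda>p. J p + c *\<^sub>R J' p"]) simp
qed

lemma has_stieltjes_integral_off_0_add_scaleR:
  assumes "has_stieltjes_integral_off_0 f g I" "has_stieltjes_integral_off_0 f' g I'"
  shows "has_stieltjes_integral_off_0 (\<lambda>u. f u + c *\<^sub>R f' u) g (I + c *\<^sub>R I')"
proof -
  obtain I1 I2 J1 J2 where "has_improper_stieltjes_integral f g at_bot (at_left 0) I1"
    "has_improper_stieltjes_integral f g (at_right 0) at_top I2" "I = I1 + I2"
    "has_improper_stieltjes_integral f' g at_bot (at_left 0) J1"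
    "has_improper_stieltjes_integral f' g (at_right 0) at_top J2" "I' = J1 + J2"
    using assms unfolding has_stieltjes_integral_off_0_def by blast
  then show ?thesis
    unfolding has_stieltjes_integral_off_0_def
    by (intro exI[of _ "I1 + c *\<^sub>R J1"] exI[of _ "I2 + c *\<^sub>R J2"])
       (auto intro: improper_stieltjes_add_scaleR simp: scaleR_add_right)
qed

section \<open>Total variation\<close>

lemma zero_in_variation_sums: "u \<in> S \<Longrightarrow> 0 \<in> variation_sums g S"
  unfolding variation_sums_def by (intro CollectI exI[of _ 0] exI[of _ "\<lambda>_. u"]) simp

lemma variation_sum_le_total_variation:
  "finite_variation_on g S \<Longrightarrow> s \<in> variation_sums g S \<Longrightarrow> s \<le> total_variation g S"
  unfolding finite_variation_on_def total_variation_def by (rule cSup_upper)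

lemma total_variation_nonneg: "finite_variation_on g S \<Longrightarrow> u \<in> S \<Longrightarrow> 0 \<le> total_variation g S"
  by (rule variation_sum_le_total_variation[OF _ zero_in_variation_sums])

lemma total_variation_atLeast_superadditive:
  assumes fv: "finite_variation_on g {u..}" and uv: "u \<le> v"
  shows "\<bar>g v - g u\<bar> + total_variation g {v..} \<le> total_variation g {u..}"
proof -
  have "total_variation g {v..} \<le> total_variation g {u..} - \<bar>g v - g u\<bar>"
    unfolding total_variation_def[of g "{v..}"]
  proof (rule cSup_least)
    show "variation_sums g {v..} \<noteq> {}" using zero_in_variation_sums[of v "{v..}"] by auto
    fix s assume "s \<in> variation_sums g {v..}"
    then obtain n x where s: "s = (\<Sum>i<n. \<bar>g (x (Suc i)) - g (x i)\<bar>)"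
      and x: "\<forall>i\<le>n. v \<le> x i" "\<forall>i<n. x i \<le> x (Suc i)"
      unfolding variation_sums_def by auto
    define y where "y i = (case i of 0 \<Rightarrow> u | Suc 0 \<Rightarrow> v | Suc (Suc j) \<Rightarrow> x j)" for i
    have y: "y 0 = u" "y (Suc 0) = v" "\<And>j. y (Suc (Suc j)) = x j"
      by (simp_all add: y_def)
    have "(\<Sum>i<Suc (Suc n). \<bar>g (y (Suc i)) - g (y i)\<bar>) \<in> variation_sums g {u..}"
      unfolding variation_sums_def
    proof (intro CollectI exI conjI allI impI)
      show "y i \<in> {u..}" if "i \<le> Suc (Suc n)" for i
        using that uv x(1) by (auto simp: y_def split: nat.split intro: order_trans)
      show "y i \<le> y (Suc i)" if "i < Suc (Suc n)" for i
        using that uv x by (auto simp: y_def split: nat.split)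
    qed simp
    then have "(\<Sum>i<Suc (Suc n). \<bar>g (y (Suc i)) - g (y i)\<bar>) \<le> total_variation g {u..}"
      by (rule variation_sum_le_total_variation[OF fv])
    then show "s \<le> total_variation g {u..} - \<bar>g v - g u\<bar>"
      unfolding sum.lessThan_Suc_shift y s using abs_ge_zero[of "g (x 0) - g v"] by linarith
  qed
  then show ?thesis by simp
qed

lemma total_variation_atMost_superadditive:
  assumes fv: "finite_variation_on g {..v}" and uv: "u \<le> v"
  shows "\<bar>g v - g u\<bar> + total_variation g {..u} \<le> total_variation g {..v}"
proof -
  have "total_variation g {..u} \<le> total_variation g {..v} - \<bar>g v - g u\<bar>"
    unfolding total_variation_def[of g "{..u}"]
  proof (rule cSup_least)
    show "variation_sums g {..u} \<noteq> {}" using zero_in_variation_sums[of u "{..u}"] by auto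
    fix s assume "s \<in> variation_sums g {..u}"
    then obtain n x where s: "s = (\<Sum>i<n. \<bar>g (x (Suc i)) - g (x i)\<bar>)"
      and x: "\<forall>i\<le>n. x i \<le> u" "\<forall>i<n. x i \<le> x (Suc i)"
      unfolding variation_sums_def by auto
    define y where "y i = (if i \<le> n then x i else if i = Suc n then u else v)" for i
    have "(\<Sum>i<Suc (Suc n). \<bar>g (y (Suc i)) - g (y i)\<bar>) \<in> variation_sums g {..v}"
      unfolding variation_sums_def
    proof (intro CollectI exI conjI allI impI)
      show "y i \<in> {..v}" if "i \<le> Suc (Suc n)" for i
        using that uv x(1) by (auto simp: y_def intro: order_trans)
      show "y i \<le> y (Suc i)" if "i < Suc (Suc n)" for i
        using that uv x by (auto simp: y_def le_Suc_eq not_le less_Suc_eq)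
    qed simp
    then have *: "(\<Sum>i<Suc (Suc n). \<bar>g (y (Suc i)) - g (y i)\<bar>) \<le> total_variation g {..v}"
      by (rule variation_sum_le_total_variation[OF fv])
    have "(\<Sum>i<n. \<bar>g (y (Suc i)) - g (y i)\<bar>) = s"
      unfolding s by (rule sum.cong) (auto simp: y_def)
    then have "(\<Sum>i<Suc (Suc n). \<bar>g (y (Suc i)) - g (y i)\<bar>) = s + \<bar>g u - g (x n)\<bar> + \<bar>g v - g u\<bar>"
      by (simp add: y_def)
    then show "s \<le> total_variation g {..v} - \<bar>g v - g u\<bar>"
      using * abs_ge_zero[of "g u - g (x n)"] by linarith
  qed
  then show ?thesis by simp
qed

lemma levy_finite_variation:
  assumes "levy_spectral_function L"
  shows "\<forall>r>0. finite_variation_on L {..-r} \<and> finite_variation_on L {r..}"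
  using assms unfolding levy_spectral_function_def by blast

lemma variation_increment:
  assumes L: "\<forall>r>0. finite_variation_on L {..-r} \<and> finite_variation_on L {r..}"
    and uv: "u \<le> v" and s: "u > 0 \<or> v < 0"
  shows "\<bar>L v - L u\<bar> \<le> variation_function L v - variation_function L u"
  using s
proof
  assume "u > 0"
  then show ?thesis
    using total_variation_atLeast_superadditive[of L u v] L uv by (simp add: variation_function_def)
next
  assume "v < 0"
  then have "finite_variation_on L {..v}" using L[rule_format, of "- v"] by simp
  then show ?thesis
    using total_variation_atMost_superadditive[OF _ uv, of L] uv \<open>v < 0\<close>
    by (simp add: variation_function_def)
qed

lemma variation_sign:
  assumes L: "\<forall>r>0. finite_variation_on L {..-r} \<and> finite_variation_on L {r..}"
  shows "u > 0 \<Longrightarrow> variation_function L u \<le> 0" "u < 0 \<Longrightarrow> 0 \<le> variation_function L u"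
  using total_variation_nonneg[of L "{u..}" u] total_variation_nonneg[of L "{..u}" u]
    L[rule_format, of u] L[rule_format, of "- u"] by (auto simp: variation_function_def)

section \<open>Second differences of the Levy exponent\<close>

lemma fine_sums_le_mono: "fine_sums_le h L a b B \<Longrightarrow> B \<le> B' \<Longrightarrow> fine_sums_le h L a b B'"
  unfolding fine_sums_le_def by (meson order_trans)

lemma norm_improper_stieltjes_integral_le:
  assumes I: "has_improper_stieltjes_integral h L A B I" and nt: "A \<noteq> bot" "B \<noteq> bot"
    and bd: "\<forall>\<^sub>F (a, b) in A \<times>\<^sub>F B. a \<le> m \<and> m \<le> b \<and> fine_sums_le h L a m B1 \<and> fine_sums_le h L m b B2"
  shows "norm I \<le> B1 + B2"
proof -
  obtain J where J: "\<forall>\<^sub>F (a, b) in A \<times>\<^sub>F B. has_stieltjes_integral h L a b (J (a, b))" "(J \<longlongrightarrow> I) (A \<times>\<^sub>F B)"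
    using I unfolding has_improper_stieltjes_integral_def by blast
  have "\<forall>\<^sub>F p in A \<times>\<^sub>F B. norm (J p) \<le> B1 + B2"
    using J(1) bd by eventually_elim (auto intro: norm_stieltjes_integral_le)
  then show ?thesis
    using nt by (intro tendsto_upperbound[OF tendsto_norm[OF J(2)]]) (auto simp: prod_filter_eq_bot)
qed

text \<open>The values of a convergent improper integral over compact intervals are eventually bounded.\<close>
lemma improper_integral_locally_bounded:
  fixes I :: real
  assumes "has_improper_stieltjes_integral h V A B I"
  obtains P Q where "eventually P A" "eventually Q B"
    "\<And>a b. P a \<Longrightarrow> Q b \<Longrightarrow> \<exists>J. has_stieltjes_integral h V a b J \<and> \<bar>J\<bar> \<le> \<bar>I\<bar> + 1"
proof -
  obtain J where J: "\<forall>\<^sub>F (a, b) in A \<times>\<^sub>F B. has_stieltjes_integral h V a b (J (a, b))" "(J \<longlongrightarrow> I) (A \<times>\<^sub>F B)"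
    using assms unfolding has_improper_stieltjes_integral_def by blast
  have "\<forall>\<^sub>F p in A \<times>\<^sub>F B. dist (J p) I < 1"
    using tendstoD[OF J(2), of 1] by simp
  with J(1) have "\<forall>\<^sub>F (a, b) in A \<times>\<^sub>F B. has_stieltjes_integral h V a b (J (a, b)) \<and> \<bar>J (a, b)\<bar> \<le> \<bar>I\<bar> + 1"
    by eventually_elim (auto simp: dist_real_def)
  then obtain P Q where "eventually P A" "eventually Q B"
     "\<And>a b. P a \<Longrightarrow> Q b \<Longrightarrow> has_stieltjes_integral h V a b (J (a, b)) \<and> \<bar>J (a, b)\<bar> \<le> \<bar>I\<bar> + 1"
    unfolding eventually_prod_filter by auto
  then show ?thesis using that by blast
qed

text \<open>The pointwise bounds on the integrands considered below.\<close>
definition levy_dominated :: "real \<Rightarrow> (real \<Rightarrow> complex) \<Rightarrow> bool" where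
  "levy_dominated C h \<longleftrightarrow> C \<ge> 0 \<and> (\<forall>u. norm (h u) \<le> C \<and> norm (h u) \<le> C * u\<^sup>2)"

text \<open>An integral over a half-line with respect to a Levy spectral function is bounded in terms of \<open>C\<close>. The
  point \<open>m\<close> separates the part near 0, controlled by the integral of \<open>u\<^sup>2\<close>, from the part controlled by the
  total variation.\<close>
lemma levy_integral_bound_pos:
  assumes L: "levy_spectral_function L"
  obtains K where "\<And>h C I. levy_dominated C h \<Longrightarrow>
     has_improper_stieltjes_integral h L (at_right 0) at_top I \<Longrightarrow> norm I \<le> C * K"
proof -
  let ?V = "variation_function L"
  note fv = levy_finite_variation[OF L]
  obtain I0 :: real where "has_improper_stieltjes_integral (\<lambda>u. u\<^sup>2) ?V (at_right 0) (at_left 1) I0"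
    using L unfolding levy_spectral_function_def by (metis zero_less_one)
  then obtain P Q where PQ: "eventually P (at_right (0::real))" "eventually Q (at_left (1::real))"
     "\<And>a b. P a \<Longrightarrow> Q b \<Longrightarrow> \<exists>J. has_stieltjes_integral (\<lambda>u. u\<^sup>2) ?V a b J \<and> \<bar>J\<bar> \<le> \<bar>I0\<bar> + 1"
    by (rule improper_integral_locally_bounded) blast
  have "eventually (\<lambda>b. Q b \<and> b > 0) (at_left (1::real))"
    using PQ(2) eventually_at_left_real[of 0 1, OF zero_less_one] by eventually_elim auto
  then obtain m where m: "Q m" "m > 0"
    using eventually_happens[of _ "at_left (1::real)"] by auto
  show ?thesis
  proof (rule that)
    fix h C I
    assume "levy_dominated C h" and I: "has_improper_stieltjes_integral h L (at_right 0) at_top I"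
    then have C: "C \<ge> 0" and h: "\<And>u. norm (h u) \<le> C" "\<And>u. norm (h u) \<le> C * u\<^sup>2"
      by (auto simp: levy_dominated_def)
    have "eventually (\<lambda>a. P a \<and> 0 < a \<and> a < m) (at_right (0::real))"
      using PQ(1) eventually_at_right_real[OF m(2)] by eventually_elim auto
    then have "\<forall>\<^sub>F p in at_right 0 \<times>\<^sub>F at_top. (P (fst p) \<and> 0 < fst p \<and> fst p < m) \<and> m \<le> snd p"
      by (intro eventually_prodI eventually_ge_at_top)
    then have "\<forall>\<^sub>F (a, b) in at_right 0 \<times>\<^sub>F at_top. a \<le> m \<and> m \<le> b \<and>
        fine_sums_le h L a m (C * (\<bar>I0\<bar> + 2)) \<and> fine_sums_le h L m b (C * - ?V m)"
    proof eventually_elim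
      case (elim p)
      obtain a b where p: "p = (a, b)" by (cases p)
      have ab: "P a" "0 < a" "a < m" "m \<le> b" using elim by (auto simp: p)
      obtain J where J: "has_stieltjes_integral (\<lambda>u. u\<^sup>2) ?V a m J" "\<bar>J\<bar> \<le> \<bar>I0\<bar> + 1"
        using PQ(3)[OF ab(1) m(1)] by blast
      have "fine_sums_le h L a m (C * (\<bar>J\<bar> + 1))"
        using ab by (intro fine_sums_le_quadratic[OF J(1) _ h(2) C] variation_increment[OF fv]) auto
      then have "fine_sums_le h L a m (C * (\<bar>I0\<bar> + 2))"
        by (rule fine_sums_le_mono) (use J(2) C in \<open>simp add: mult_left_mono\<close>)
      moreover have "fine_sums_le h L m b (C * (?V b - ?V m))"
        using ab m by (intro fine_sums_le_uniform[OF _ _ h(1)] variation_increment[OF fv]) auto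
      then have "fine_sums_le h L m b (C * - ?V m)"
        by (rule fine_sums_le_mono, intro mult_left_mono C)
           (use variation_sign(1)[OF fv, of b] ab m in auto)
      ultimately show ?case using ab by (simp add: p)
    qed
    then have "norm I \<le> C * (\<bar>I0\<bar> + 2) + C * - ?V m"
      by (intro norm_improper_stieltjes_integral_le[OF I]) simp_all
    then show "norm I \<le> C * (\<bar>I0\<bar> + 2 + - ?V m)"
      by (simp only: distrib_left)
  qed
qed

lemma levy_integral_bound_neg:
  assumes L: "levy_spectral_function L"
  obtains K where "\<And>h C I. levy_dominated C h \<Longrightarrow>
     has_improper_stieltjes_integral h L at_bot (at_left 0) I \<Longrightarrow> norm I \<le> C * K"
proof -
  let ?V = "variation_function L"
  note fv = levy_finite_variation[OF L]
  obtain I0 :: real where "has_improper_stieltjes_integral (\<lambda>u. u\<^sup>2) ?V (at_right (-1)) (at_left 0) I0"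
    using L unfolding levy_spectral_function_def by (metis zero_less_one)
  then obtain P Q where PQ: "eventually P (at_right (-1::real))" "eventually Q (at_left (0::real))"
     "\<And>a b. P a \<Longrightarrow> Q b \<Longrightarrow> \<exists>J. has_stieltjes_integral (\<lambda>u. u\<^sup>2) ?V a b J \<and> \<bar>J\<bar> \<le> \<bar>I0\<bar> + 1"
    by (rule improper_integral_locally_bounded) blast
  have "eventually (\<lambda>a. P a \<and> a < 0) (at_right (-1::real))"
    using PQ(1) eventually_at_right_real[OF neg_less_0_iff_less[THEN iffD2, OF zero_less_one]]
    by eventually_elim auto
  then obtain m where m: "P m" "m < 0"
    using eventually_happens[of _ "at_right (-1::real)"] by auto
  show ?thesis
  proof (rule that)
    fix h C I
    assume "levy_dominated C h" and I: "has_improper_stieltjes_integral h L at_bot (at_left 0) I"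
    then have C: "C \<ge> 0" and h: "\<And>u. norm (h u) \<le> C" "\<And>u. norm (h u) \<le> C * u\<^sup>2"
      by (auto simp: levy_dominated_def)
    have "eventually (\<lambda>b. Q b \<and> b < 0 \<and> m < b) (at_left (0::real))"
      using PQ(2) eventually_at_left_real[OF m(2)] by eventually_elim auto
    then have "\<forall>\<^sub>F p in at_bot \<times>\<^sub>F at_left 0. fst p \<le> m \<and> (Q (snd p) \<and> snd p < 0 \<and> m < snd p)"
      by (intro eventually_prodI eventually_le_at_bot)
    then have "\<forall>\<^sub>F (a, b) in at_bot \<times>\<^sub>F at_left 0. a \<le> m \<and> m \<le> b \<and>
        fine_sums_le h L a m (C * ?V m) \<and> fine_sums_le h L m b (C * (\<bar>I0\<bar> + 2))"
    proof eventually_elim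
      case (elim p)
      obtain a b where p: "p = (a, b)" by (cases p)
      have ab: "Q b" "b < 0" "m < b" "a \<le> m" using elim by (auto simp: p)
      obtain J where J: "has_stieltjes_integral (\<lambda>u. u\<^sup>2) ?V m b J" "\<bar>J\<bar> \<le> \<bar>I0\<bar> + 1"
        using PQ(3)[OF m(1) ab(1)] by blast
      have "fine_sums_le h L m b (C * (\<bar>J\<bar> + 1))"
        using ab by (intro fine_sums_le_quadratic[OF J(1) _ h(2) C] variation_increment[OF fv]) auto
      then have "fine_sums_le h L m b (C * (\<bar>I0\<bar> + 2))"
        by (rule fine_sums_le_mono) (use J(2) C in \<open>simp add: mult_left_mono\<close>)
      moreover have "fine_sums_le h L a m (C * (?V m - ?V a))"
        using ab m by (intro fine_sums_le_uniform[OF _ _ h(1)] variation_increment[OF fv]) auto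
      then have "fine_sums_le h L a m (C * ?V m)"
        by (rule fine_sums_le_mono, intro mult_left_mono C)
           (use variation_sign(2)[OF fv, of a] ab m in auto)
      ultimately show ?case using ab by (simp add: p)
    qed
    then have "norm I \<le> C * ?V m + C * (\<bar>I0\<bar> + 2)"
      by (intro norm_improper_stieltjes_integral_le[OF I]) simp_all
    then show "norm I \<le> C * (?V m + (\<bar>I0\<bar> + 2))"
      by (simp only: distrib_left)
  qed
qed

text \<open>The integrand of the Levy representation.\<close>
abbreviation levy_kernel :: "real \<Rightarrow> real \<Rightarrow> complex" where
  "levy_kernel t \<equiv> (\<lambda>u. iexp (t * u) - 1 - \<i> * of_real (t * sin u))"

lemma levy_kernel_second_difference:
  "levy_kernel (t + s) u + 1 *\<^sub>R levy_kernel (t - s) u + (- 2) *\<^sub>R levy_kernel t u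
    = cis (t * u) * of_real (2 * cos (s * u) - 2)"
proof -
  have e: "iexp x = cis x" for x by (simp add: cis_conv_exp)
  have "cis ((t + s) * u) + cis ((t - s) * u) = cis (t * u) * (cis (s * u) + cis (- (s * u)))"
    by (simp add: distrib_left cis_mult algebra_simps)
  also have "cis (s * u) + cis (- (s * u)) = of_real (2 * cos (s * u))"
    by (simp add: complex_eq_iff)
  finally show ?thesis
    unfolding e by (simp add: scaleR_conv_of_real algebra_simps)
qed

lemma second_difference_multiplier_bounds:
  fixes s u :: real
  shows "\<bar>2 * cos (s * u) - 2\<bar> \<le> 4 + s\<^sup>2" "\<bar>2 * cos (s * u) - 2\<bar> \<le> (4 + s\<^sup>2) * u\<^sup>2"
proof -
  have "\<bar>2 * cos (s * u) - 2\<bar> \<le> 4"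
    using cos_ge_minus_one[of "s * u"] cos_le_one[of "s * u"] by linarith
  then show "\<bar>2 * cos (s * u) - 2\<bar> \<le> 4 + s\<^sup>2"
    using zero_le_power2[of s] by linarith
  have "2 * cos (s * u) - 2 = - 4 * (sin (s * u / 2))\<^sup>2"
    using cos_double_sin[of "s * u / 2"] by simp
  then have "\<bar>2 * cos (s * u) - 2\<bar> = 4 * (sin (s * u / 2))\<^sup>2"
    by simp
  also have "(sin (s * u / 2))\<^sup>2 \<le> (s * u / 2)\<^sup>2"
    using abs_sin_x_le_abs_x[of "s * u / 2"] by (rule abs_le_square_iff[THEN iffD1])
  also have "4 * (s * u / 2)\<^sup>2 = s\<^sup>2 * u\<^sup>2"
    by (simp add: power_mult_distrib power_divide)
  also have "\<dots> \<le> (4 + s\<^sup>2) * u\<^sup>2"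
    by (intro mult_right_mono) auto
  finally show "\<bar>2 * cos (s * u) - 2\<bar> \<le> (4 + s\<^sup>2) * u\<^sup>2" by simp
qed

lemma second_difference_bounded:
  assumes L: "levy_spectral_function L"
    and I: "\<And>t. has_stieltjes_integral_off_0 (levy_kernel t) L (I t)"
  obtains K where "\<And>t. norm (I (t + s) + I (t - s) - 2 * I t) \<le> K"
proof -
  obtain K1 where K1: "\<And>h C I. levy_dominated C h \<Longrightarrow>
      has_improper_stieltjes_integral h L at_bot (at_left 0) I \<Longrightarrow> norm I \<le> C * K1"
    using levy_integral_bound_neg[OF L] by blast
  obtain K2 where K2: "\<And>h C I. levy_dominated C h \<Longrightarrow>
      has_improper_stieltjes_integral h L (at_right 0) at_top I \<Longrightarrow> norm I \<le> C * K2"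
    using levy_integral_bound_pos[OF L] by blast
  let ?C = "4 + s\<^sup>2"
  show ?thesis
  proof (rule that)
    fix t
    let ?h = "\<lambda>u. cis (t * u) * of_real (2 * cos (s * u) - 2)"
    have "has_stieltjes_integral_off_0 ?h L (I (t + s) + 1 *\<^sub>R I (t - s) + (- 2) *\<^sub>R I t)"
      unfolding levy_kernel_second_difference[symmetric] by (intro has_stieltjes_integral_off_0_add_scaleR I)
    then obtain A B where AB: "has_improper_stieltjes_integral ?h L at_bot (at_left 0) A"
      "has_improper_stieltjes_integral ?h L (at_right 0) at_top B" "I (t + s) + 1 *\<^sub>R I (t - s) + (- 2) *\<^sub>R I t = A + B"
      unfolding has_stieltjes_integral_off_0_def by blast
    have n: "norm (?h u) = \<bar>2 * cos (s * u) - 2\<bar>" for u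
      unfolding norm_mult norm_of_real by simp
    have "levy_dominated ?C ?h"
      unfolding levy_dominated_def n using second_difference_multiplier_bounds by (simp add: add_nonneg_nonneg)
    then have "norm A \<le> ?C * K1" "norm B \<le> ?C * K2"
      using K1[OF _ AB(1)] K2[OF _ AB(2)] by auto
    moreover have "I (t + s) + I (t - s) - 2 * I t = A + B"
      using AB(3) by (simp add: scaleR_conv_of_real)
    ultimately show "norm (I (t + s) + I (t - s) - 2 * I t) \<le> ?C * K1 + ?C * K2"
      using norm_triangle_ineq[of A B] by simp
  qed
qed

section \<open>Quasi-infinite divisibility implies a lower bound\<close>

lemma norm_cis_diff_le_of_floor_eq:
  assumes "\<lfloor>8 * cos a\<rfloor> = \<lfloor>8 * cos b\<rfloor>" "\<lfloor>8 * sin a\<rfloor> = \<lfloor>8 * sin b\<rfloor>"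
  shows "norm (cis (a - b) - 1) \<le> 1 / 4"
proof -
  have "\<bar>cos a - cos b\<bar> \<le> 1 / 8" "\<bar>sin a - sin b\<bar> \<le> 1 / 8"
    using assms by linarith+
  then have "norm (cis a - cis b) \<le> 1 / 4"
    using cmod_le[of "cis a - cis b"] by simp
  moreover have "cis a - cis b = cis b * (cis (a - b) - 1)"
    by (simp add: right_diff_distrib cis_mult)
  ultimately show ?thesis
    by (simp add: norm_mult)
qed

text \<open>Almost periodicity by the pigeonhole principle: for \<open>k < N\<close>, the points \<open>cis (t * x k)\<close> lie in one of
  finitely many cells, and \<open>E\<close> contains one \<open>s\<close> from each occupied cell. If \<open>s\<close> and \<open>t\<close> share a cell, \<open>f(t - s)\<close> is
  close to \<open>f(0) = 1\<close>.\<close>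
lemma finite_translates_bounded_below:
  fixes x p :: "nat \<Rightarrow> real"
  assumes p: "\<And>k. p k \<ge> 0" "p sums 1"
  defines "f \<equiv> (\<lambda>t. \<Sum>k. of_real (p k) * cis (t * x k))"
  obtains E where "finite E" "\<And>t. \<exists>s\<in>E. norm (f (t - s)) \<ge> 1 / 2"
proof -
  have sp: "summable p" using p(2) by (simp add: sums_iff)
  obtain N where "\<forall>n\<ge>N. norm (\<Sum>k. p (k + n)) < 1 / 8"
    using suminf_exist_split[of "1 / 8" p] sp by auto
  then have N: "(\<Sum>k. p (k + N)) < 1 / 8"
    by (metis abs_ge_self order.refl order.strict_trans1 real_norm_def)
  define cell where "cell t = (\<lambda>k\<in>{..<N}. (\<lfloor>8 * cos (t * x k)\<rfloor>, \<lfloor>8 * sin (t * x k)\<rfloor>))" for t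
  have fl: "\<lfloor>8 * y\<rfloor> \<in> {-8..8}" if "-1 \<le> y" "y \<le> 1" for y :: real
    using that by (auto simp: le_floor_iff floor_le_iff)
  have "range cell \<subseteq> {..<N} \<rightarrow>\<^sub>E ({-8..8} \<times> {-8..8})"
    unfolding cell_def by (intro image_subsetI restrict_PiE_iff[THEN iffD2] ballI SigmaI fl) auto
  then have fin: "finite (range cell)"
    by (rule finite_subset) (intro finite_PiE; simp)
  define r where "r c = (SOME t. cell t = c)" for c
  have r: "cell (r (cell t)) = cell t" for t
    unfolding r_def by (rule someI[of _ t]) simp
  show ?thesis
  proof (rule that[of "r ` range cell"])
    show "finite (r ` range cell)" using fin by simp
    fix t
    define s where "s = r (cell t)"
    define b where "b k = (if k < N then 1 / 4 else 2 :: real)" for k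
    have le: "norm (of_real (p k) * (cis ((t - s) * x k) - 1)) \<le> p k * b k" for k
    proof -
      have "norm (cis ((t - s) * x k) - 1) \<le> b k"
      proof (cases "k < N")
        case True
        have "cell s k = cell t k" by (simp add: s_def r)
        then have "norm (cis (t * x k - s * x k) - 1) \<le> 1 / 4"
          using True by (intro norm_cis_diff_le_of_floor_eq) (simp_all add: cell_def)
        then show ?thesis using True by (simp add: b_def left_diff_distrib)
      next
        case False
        then show ?thesis
          using norm_triangle_ineq4[of "cis ((t - s) * x k)" 1] by (simp add: b_def)
      qed
      then show ?thesis
        using p(1)[of k] by (simp add: norm_mult mult_left_mono)
    qed
    have sb: "summable (\<lambda>k. p k * b k)"
      by (rule summable_comparison_test'[OF summable_mult[OF sp, of 2], of 0])
         (use p(1) in \<open>auto simp: b_def\<close>)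
    have sf: "summable (\<lambda>k. of_real (p k) * cis (u * x k))" for u
      by (rule summable_norm_cancel, rule summable_comparison_test'[OF sp, of 0]) (use p(1) in \<open>auto simp: norm_mult\<close>)
    have s1: "summable (\<lambda>k. of_real (p k) :: complex)" "(\<Sum>k. of_real (p k) :: complex) = 1"
      using sums_of_real[OF p(2), where 'a = complex] by (auto simp: sums_iff)
    have "f (t - s) - 1 = (\<Sum>k. of_real (p k) * (cis ((t - s) * x k) - 1))"
      unfolding f_def using suminf_diff[OF sf s1(1), of "t - s"] s1(2) by (simp add: right_diff_distrib)
    also have "norm \<dots> \<le> (\<Sum>k. p k * b k)"
      by (rule norm_suminf_le[OF le sb])
    also have "\<dots> = (\<Sum>k. p (k + N) * b (k + N)) + (\<Sum>k<N. p k * b k)"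
      by (rule suminf_split_initial_segment[OF sb])
    also have "\<dots> = 2 * (\<Sum>k. p (k + N)) + (\<Sum>k<N. p k) / 4"
      using suminf_mult2[OF summable_ignore_initial_segment[OF sp], of N 2]
      by (simp add: b_def sum_divide_distrib mult.commute)
    also have "(\<Sum>k<N. p k) \<le> 1"
      using sum_le_suminf[OF sp, of "{..<N}"] p by (simp add: sums_iff)
    finally have "norm (f (t - s) - 1) \<le> 1 / 2"
      using N by simp
    then have "norm (f (t - s)) \<ge> 1 / 2"
      using norm_triangle_ineq2[of 1 "1 - f (t - s)"] by (simp add: norm_minus_commute)
    then show "\<exists>s\<in>r ` range cell. norm (f (t - s)) \<ge> 1 / 2"
      unfolding s_def by blast
  qed
qed

text \<open>Boundedness of the second difference, centred at \<open>v = t - s\<close>, gives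
  \<open>|f(t)| \<ge> |f(t)| |f(t - 2s)| \<ge> c |f(t - s)|\<^sup>2\<close>.\<close>
lemma levy_representation_bounded_below:
  fixes x p :: "nat \<Rightarrow> real"
  assumes p: "\<And>k. p k \<ge> 0" "p sums 1"
  defines "f \<equiv> (\<lambda>t. \<Sum>k. of_real (p k) * cis (t * x k))"
  assumes L: "levy_spectral_function L"
    and I: "\<And>t. has_stieltjes_integral_off_0 (levy_kernel t) L (I t)"
    and rep: "\<And>t. f t = exp (\<i> * of_real (t * \<gamma>) - of_real (\<sigma>\<^sup>2 * t\<^sup>2 / 2) + I t)"
  shows "\<exists>\<mu>>0. \<forall>t. \<mu> \<le> norm (f t)"
proof -
  have sp: "summable p" using p(2) by (simp add: sums_iff)
  have f1: "norm (f t) \<le> 1" for t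
  proof -
    have "norm (f t) \<le> (\<Sum>k. p k)"
      unfolding f_def by (rule norm_suminf_le[OF _ sp]) (use p(1) in \<open>simp add: norm_mult\<close>)
    then show ?thesis using p(2) by (simp add: sums_iff)
  qed
  have "\<exists>c>0. \<forall>t. c * (norm (f (t - s)))\<^sup>2 \<le> norm (f t)" for s
  proof -
    obtain K where K: "\<And>t. norm (I (t + s) + I (t - s) - 2 * I t) \<le> K"
      using second_difference_bounded[OF L I] by blast
    define c where "c = exp (- (\<sigma>\<^sup>2 * s\<^sup>2) - K)"
    have "c * (norm (f (t - s)))\<^sup>2 \<le> norm (f t)" for t
    proof -
      define Q where "Q t = \<sigma>\<^sup>2 * t\<^sup>2 / 2" for t
      define \<psi> where "\<psi> t = \<i> * of_real (t * \<gamma>) - of_real (Q t) + I t" for t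
      have f: "f t = exp (\<psi> t)" for t unfolding rep \<psi>_def Q_def ..
      define v where "v = t - s"
      have d: "\<psi> (v + s) + \<psi> (v - s) = 2 * \<psi> v + (I (v + s) + I (v - s) - 2 * I v - of_real (\<sigma>\<^sup>2 * s\<^sup>2))"
      proof -
        have "Q (v + s) = 2 * Q v + \<sigma>\<^sup>2 * s\<^sup>2 - Q (v - s)"
          by (simp add: Q_def power2_eq_square field_simps)
        then have "complex_of_real (Q (v + s)) = of_real (2 * Q v + \<sigma>\<^sup>2 * s\<^sup>2 - Q (v - s))"
          by (simp only:)
        then have "complex_of_real (Q (v + s)) = 2 * of_real (Q v) + of_real (\<sigma>\<^sup>2 * s\<^sup>2) - of_real (Q (v - s))"
          by (simp only: of_real_add of_real_diff of_real_mult of_real_numeral)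
        then show ?thesis
          unfolding \<psi>_def by (simp add: algebra_simps)
      qed
      have "- K \<le> Re (I (v + s) + I (v - s) - 2 * I v)"
        using K[of v] abs_Re_le_cmod[of "I (v + s) + I (v - s) - 2 * I v"] by linarith
      then have "2 * Re (\<psi> v) + (- (\<sigma>\<^sup>2 * s\<^sup>2) - K) \<le> Re (\<psi> (v + s) + \<psi> (v - s))"
        unfolding d by simp
      then have "exp (2 * Re (\<psi> v) + (- (\<sigma>\<^sup>2 * s\<^sup>2) - K)) \<le> exp (Re (\<psi> (v + s) + \<psi> (v - s)))"
        by simp
      also have "\<dots> = norm (f (v + s)) * norm (f (v - s))"
        by (simp add: f exp_add)
      also have "\<dots> \<le> norm (f (v + s))"
        by (rule mult_right_le_one_le) (simp_all add: f1)
      also have "exp (2 * Re (\<psi> v) + (- (\<sigma>\<^sup>2 * s\<^sup>2) - K)) = c * (norm (f v))\<^sup>2"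
        unfolding exp_add c_def f norm_exp_eq_Re by (simp add: exp_double)
      finally show ?thesis by (simp add: v_def)
    qed
    then show ?thesis by (intro exI[of _ c]) (simp add: c_def)
  qed
  then obtain c where c: "\<And>s. c s > 0" "\<And>s t. c s * (norm (f (t - s)))\<^sup>2 \<le> norm (f t)"
    by metis
  obtain E where E: "finite E" "\<And>t. \<exists>s\<in>E. norm (f (t - s)) \<ge> 1 / 2"
    using finite_translates_bounded_below[OF p, of x] unfolding f_def by metis
  have "E \<noteq> {}" using E(2) by blast
  define m where "m = Min (c ` E)"
  have m: "m > 0" "\<And>s. s \<in> E \<Longrightarrow> m \<le> c s"
    using E(1) \<open>E \<noteq> {}\<close> c(1) by (auto simp: m_def)
  have "m * (1 / 2)\<^sup>2 \<le> norm (f t)" for t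
  proof -
    obtain s where s: "s \<in> E" "norm (f (t - s)) \<ge> 1 / 2" using E(2) by blast
    have "m * (1 / 2)\<^sup>2 \<le> c s * (norm (f (t - s)))\<^sup>2"
      using m s by (intro mult_mono power_mono) (auto intro: less_imp_le[OF c(1)])
    then show ?thesis using c(2)[of s t] by linarith
  qed
  then show ?thesis using m(1) by (intro exI[of _ "m * (1 / 2)\<^sup>2"]) auto
qed

section \<open>Stieltjes integrals with respect to jump functions\<close>

lemma summable_on_real_subset:
  fixes l :: "real \<Rightarrow> real"
  assumes "abs_summable l"
  shows "(\<lambda>u. \<bar>l u\<bar>) summable_on A" "l summable_on A"
proof -
  show 1: "(\<lambda>u. \<bar>l u\<bar>) summable_on A" for A
    by (rule summable_on_subset_banach[OF assms]) simp
  show "l summable_on A"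
    by (rule abs_summable_summable) (use 1 in simp)
qed

lemma infsum_greaterThanAtMost_split:
  fixes f :: "real \<Rightarrow> 'a::banach"
  assumes "f summable_on {a<..c}" "a \<le> b" "b \<le> c"
  shows "infsum f {a<..c} = infsum f {a<..b} + infsum f {b<..c}"
proof -
  have "{a<..b} \<subseteq> {a<..c}" "{b<..c} \<subseteq> {a<..c}" using assms(2,3) by auto
  then have "f summable_on {a<..b}" "f summable_on {b<..c}"
    using summable_on_subset_banach[OF assms(1)] by auto
  moreover have "{a<..b} \<union> {b<..c} = {a<..c}" "{a<..b} \<inter> {b<..c} = {}" using assms(2,3) by auto
  ultimately show ?thesis using infsum_Un_disjoint by metis
qed

text \<open>Convergence of sums over sets that eventually contain each point of \<open>U\<close>.\<close>
lemma tendsto_infsum_exhausting: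
  fixes f :: "'b \<Rightarrow> 'a::banach"
  assumes f: "(\<lambda>w. norm (f w)) summable_on U"
    and sub: "\<forall>\<^sub>F p in F. A p \<subseteq> U" and ex: "\<And>w. w \<in> U \<Longrightarrow> \<forall>\<^sub>F p in F. w \<in> A p"
  shows "((\<lambda>p. infsum f (A p)) \<longlongrightarrow> infsum f U) F"
proof (rule tendstoI)
  fix e :: real assume e: "e > 0"
  let ?n = "\<lambda>w. norm (f w)"
  obtain S where S: "finite S" "S \<subseteq> U" "dist (sum ?n S) (infsum ?n U) \<le> e / 2"
    using infsum_finite_approximation[OF f, of "e / 2"] e by auto
  have "\<forall>\<^sub>F p in F. \<forall>w\<in>S. w \<in> A p"
    using S ex by (intro eventually_ball_finite) auto
  with sub show "\<forall>\<^sub>F p in F. dist (infsum f (A p)) (infsum f U) < e"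
  proof eventually_elim
    case (elim p)
    have sf: "f summable_on B" and sn: "?n summable_on B" if "B \<subseteq> U" for B
      using abs_summable_summable[of f B] summable_on_subset_banach[OF f that] by auto
    have "infsum f U = infsum f (A p) + infsum f (U - A p)"
      using infsum_Un_disjoint[OF sf sf, of "A p" "U - A p"] elim(1) by (simp add: Un_absorb1)
    then have "dist (infsum f (A p)) (infsum f U) = norm (infsum f (U - A p))"
      by (simp add: dist_norm)
    also have "\<dots> \<le> infsum ?n (U - A p)"
      by (rule norm_infsum_bound[OF sn]) auto
    also have "\<dots> \<le> infsum ?n (U - S)"
      using elim S(2) by (intro infsum_mono2 sn) auto
    also have "\<dots> = infsum ?n U - sum ?n S"
      using infsum_Un_disjoint[OF sn sn, of S "U - S"] S(1,2) by (simp add: Un_absorb1)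
    also have "\<dots> \<le> e / 2" using S(3) unfolding dist_real_def by linarith
    finally show ?case using e by simp
  qed
qed

text \<open>If the increments of \<open>g\<close> are the sums of the jumps \<open>l\<close> over half-open intervals, the Stieltjes integral of
  a continuous \<open>h\<close> is the sum of \<open>l w *\<^sub>R h w\<close>. The exact value and the total mass of \<open>l\<close> are increments of \<open>\<Phi>\<close>
  and \<open>N\<close>, hence additive over a division, which reduces the claim to uniform continuity of \<open>h\<close>.\<close>
lemma has_stieltjes_integral_jump_function:
  fixes h :: "real \<Rightarrow> 'a::banach"
  assumes l: "abs_summable l" and ab: "a \<le> b"
    and g: "\<And>u v. a \<le> u \<Longrightarrow> u \<le> v \<Longrightarrow> v \<le> b \<Longrightarrow> g v - g u = (\<Sum>\<^sub>\<infinity>w\<in>{u<..v}. l w)"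
    and h: "continuous_on {a..b} h"
  shows "has_stieltjes_integral h g a b (\<Sum>\<^sub>\<infinity>w\<in>{a<..b}. l w *\<^sub>R h w)"
  unfolding has_stieltjes_integral_def
proof (intro allI impI)
  fix e :: real assume e: "e > 0"
  note ls = summable_on_real_subset[OF l]
  define M where "M = (\<Sum>\<^sub>\<infinity>w. \<bar>l w\<bar>)"
  have M: "M \<ge> 0" unfolding M_def by (rule infsum_nonneg) simp
  define e' where "e' = e / (M + 1)"
  have e': "e' > 0" using e M by (simp add: e'_def)
  have "uniformly_continuous_on {a..b} h"
    by (rule compact_uniformly_continuous[OF h]) simp
  then obtain d where d: "d > 0" and dh: "\<And>x y. x \<in> {a..b} \<Longrightarrow> y \<in> {a..b} \<Longrightarrow> dist y x < d \<Longrightarrow> dist (h y) (h x) < e'"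
    unfolding uniformly_continuous_on_def using e' by metis
  obtain C where "\<forall>y\<in>h ` {a..b}. norm y \<le> C"
    using compact_imp_bounded[OF compact_continuous_image[OF h compact_Icc]] unfolding bounded_iff by blast
  then have C: "norm (h x) \<le> C" if "x \<in> {a..b}" for x
    using that by blast
  have lh: "(\<lambda>w. norm (l w *\<^sub>R h w)) summable_on B" if "B \<subseteq> {a<..b}" for B
  proof (rule absum_comparison')
    show "(\<lambda>w. \<bar>l w\<bar> * C) summable_on B" by (rule summable_on_cmult_left[OF ls(1)])
    show "norm (l w *\<^sub>R h w) \<le> \<bar>l w\<bar> * C" if "w \<in> B" for w
      using C[of w] that \<open>B \<subseteq> {a<..b}\<close> by (auto intro!: mult_left_mono)
  qed
  have lh': "(\<lambda>w. l w *\<^sub>R h w) summable_on B" if "B \<subseteq> {a<..b}" for B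
    by (rule abs_summable_summable[OF lh[OF that]])
  define \<Phi> where "\<Phi> y = (\<Sum>\<^sub>\<infinity>w\<in>{a<..y}. l w *\<^sub>R h w)" for y
  define N where "N y = (\<Sum>\<^sub>\<infinity>w\<in>{a<..y}. \<bar>l w\<bar>)" for y
  have \<Phi>: "\<Phi> v - \<Phi> u = (\<Sum>\<^sub>\<infinity>w\<in>{u<..v}. l w *\<^sub>R h w)" if "a \<le> u" "u \<le> v" "v \<le> b" for u v
    unfolding \<Phi>_def using that by (subst infsum_greaterThanAtMost_split[of _ a v u]) (auto intro!: lh')
  have N: "N v - N u = (\<Sum>\<^sub>\<infinity>w\<in>{u<..v}. \<bar>l w\<bar>)" if "a \<le> u" "u \<le> v" for u v
    unfolding N_def using that by (subst infsum_greaterThanAtMost_split[of _ a v u]) (auto intro!: ls)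
  show "\<exists>d>0. \<forall>D. D tagged_division_of {a..b} \<and> mesh_less d D \<longrightarrow>
      norm (stieltjes_sum h g D - (\<Sum>\<^sub>\<infinity>w\<in>{a<..b}. l w *\<^sub>R h w)) < e"
  proof (intro exI[of _ d] conjI allI impI d)
    fix D assume "D tagged_division_of {a..b} \<and> mesh_less d D"
    then have D: "D tagged_division_of {a..b}" and Dd: "\<And>x K. (x, K) \<in> D \<Longrightarrow> Sup K - Inf K < d" by auto
    have "(\<Sum>\<^sub>\<infinity>w\<in>{a<..b}. l w *\<^sub>R h w) = \<Phi> b - \<Phi> a"
      using \<Phi>[of a b] ab by simp
    also have "\<dots> = (\<Sum>(x, K)\<in>D. \<Phi> (Sup K) - \<Phi> (Inf K))"
      by (rule additive_tagged_division_1[OF ab D, symmetric])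
    finally have "norm (stieltjes_sum h g D - (\<Sum>\<^sub>\<infinity>w\<in>{a<..b}. l w *\<^sub>R h w))
        = norm (\<Sum>(x, K)\<in>D. (g (Sup K) - g (Inf K)) *\<^sub>R h x - (\<Phi> (Sup K) - \<Phi> (Inf K)))"
      by (simp add: case_prod_unfold sum_subtractf)
    also have "\<dots> \<le> (\<Sum>(x, K)\<in>D. e' * (N (Sup K) - N (Inf K)))"
    proof (rule sum_norm_le, clarify)
      fix x K assume xK: "(x, K) \<in> D"
      note t = tagged_interval_real(2-)[OF D xK]
      let ?B = "{Inf K<..Sup K}"
      have B: "?B \<subseteq> {a<..b}" using t by auto
      have sc: "(\<lambda>w. l w *\<^sub>R h x) summable_on ?B"
        by (rule summable_on_scaleR_left[OF ls(2)])
      have close: "norm (l w *\<^sub>R h x - l w *\<^sub>R h w) \<le> e' * \<bar>l w\<bar>" if "w \<in> ?B" for w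
      proof -
        have w: "Inf K < w" "w \<le> Sup K" using that by auto
        then have "dist x w < d" using Dd[OF xK] t unfolding dist_real_def by linarith
        then have "norm (h x - h w) \<le> e'"
          using dh[of w x] t w by (auto simp: dist_norm)
        then have "\<bar>l w\<bar> * norm (h x - h w) \<le> \<bar>l w\<bar> * e'"
          by (rule mult_left_mono) simp
        then show ?thesis
          by (simp add: scaleR_diff_right[symmetric] mult.commute)
      qed
      have se: "(\<lambda>w. e' * \<bar>l w\<bar>) summable_on ?B"
        by (rule summable_on_cmult_right[OF ls(1)])
      have sd: "(\<lambda>w. norm (l w *\<^sub>R h x - l w *\<^sub>R h w)) summable_on ?B"
        by (rule absum_comparison'[OF se close])
      have "(g (Sup K) - g (Inf K)) *\<^sub>R h x - (\<Phi> (Sup K) - \<Phi> (Inf K))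
          = (\<Sum>\<^sub>\<infinity>w\<in>?B. l w *\<^sub>R h x) - (\<Sum>\<^sub>\<infinity>w\<in>?B. l w *\<^sub>R h w)"
        using t by (simp add: g \<Phi> infsum_scaleR_left[OF ls(2)])
      also have "\<dots> = (\<Sum>\<^sub>\<infinity>w\<in>?B. l w *\<^sub>R h x - l w *\<^sub>R h w)"
        using infsum_add[OF sc summable_on_uminus[THEN iffD2, OF lh'[OF B]]] by (simp add: infsum_uminus)
      also have "norm \<dots> \<le> (\<Sum>\<^sub>\<infinity>w\<in>?B. norm (l w *\<^sub>R h x - l w *\<^sub>R h w))"
        by (rule norm_infsum_bound[OF sd])
      also have "\<dots> \<le> (\<Sum>\<^sub>\<infinity>w\<in>?B. e' * \<bar>l w\<bar>)"
        by (rule infsum_mono[OF sd se close])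
      also have "\<dots> = e' * (N (Sup K) - N (Inf K))"
        using t by (simp add: N infsum_cmult_right')
      finally show "norm ((g (Sup K) - g (Inf K)) *\<^sub>R h x - (\<Phi> (Sup K) - \<Phi> (Inf K))) \<le> e' * (N (Sup K) - N (Inf K))" .
    qed
    also have "\<dots> = e' * (N b - N a)"
      using additive_tagged_division_1[OF ab D, of N] by (simp add: case_prod_unfold sum_distrib_left[symmetric])
    also have "\<dots> \<le> e' * M"
      using N[of a b] ab e' unfolding M_def by (intro mult_left_mono) (auto intro!: infsum_mono2 ls)
    also have "\<dots> < e"
      using e M by (simp add: e'_def field_simps)
    finally show "norm (stieltjes_sum h g D - (\<Sum>\<^sub>\<infinity>w\<in>{a<..b}. l w *\<^sub>R h w)) < e" .
  qed
qed

lemma improper_stieltjes_jump_function: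
  fixes h :: "real \<Rightarrow> 'a::banach"
  assumes l: "abs_summable l"
    and g: "\<And>u v. u \<le> v \<Longrightarrow> {u..v} \<subseteq> U \<Longrightarrow> g v - g u = (\<Sum>\<^sub>\<infinity>w\<in>{u<..v}. l w)"
    and h: "continuous_on U h" "\<And>u. u \<in> U \<Longrightarrow> norm (h u) \<le> C"
    and inU: "\<forall>\<^sub>F (a, b) in A \<times>\<^sub>F B. a \<le> b \<and> {a..b} \<subseteq> U"
    and ex: "\<And>w. w \<in> U \<Longrightarrow> \<forall>\<^sub>F (a, b) in A \<times>\<^sub>F B. a < w \<and> w \<le> b"
  shows "has_improper_stieltjes_integral h g A B (\<Sum>\<^sub>\<infinity>w\<in>U. l w *\<^sub>R h w)"
  unfolding has_improper_stieltjes_integral_def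
proof (intro exI conjI)
  let ?J = "\<lambda>p. \<Sum>\<^sub>\<infinity>w\<in>{fst p<..snd p}. l w *\<^sub>R h w"
  show "\<forall>\<^sub>F (a, b) in A \<times>\<^sub>F B. has_stieltjes_integral h g a b (?J (a, b))"
    using inU
  proof eventually_elim
    case (elim p)
    obtain a b where p: "p = (a, b)" by (cases p)
    then have ab: "a \<le> b" "{a..b} \<subseteq> U" using elim by auto
    have "has_stieltjes_integral h g a b (\<Sum>\<^sub>\<infinity>w\<in>{a<..b}. l w *\<^sub>R h w)"
      by (rule has_stieltjes_integral_jump_function[OF l ab(1) g continuous_on_subset[OF h(1) ab(2)]])
         (use ab(2) in auto)
    then show ?case by (simp add: p)
  qed
  show "(?J \<longlongrightarrow> (\<Sum>\<^sub>\<infinity>w\<in>U. l w *\<^sub>R h w)) (A \<times>\<^sub>F B)"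
  proof (rule tendsto_infsum_exhausting)
    show "(\<lambda>w. norm (l w *\<^sub>R h w)) summable_on U"
    proof (rule absum_comparison')
      show "(\<lambda>w. \<bar>l w\<bar> * C) summable_on U"
        by (rule summable_on_cmult_left[OF summable_on_real_subset(1)[OF l]])
      show "norm (l w *\<^sub>R h w) \<le> \<bar>l w\<bar> * C" if "w \<in> U" for w
        using h(2)[OF that] by (auto intro!: mult_left_mono)
    qed
    show "\<forall>\<^sub>F p in A \<times>\<^sub>F B. {fst p<..snd p} \<subseteq> U"
      using inU by eventually_elim force
    show "\<forall>\<^sub>F p in A \<times>\<^sub>F B. w \<in> {fst p<..snd p}" if "w \<in> U" for w
      using ex[OF that] by eventually_elim auto
  qed
qed

lemma eventually_prod_open_interval:
  fixes \<alpha> \<beta> :: real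
  assumes "\<alpha> < \<beta>"
  shows "\<forall>\<^sub>F (a, b) in at_right \<alpha> \<times>\<^sub>F at_left \<beta>. a \<le> b \<and> {a..b} \<subseteq> {\<alpha><..<\<beta>}"
    and "w \<in> {\<alpha><..<\<beta>} \<Longrightarrow> \<forall>\<^sub>F (a, b) in at_right \<alpha> \<times>\<^sub>F at_left \<beta>. a < w \<and> w \<le> b"
proof -
  define m where "m = (\<alpha> + \<beta>) / 2"
  have m: "\<alpha> < m" "m < \<beta>" using assms by (auto simp: m_def)
  have "\<forall>\<^sub>F p in at_right \<alpha> \<times>\<^sub>F at_left \<beta>. fst p \<in> {\<alpha><..<m} \<and> snd p \<in> {m<..<\<beta>}"
    by (intro eventually_prodI eventually_at_right_real eventually_at_left_real m)
  then show "\<forall>\<^sub>F (a, b) in at_right \<alpha> \<times>\<^sub>F at_left \<beta>. a \<le> b \<and> {a..b} \<subseteq> {\<alpha><..<\<beta>}"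
    by eventually_elim auto
  assume w: "w \<in> {\<alpha><..<\<beta>}"
  then have "\<forall>\<^sub>F p in at_right \<alpha> \<times>\<^sub>F at_left \<beta>. fst p \<in> {\<alpha><..<w} \<and> snd p \<in> {w<..<\<beta>}"
    by (intro eventually_prodI eventually_at_right_real eventually_at_left_real) auto
  then show "\<forall>\<^sub>F (a, b) in at_right \<alpha> \<times>\<^sub>F at_left \<beta>. a < w \<and> w \<le> b"
    by eventually_elim auto
qed

lemma eventually_prod_half_lines:
  fixes w :: real
  shows "\<forall>\<^sub>F (a, b) in at_right (0::real) \<times>\<^sub>F at_top. a \<le> b \<and> {a..b} \<subseteq> {0<..}"
    and "w \<in> {0<..} \<Longrightarrow> \<forall>\<^sub>F (a, b) in at_right (0::real) \<times>\<^sub>F at_top. a < w \<and> w \<le> b"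
    and "\<forall>\<^sub>F (a, b) in at_bot \<times>\<^sub>F at_left (0::real). a \<le> b \<and> {a..b} \<subseteq> {..<0}"
    and "w \<in> {..<0} \<Longrightarrow> \<forall>\<^sub>F (a, b) in at_bot \<times>\<^sub>F at_left (0::real). a < w \<and> w \<le> b"
proof -
  have 1: "\<forall>\<^sub>F p in at_right (0::real) \<times>\<^sub>F at_top. fst p \<in> {0<..<w} \<and> w \<le> snd p" if "w > 0" for w :: real
    by (intro eventually_prodI eventually_at_right_real eventually_ge_at_top that)
  have 2: "\<forall>\<^sub>F p in at_bot \<times>\<^sub>F at_left (0::real). fst p < w \<and> snd p \<in> {w<..<0}" if "w < 0" for w :: real
    by (intro eventually_prodI eventually_at_left_real eventually_gt_at_bot that)
  show "\<forall>\<^sub>F (a, b) in at_right (0::real) \<times>\<^sub>F at_top. a \<le> b \<and> {a..b} \<subseteq> {0<..}"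
    using 1[of 1, OF zero_less_one] by eventually_elim auto
  show "\<forall>\<^sub>F (a, b) in at_right (0::real) \<times>\<^sub>F at_top. a < w \<and> w \<le> b" if "w \<in> {0<..}"
    using 1[of w] that by (auto elim!: eventually_mono)
  have "(-1::real) < 0" by simp
  from 2[OF this] show "\<forall>\<^sub>F (a, b) in at_bot \<times>\<^sub>F at_left (0::real). a \<le> b \<and> {a..b} \<subseteq> {..<0}"
    by eventually_elim auto
  show "\<forall>\<^sub>F (a, b) in at_bot \<times>\<^sub>F at_left (0::real). a < w \<and> w \<le> b" if "w \<in> {..<0}"
    using 2[of w] that by (auto elim!: eventually_mono)
qed

text \<open>The pure jump function with jump \<open>l v\<close> at each \<open>v \<noteq> 0\<close>, right-continuous off 0, and vanishing at both
  infinities. The value \<open>l 0\<close> does not affect it off 0.\<close>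
definition jump_function :: "(real \<Rightarrow> real) \<Rightarrow> real \<Rightarrow> real" where
  "jump_function l u = (if u < 0 then (\<Sum>\<^sub>\<infinity>v\<in>{..u}. l v) else - (\<Sum>\<^sub>\<infinity>v\<in>{u<..}. l v))"

lemma jump_function_increment:
  assumes l: "abs_summable l" and uv: "u \<le> v" "u > 0 \<or> v < 0"
  shows "jump_function l v - jump_function l u = (\<Sum>\<^sub>\<infinity>w\<in>{u<..v}. l w)"
proof (cases "v < 0")
  case True
  have e: "{..v} = {..u} \<union> {u<..v}" using uv by auto
  have "infsum l {..v} = infsum l {..u} + infsum l {u<..v}"
    unfolding e by (rule infsum_Un_disjoint) (auto intro: summable_on_real_subset[OF l])
  then show ?thesis using True uv by (simp add: jump_function_def)
next
  case False
  have e: "{u<..} = {u<..v} \<union> {v<..}" using uv by auto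
  have "infsum l {u<..} = infsum l {u<..v} + infsum l {v<..}"
    unfolding e by (rule infsum_Un_disjoint) (auto intro: summable_on_real_subset[OF l])
  then show ?thesis using False uv by (simp add: jump_function_def)
qed

text \<open>Both half-lines at once: \<open>T\<close> is the set of jumps that variation sums over \<open>S\<close> can see.\<close>
lemma variation_sum_jump_function_le:
  assumes l: "abs_summable l" and S: "S = {a..} \<and> a > 0 \<and> T = {a<..} \<or> S = {..a} \<and> a < 0 \<and> T = {..a}"
    and s: "s \<in> variation_sums (jump_function l) S"
  shows "s \<le> (\<Sum>\<^sub>\<infinity>w\<in>T. \<bar>l w\<bar>)"
proof -
  note ls = summable_on_real_subset[OF l]
  obtain n x where sx: "s = (\<Sum>i<n. \<bar>jump_function l (x (Suc i)) - jump_function l (x i)\<bar>)"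
    and x: "\<forall>i\<le>n. x i \<in> S" "\<forall>i<n. x i \<le> x (Suc i)"
    using s unfolding variation_sums_def by auto
  have "(\<Sum>i<k. \<bar>jump_function l (x (Suc i)) - jump_function l (x i)\<bar>) \<le> (\<Sum>\<^sub>\<infinity>w\<in>{x 0<..x k}. \<bar>l w\<bar>) \<and> x 0 \<le> x k"
    if "k \<le> n" for k
    using that
  proof (induction k)
    case (Suc k)
    have k: "x k \<le> x (Suc k)" "x k \<in> S" "x (Suc k) \<in> S" using x Suc.prems by auto
    have "\<bar>jump_function l (x (Suc k)) - jump_function l (x k)\<bar> = \<bar>\<Sum>\<^sub>\<infinity>w\<in>{x k<..x (Suc k)}. l w\<bar>"
      using k S by (subst jump_function_increment[OF l]) auto
    also have "\<dots> \<le> (\<Sum>\<^sub>\<infinity>w\<in>{x k<..x (Suc k)}. \<bar>l w\<bar>)"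
      using norm_infsum_bound[of l "{x k<..x (Suc k)}"] ls by simp
    finally show ?case
      using Suc.IH Suc.prems k(1) infsum_greaterThanAtMost_split[OF ls(1), of "x 0" "x k" "x (Suc k)"]
      by simp
  qed simp
  from this[of n] have "s \<le> (\<Sum>\<^sub>\<infinity>w\<in>{x 0<..x n}. \<bar>l w\<bar>)" by (simp add: sx)
  also have "\<dots> \<le> (\<Sum>\<^sub>\<infinity>w\<in>T. \<bar>l w\<bar>)"
    using S x(1)[rule_format, of 0] x(1)[rule_format, of n] by (intro infsum_mono2 ls) auto
  finally show ?thesis .
qed

lemma finite_variation_jump_function:
  assumes l: "abs_summable l"
  shows "\<forall>r>0. finite_variation_on (jump_function l) {..-r} \<and> finite_variation_on (jump_function l) {r..}"
  unfolding finite_variation_on_def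
proof (intro allI impI conjI)
  fix r :: real assume r: "r > 0"
  show "bdd_above (variation_sums (jump_function l) {..-r})"
    by (rule bdd_aboveI, rule variation_sum_jump_function_le[OF l, of "{..-r}" "-r" "{..-r}"]) (use r in auto)
  show "bdd_above (variation_sums (jump_function l) {r..})"
    by (rule bdd_aboveI, rule variation_sum_jump_function_le[OF l, of "{r..}" r "{r<..}"]) (use r in auto)
qed

text \<open>The variation function grows by at least \<open>|l v|\<close> at \<open>v\<close>: compare \<open>v\<close> with points \<open>y\<close> tending to \<open>v\<close> from
  the left.\<close>
lemma jump_le_variation_increment:
  assumes l: "abs_summable l" and uv: "u < v" "u > 0 \<or> v < 0"
  defines "V \<equiv> variation_function (jump_function l)"
  shows "\<bar>l v\<bar> \<le> V v - V u"
proof -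
  let ?g = "jump_function l"
  note ls = summable_on_real_subset[OF l] and fv = finite_variation_jump_function[OF l]
  have "((\<lambda>y. infsum l {u<..y}) \<longlongrightarrow> infsum l {u<..<v}) (at_left v)"
  proof (rule tendsto_infsum_exhausting)
    show "(\<lambda>w. norm (l w)) summable_on {u<..<v}" using ls by simp
    show "\<forall>\<^sub>F y in at_left v. {u<..y} \<subseteq> {u<..<v}"
      using eventually_at_left_real[OF uv(1)] by eventually_elim auto
    show "\<forall>\<^sub>F y in at_left v. w \<in> {u<..y}" if "w \<in> {u<..<v}" for w
      using eventually_at_left_real[of w v] that by (auto elim!: eventually_mono)
  qed
  then have "((\<lambda>y. \<bar>infsum l {u<..v} - infsum l {u<..y}\<bar>) \<longlongrightarrow> \<bar>infsum l {u<..v} - infsum l {u<..<v}\<bar>) (at_left v)"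
    by (intro tendsto_intros)
  moreover have "{u<..v} = {u<..<v} \<union> {v}" using uv(1) by auto
  then have "infsum l {u<..v} = infsum l {u<..<v} + l v"
    using infsum_Un_disjoint[OF ls(2) ls(2), of "{u<..<v}" "{v}"] by simp
  ultimately have lim: "((\<lambda>y. \<bar>infsum l {u<..v} - infsum l {u<..y}\<bar>) \<longlongrightarrow> \<bar>l v\<bar>) (at_left v)"
    by simp
  have "\<forall>\<^sub>F y in at_left v. \<bar>infsum l {u<..v} - infsum l {u<..y}\<bar> \<le> V v - V u"
    using eventually_at_left_real[OF uv(1)]
  proof eventually_elim
    case (elim y)
    then have y: "u \<le> y" "y \<le> v" "y > 0 \<or> v < 0" "u > 0 \<or> y < 0" using uv by auto
    have "infsum l {u<..v} - infsum l {u<..y} = ?g v - ?g y"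
      using jump_function_increment[OF l y(2,3)] infsum_greaterThanAtMost_split[OF ls(2) y(1,2)] by simp
    then have "\<bar>infsum l {u<..v} - infsum l {u<..y}\<bar> \<le> V v - V y"
      unfolding V_def using variation_increment[OF fv y(2,3)] by simp
    moreover have "V u \<le> V y"
      unfolding V_def using variation_increment[OF fv y(1,4)] by linarith
    ultimately show ?case by linarith
  qed
  then show ?thesis
    by (intro tendsto_upperbound[OF lim]) simp_all
qed

text \<open>Induction on the largest point \<open>m\<close> of \<open>S\<close>; the preceding one is \<open>m'\<close>, or \<open>a\<close> if there is none.\<close>
lemma sum_jumps_le_variation_increment:
  assumes l: "abs_summable l" and S: "finite S" "S \<subseteq> {a<..b}" "a \<le> b" "a > 0 \<or> b < 0"
  defines "V \<equiv> variation_function (jump_function l)"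
  shows "(\<Sum>w\<in>S. \<bar>l w\<bar>) \<le> V b - V a"
  using S
proof (induction S arbitrary: b rule: finite_linorder_max_induct)
  note fv = finite_variation_jump_function[OF l]
  have mono: "V u \<le> V v" if "u \<le> v" "u > 0 \<or> v < 0" for u v
    unfolding V_def using variation_increment[OF fv that] by linarith
  {
    case (empty b)
    then show ?case using mono[of a b] by simp
  next
    case (insert m S b)
    define m' where "m' = Max (insert a S)"
    have "m' \<in> insert a S"
      unfolding m'_def by (rule Max_in) (use insert.hyps(1) in auto)
    moreover have "w \<le> m'" if "w \<in> insert a S" for w
      unfolding m'_def by (rule Max_ge) (use insert.hyps(1) that in auto)
    ultimately have m': "m' \<in> insert a S" "\<And>w. w \<in> S \<Longrightarrow> w \<le> m'" "a \<le> m'"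
      by auto
    have am: "a < m" "m \<le> b" using insert.prems(1) by auto
    have mm: "m' < m" using m'(1) insert.hyps(2) am by auto
    have s: "m' > 0 \<or> m < 0" "m > 0 \<or> b < 0" "a > 0 \<or> m' < 0"
      using insert.prems(3) m'(3) mm am by auto
    have "S \<subseteq> {a<..m'}" using insert.prems(1) m'(2) by auto
    then have "(\<Sum>w\<in>S. \<bar>l w\<bar>) \<le> V m' - V a"
      using insert.IH[of m'] m'(3) s(3) by simp
    moreover have "\<bar>l m\<bar> \<le> V m - V m'"
      unfolding V_def by (rule jump_le_variation_increment[OF l mm s(1)])
    moreover have "V m \<le> V b" by (rule mono[OF am(2) s(2)])
    moreover have "m \<notin> S" using insert.hyps(2) by auto
    ultimately show ?case using insert.hyps(1) by simp
  }
qed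

lemma total_variation_jump_function:
  assumes l: "abs_summable l"
  shows "a > 0 \<Longrightarrow> total_variation (jump_function l) {a..} = (\<Sum>\<^sub>\<infinity>w\<in>{a<..}. \<bar>l w\<bar>)"
    and "a < 0 \<Longrightarrow> total_variation (jump_function l) {..a} = (\<Sum>\<^sub>\<infinity>w\<in>{..a}. \<bar>l w\<bar>)"
proof -
  let ?V = "variation_function (jump_function l)"
  note ls = summable_on_real_subset[OF l] and fv = finite_variation_jump_function[OF l]
  have ne: "variation_sums (jump_function l) {a..} \<noteq> {}" "variation_sums (jump_function l) {..a} \<noteq> {}"
    using zero_in_variation_sums[of a "{a..}"] zero_in_variation_sums[of a "{..a}"] by blast+
  {
    assume a: "a > 0"
    show "total_variation (jump_function l) {a..} = (\<Sum>\<^sub>\<infinity>w\<in>{a<..}. \<bar>l w\<bar>)"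
    proof (rule antisym)
      show "total_variation (jump_function l) {a..} \<le> (\<Sum>\<^sub>\<infinity>w\<in>{a<..}. \<bar>l w\<bar>)"
        unfolding total_variation_def using a by (intro cSup_least ne variation_sum_jump_function_le[OF l]) auto
      show "(\<Sum>\<^sub>\<infinity>w\<in>{a<..}. \<bar>l w\<bar>) \<le> total_variation (jump_function l) {a..}"
      proof (rule infsum_le_finite_sums[OF ls(1)])
        fix S assume S: "finite S" "S \<subseteq> {a<..}"
        define b where "b = Max (insert a S)"
        have b: "a \<le> b" "S \<subseteq> {a<..b}"
          using S by (auto simp: b_def simp del: Max_insert)
        have "(\<Sum>w\<in>S. \<bar>l w\<bar>) \<le> ?V b - ?V a"
          using a by (intro sum_jumps_le_variation_increment[OF l S(1) b(2,1)]) simp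
        then show "(\<Sum>w\<in>S. \<bar>l w\<bar>) \<le> total_variation (jump_function l) {a..}"
          using variation_sign(1)[OF fv, of b] a b(1) by (simp add: variation_function_def)
      qed
    qed
  next
    assume a: "a < 0"
    show "total_variation (jump_function l) {..a} = (\<Sum>\<^sub>\<infinity>w\<in>{..a}. \<bar>l w\<bar>)"
    proof (rule antisym)
      show "total_variation (jump_function l) {..a} \<le> (\<Sum>\<^sub>\<infinity>w\<in>{..a}. \<bar>l w\<bar>)"
        unfolding total_variation_def using a by (intro cSup_least ne variation_sum_jump_function_le[OF l]) auto
      show "(\<Sum>\<^sub>\<infinity>w\<in>{..a}. \<bar>l w\<bar>) \<le> total_variation (jump_function l) {..a}"
      proof (rule infsum_le_finite_sums[OF ls(1)])
        fix S assume S: "finite S" "S \<subseteq> {..a}"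
        define b where "b = Min (insert a S) - 1"
        have "w \<ge> Min (insert a S)" if "w \<in> insert a S" for w
          using S(1) that by (intro Min_le) auto
        then have b: "b \<le> a" "S \<subseteq> {b<..a}"
          using S(2) by (force simp: b_def simp del: Min_insert)+
        have "(\<Sum>w\<in>S. \<bar>l w\<bar>) \<le> ?V a - ?V b"
          using a by (intro sum_jumps_le_variation_increment[OF l S(1) b(2,1)]) simp
        then show "(\<Sum>w\<in>S. \<bar>l w\<bar>) \<le> total_variation (jump_function l) {..a}"
          using variation_sign(2)[OF fv, of b] a b(1) by (simp add: variation_function_def)
      qed
    qed
  }
qed

lemma variation_function_jump_function:
  assumes l: "abs_summable l" and u: "u \<noteq> 0"
  shows "variation_function (jump_function l) u = jump_function (\<lambda>w. \<bar>l w\<bar>) u"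
  using u total_variation_jump_function[OF l, of u] by (auto simp: variation_function_def jump_function_def)

lemma levy_spectral_function_jump_function:
  assumes l: "abs_summable l"
  shows "levy_spectral_function (jump_function l)"
  unfolding levy_spectral_function_def
proof (intro conjI allI impI finite_variation_jump_function[OF l, rule_format, THEN conjunct1]
    finite_variation_jump_function[OF l, rule_format, THEN conjunct2])
  note ls = summable_on_real_subset[OF l]
  have nl: "(\<lambda>w. norm (l w)) summable_on UNIV" using l by simp
  have un: "{..u} \<union> {u<..} = UNIV" for u :: real by auto
  have 1: "((\<lambda>u. infsum l {u<..}) \<longlongrightarrow> 0) at_top" and 2: "((\<lambda>u. infsum l {..u}) \<longlongrightarrow> 0) at_bot"
  proof -
    have "((\<lambda>u. infsum l {..u}) \<longlongrightarrow> infsum l UNIV) at_top"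
      by (rule tendsto_infsum_exhausting[OF nl]) (auto intro: eventually_ge_at_top)
    then have "((\<lambda>u. infsum l UNIV - infsum l {..u}) \<longlongrightarrow> infsum l UNIV - infsum l UNIV) at_top"
      by (intro tendsto_intros)
    moreover have "infsum l UNIV - infsum l {..u} = infsum l {u<..}" for u
      using infsum_Un_disjoint[OF ls(2) ls(2), of "{..u}" "{u<..}"] by (simp add: un disjoint_iff)
    ultimately show "((\<lambda>u. infsum l {u<..}) \<longlongrightarrow> 0) at_top" by simp
    have "((\<lambda>u. infsum l {u<..}) \<longlongrightarrow> infsum l UNIV) at_bot"
      by (rule tendsto_infsum_exhausting[OF nl]) (auto intro: eventually_gt_at_bot)
    then have "((\<lambda>u. infsum l UNIV - infsum l {u<..}) \<longlongrightarrow> infsum l UNIV - infsum l UNIV) at_bot"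
      by (intro tendsto_intros)
    moreover have "infsum l UNIV - infsum l {u<..} = infsum l {..u}" for u
      using infsum_Un_disjoint[OF ls(2) ls(2), of "{..u}" "{u<..}"] by (simp add: un disjoint_iff)
    ultimately show "((\<lambda>u. infsum l {..u}) \<longlongrightarrow> 0) at_bot" by simp
  qed
  have "\<forall>\<^sub>F u in at_top. - infsum l {u<..} = jump_function l u"
    using eventually_ge_at_top[of 0] by eventually_elim (simp add: jump_function_def)
  then show "(jump_function l \<longlongrightarrow> 0) at_top"
    using tendsto_minus[OF 1] by (auto intro: Lim_transform_eventually)
  have "\<forall>\<^sub>F u in at_bot. infsum l {..u} = jump_function l u"
    using eventually_gt_at_bot[of 0] by eventually_elim (simp add: jump_function_def)
  then show "(jump_function l \<longlongrightarrow> 0) at_bot"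
    using 2 by (auto intro: Lim_transform_eventually)
  fix \<delta> :: real assume \<delta>: "\<delta> > 0"
  let ?V = "variation_function (jump_function l)"
  have al: "(\<lambda>u. \<bar>\<bar>l u\<bar>\<bar>) summable_on UNIV" using l by simp
  have V: "?V v - ?V u = (\<Sum>\<^sub>\<infinity>w\<in>{u<..v}. \<bar>l w\<bar>)" if "u \<le> v" "u > 0 \<or> v < 0" for u v
  proof -
    have "u \<noteq> 0" "v \<noteq> 0" using that by auto
    then show ?thesis
      using variation_function_jump_function[OF l] jump_function_increment[OF al that] by simp
  qed
  have sq: "u\<^sup>2 \<le> \<delta>\<^sup>2" if "- \<delta> < u" "u < \<delta>" for u :: real
    using that by (intro abs_le_square_iff[THEN iffD1]) linarith
  note cont = continuous_on_power[OF continuous_on_id]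
  have m\<delta>: "- \<delta> < 0" using \<delta> by simp
  have "has_improper_stieltjes_integral (\<lambda>u. u\<^sup>2) ?V (at_right (-\<delta>)) (at_left 0) (\<Sum>\<^sub>\<infinity>w\<in>{-\<delta><..<0}. \<bar>l w\<bar> *\<^sub>R w\<^sup>2)"
    by (rule improper_stieltjes_jump_function[OF al _ cont _ eventually_prod_open_interval[OF m\<delta>], where C = "\<delta>\<^sup>2"])
       (use \<delta> in \<open>auto intro!: V sq\<close>)
  then show "\<exists>I::real. has_improper_stieltjes_integral (\<lambda>u. u\<^sup>2) ?V (at_right (-\<delta>)) (at_left 0) I" ..
  have "has_improper_stieltjes_integral (\<lambda>u. u\<^sup>2) ?V (at_right 0) (at_left \<delta>) (\<Sum>\<^sub>\<infinity>w\<in>{0<..<\<delta>}. \<bar>l w\<bar> *\<^sub>R w\<^sup>2)"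
    by (rule improper_stieltjes_jump_function[OF al _ cont _ eventually_prod_open_interval[OF \<delta>], where C = "\<delta>\<^sup>2"])
       (use \<delta> in \<open>auto intro!: V sq\<close>)
  then show "\<exists>I::real. has_improper_stieltjes_integral (\<lambda>u. u\<^sup>2) ?V (at_right 0) (at_left \<delta>) I" ..
qed

text \<open>The terms \<open>\<i> t sin u\<close> of the kernel sum up to a drift, which is absorbed into \<open>\<gamma>\<close>.\<close>
lemma levy_kernel_integral_jump_function:
  assumes l: "abs_summable l"
  shows "has_stieltjes_integral_off_0 (levy_kernel t) (jump_function l)
    ((\<Sum>\<^sub>\<infinity>u. of_real (l u) * (cis (t * u) - 1)) - \<i> * of_real (t * (\<Sum>\<^sub>\<infinity>u. l u * sin u)))"
proof -
  note ls = summable_on_real_subset[OF l]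
  have e: "iexp x = cis x" for x by (simp add: cis_conv_exp)
  let ?h = "levy_kernel t"
  have b: "norm (?h u) \<le> 2 + \<bar>t\<bar>" for u
  proof -
    have "norm (?h u) \<le> norm (iexp (t * u)) + norm (1::complex) + norm (\<i> * complex_of_real (t * sin u))"
      by (intro norm_triangle_le_diff add_right_mono norm_triangle_ineq4 order.refl)
    also have "norm (\<i> * complex_of_real (t * sin u)) \<le> \<bar>t\<bar>"
      unfolding norm_mult norm_of_real norm_ii by (simp add: abs_mult mult_left_le)
    finally show ?thesis unfolding e by simp
  qed
  have c: "continuous_on A ?h" for A by (intro continuous_intros)
  have N: "has_improper_stieltjes_integral ?h (jump_function l) at_bot (at_left 0) (\<Sum>\<^sub>\<infinity>w\<in>{..<0}. l w *\<^sub>R ?h w)"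
    by (rule improper_stieltjes_jump_function[OF l jump_function_increment[OF l] c b eventually_prod_half_lines(3,4)])
       auto
  have P: "has_improper_stieltjes_integral ?h (jump_function l) (at_right 0) at_top (\<Sum>\<^sub>\<infinity>w\<in>{0<..}. l w *\<^sub>R ?h w)"
    by (rule improper_stieltjes_jump_function[OF l jump_function_increment[OF l] c b eventually_prod_half_lines(1,2)])
       auto
  have s: "(\<lambda>w. l w *\<^sub>R k w) summable_on A" if "\<And>u. norm (k u) \<le> C" for A and C and k :: "real \<Rightarrow> complex"
  proof (rule abs_summable_summable, rule absum_comparison')
    show "(\<lambda>w. \<bar>l w\<bar> * C) summable_on A" by (rule summable_on_cmult_left[OF ls(1)])
    show "norm (l w *\<^sub>R k w) \<le> \<bar>l w\<bar> * C" for w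
      using that[of w] by (auto intro!: mult_left_mono)
  qed
  have "(\<Sum>\<^sub>\<infinity>w\<in>{..<0}. l w *\<^sub>R ?h w) + (\<Sum>\<^sub>\<infinity>w\<in>{0<..}. l w *\<^sub>R ?h w) = (\<Sum>\<^sub>\<infinity>w\<in>{..<0} \<union> {0<..}. l w *\<^sub>R ?h w)"
    by (rule infsum_Un_disjoint[symmetric, OF s[OF b] s[OF b]]) auto
  also have "\<dots> = (\<Sum>\<^sub>\<infinity>w. l w *\<^sub>R ?h w)"
    by (rule infsum_cong_neutral) (auto simp: not_less)
  also have "\<dots> = (\<Sum>\<^sub>\<infinity>w. l w *\<^sub>R (cis (t * w) - 1) + l w *\<^sub>R (- \<i> * of_real (t * sin w)))"
    unfolding e by (intro infsum_cong) (simp add: scaleR_conv_of_real algebra_simps)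
  also have "\<dots> = (\<Sum>\<^sub>\<infinity>w. l w *\<^sub>R (cis (t * w) - 1)) + (\<Sum>\<^sub>\<infinity>w. l w *\<^sub>R (- \<i> * of_real (t * sin w)))"
  proof (rule infsum_add)
    show "(\<lambda>w. l w *\<^sub>R (cis (t * w) - 1)) summable_on UNIV"
      by (rule s[of _ 2]) (use norm_triangle_ineq4[of "cis _" 1] in simp)
    show "(\<lambda>w. l w *\<^sub>R (- \<i> * of_real (t * sin w))) summable_on UNIV"
      by (rule s[of _ "\<bar>t\<bar>"]) (simp add: norm_mult abs_mult mult_left_le)
  qed
  also have "(\<Sum>\<^sub>\<infinity>w. l w *\<^sub>R (- \<i> * of_real (t * sin w))) = (\<Sum>\<^sub>\<infinity>w. (- \<i> * of_real t) * of_real (l w * sin w))"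
    by (rule infsum_cong) (simp add: scaleR_conv_of_real)
  also have "\<dots> = (- \<i> * of_real t) * (\<Sum>\<^sub>\<infinity>w. of_real (l w * sin w))"
    by (rule infsum_cmult_right')
  also have "(\<Sum>\<^sub>\<infinity>w. complex_of_real (l w * sin w)) = of_real (\<Sum>\<^sub>\<infinity>w. l w * sin w)"
  proof -
    have "(\<lambda>w. l w * sin w) summable_on UNIV"
    proof (rule abs_summable_summable, rule absum_comparison'[OF l])
      show "norm (l w * sin w) \<le> \<bar>l w\<bar>" for w by (simp add: abs_mult mult_left_le)
    qed
    then show ?thesis
      using has_sum_of_real[OF has_sum_infsum] by (metis infsumI)
  qed
  finally have eq: "(\<Sum>\<^sub>\<infinity>w\<in>{..<0}. l w *\<^sub>R ?h w) + (\<Sum>\<^sub>\<infinity>w\<in>{0<..}. l w *\<^sub>R ?h w)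
      = (\<Sum>\<^sub>\<infinity>u. of_real (l u) * (cis (t * u) - 1)) - \<i> * of_real (t * (\<Sum>\<^sub>\<infinity>u. l u * sin u))"
    by (simp add: scaleR_conv_of_real)
  show ?thesis
    unfolding has_stieltjes_integral_off_0_def
    by (intro exI conjI, rule N, rule P, rule eq[symmetric])
qed

section \<open>Discrete distributions\<close>

lemma ap_discrete_char:
  fixes x p :: "nat \<Rightarrow> real"
  assumes x: "inj x" and p: "\<And>k. p k \<ge> 0" "summable p" and G: "\<And>k. p k \<noteq> 0 \<Longrightarrow> x k \<in> G"
  shows "ap G (\<lambda>t. \<Sum>k. of_real (p k) * cis (t * x k))"
proof -
  define c where "c u = (if u \<in> range x then complex_of_real (p (inv x u)) else 0)" for u
  have c: "c (x k) = of_real (p k)" for k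
    using x by (simp add: c_def)
  have sp: "p summable_on UNIV"
    by (rule summable_nonneg_imp_summable_on) (use p in auto)
  have "(\<lambda>u. norm (c u)) \<circ> x = p"
    using p(1) by (auto simp: c)
  then have "(\<lambda>u. norm (c u)) summable_on range x"
    using summable_on_reindex[OF x, of "\<lambda>u. norm (c u)"] sp by simp
  then have l: "ell1 c"
    by (subst summable_on_cong_neutral[where T = "range x" and g = "\<lambda>u. norm (c u)"]) (auto simp: c_def)
  show ?thesis
  proof (rule apI[OF l])
    fix u assume "c u \<noteq> 0"
    then show "u \<in> G" using G x by (auto simp: c_def split: if_splits)
  next
    fix t
    have sm: "summable (\<lambda>k. norm (of_real (p k) * cis (t * x k)))"
      using p by (simp add: norm_mult)
    have "trig c t = (\<Sum>\<^sub>\<infinity>u\<in>range x. c u * cis (t * u))"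
      unfolding trig_def by (rule infsum_cong_neutral) (auto simp: c_def)
    also have "\<dots> = (\<Sum>\<^sub>\<infinity>k. of_real (p k) * cis (t * x k))"
      using infsum_reindex[OF x, of "\<lambda>u. c u * cis (t * u)"] by (simp add: o_def c)
    also have "\<dots> = (\<Sum>k. of_real (p k) * cis (t * x k))"
      by (rule infsumI, rule norm_summable_imp_has_sum[OF sm], rule summable_sums, rule summable_norm_cancel[OF sm])
    finally show "(\<Sum>k. of_real (p k) * cis (t * x k)) = trig c t" ..
  qed
qed

lemma discrete_distribution_exists:
  fixes x p :: "nat \<Rightarrow> real"
  assumes p: "\<And>k. p k \<ge> 0" "p sums 1"
  obtains M where "real_distribution M" "cdf M = (\<lambda>y. \<Sum>\<^sub>\<infinity>k\<in>{k. x k \<le> y}. p k)"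
    "\<And>t. char M t = (\<Sum>k. of_real (p k) * iexp (t * x k))"
proof -
  have "(\<integral>\<^sup>+k. ennreal (p k) \<partial>count_space UNIV) = 1"
    using suminf_ennreal_eq[OF p] by (simp add: nn_integral_count_space_nat)
  then have pmf: "pmf (embed_pmf p) k = p k" for k
    by (intro pmf_embed_pmf p(1))
  define P where "P = embed_pmf p"
  have pmfP: "pmf P = p" using pmf by (auto simp: P_def)
  define M where "M = distr (measure_pmf P) borel x"
  have "real_distribution M"
    unfolding M_def by (rule prob_space.real_distribution_distr[OF measure_pmf.prob_space_axioms]) simp
  moreover have "cdf M = (\<lambda>y. \<Sum>\<^sub>\<infinity>k\<in>{k. x k \<le> y}. p k)"
  proof
    fix y
    have "cdf M y = measure (measure_pmf P) {k. x k \<le> y}"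
      unfolding cdf_def M_def by (simp add: measure_distr vimage_def)
    also have "\<dots> = infsetsum (pmf P) {k. x k \<le> y}"
      by (rule measure_pmf_conv_infsetsum)
    also have "\<dots> = infsum (pmf P) {k. x k \<le> y}"
      by (rule infsetsum_infsum[OF pmf_abs_summable])
    finally show "cdf M y = (\<Sum>\<^sub>\<infinity>k\<in>{k. x k \<le> y}. p k)"
      by (simp only: pmfP)
  qed
  moreover have "char M t = (\<Sum>k. of_real (p k) * iexp (t * x k))" for t
  proof -
    have s: "summable (\<lambda>k. norm (p k *\<^sub>R iexp (t * x k)))"
      using p by (simp add: sums_iff norm_mult del: of_real_mult)
    have "char M t = (LINT k|measure_pmf P. iexp (t * x k))"
      unfolding char_def M_def by (rule integral_distr) simp_all
    also have "\<dots> = (LINT k|count_space UNIV. pmf P k *\<^sub>R iexp (t * x k))"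
      unfolding measure_pmf_eq_density by (rule integral_density) simp_all
    also have "\<dots> = (\<Sum>k. p k *\<^sub>R iexp (t * x k))"
      unfolding pmfP by (rule integral_count_space_nat) (simp only: integrable_count_space_nat_iff s)
    finally show ?thesis by (simp add: scaleR_conv_of_real)
  qed
  ultimately show ?thesis using that by blast
qed

theorem mainTheorem2:
  fixes x p :: "nat \<Rightarrow> real" and F :: "real \<Rightarrow> real" and f :: "real \<Rightarrow> complex" and X :: "real set"
  assumes "inj x"
    and "\<And>k. p k \<ge> 0"
    and "p sums 1"
    and "F = (\<lambda>y. \<Sum>\<^sub>\<infinity>k\<in>{k. x k \<le> y}. p k)"
    and "f = (\<lambda>t. \<Sum>k. of_real (p k) * iexp (t * x k))"
    and "X = {x k | k. p k > 0}"
  shows "(quasi_infinitely_divisible F \<longleftrightarrow> (INF t. cmod (f t)) > 0) \<and>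
    ((INF t. cmod (f t)) > 0 \<longleftrightarrow> (\<exists>\<mu>>0. \<forall>t. cmod (f t) \<ge> \<mu>)) \<and>
    (quasi_infinitely_divisible F \<longrightarrow>
      (\<exists>\<gamma>\<^sub>0 \<in> int_span X. \<exists>l :: real \<Rightarrow> real.
         (\<lambda>u. \<bar>l u\<bar>) summable_on (int_span X - {0}) \<and>
         (\<forall>t. f t = exp (\<i> * of_real (t * \<gamma>\<^sub>0) +
                (\<Sum>\<^sub>\<infinity>u\<in>int_span X - {0}. of_real (l u) * (iexp (t * u) - 1))))))"
proof -
  have e: "iexp y = cis y" for y by (simp add: cis_conv_exp)
  have f: "f = (\<lambda>t. \<Sum>k. of_real (p k) * cis (t * x k))"
    unfolding assms(5) e ..
  have sp: "summable p" using assms(3) by (simp add: sums_iff)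
  have "X \<noteq> {}"
  proof
    assume "X = {}"
    then have "p = (\<lambda>_. 0)" using assms(2,6) by (auto simp: less_le)
    then show False using assms(3) sums_unique2[OF sums_zero] by force
  qed
  then have G: "real_subgroup (int_span X)" by (rule int_span_subgroup)
  have apf: "ap (int_span X) f"
    unfolding f
  proof (rule ap_discrete_char[OF assms(1,2) sp])
    fix k assume "p k \<noteq> 0"
    then have "x k \<in> X" unfolding assms(6) using assms(2)[of k] by (auto simp: less_le)
    then show "x k \<in> int_span X" using subset_int_span by blast
  qed
  have f0: "f 0 = 1"
    unfolding f using sums_of_real[OF assms(3), where 'a = complex] by (simp add: sums_iff)
  have herm: "cnj (f (- t)) = f t" for t
  proof -
    have s: "summable (\<lambda>k. of_real (p k) * cis (- t * x k))"
      by (rule summable_norm_cancel) (use sp assms(2) in \<open>simp add: norm_mult\<close>)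
    have "(\<lambda>k. cnj (of_real (p k) * cis (- t * x k))) sums cnj (f (- t))"
      unfolding f sums_cnj by (rule summable_sums[OF s])
    then show ?thesis unfolding f by (simp add: cis_cnj sums_iff)
  qed
  obtain M where M: "real_distribution M" "cdf M = F" "\<And>t. char M t = f t"
    using discrete_distribution_exists[OF assms(2,3), of x] unfolding assms(4,5) by metis
  have bounded: "\<exists>\<mu>>0. \<forall>t. \<mu> \<le> cmod (f t)" if Q: "quasi_infinitely_divisible F"
  proof -
    obtain M' \<gamma> \<sigma> L where M': "real_distribution M'" "cdf M' = F" and L: "levy_spectral_function L"
      and I: "\<forall>t :: real. \<exists>I :: complex. has_stieltjes_integral_off_0 (levy_kernel t) L I \<and>
              char M' t = exp (\<i> * of_real (t * \<gamma>) - of_real (\<sigma>\<^sup>2 * t\<^sup>2 / 2) + I)"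
      using Q unfolding quasi_infinitely_divisible_def by blast
    have MM: "M' = M" using cdf_unique[OF M'(1) M(1)] M'(2) M(2) by simp
    from I have "\<forall>t. \<exists>I. has_stieltjes_integral_off_0 (levy_kernel t) L I \<and>
        f t = exp (\<i> * of_real (t * \<gamma>) - of_real (\<sigma>\<^sup>2 * t\<^sup>2 / 2) + I)"
      unfolding MM M(3) .
    from choice[OF this] obtain J where J: "\<And>t. has_stieltjes_integral_off_0 (levy_kernel t) L (J t)"
      "\<And>t. f t = exp (\<i> * of_real (t * \<gamma>) - of_real (\<sigma>\<^sup>2 * t\<^sup>2 / 2) + J t)"
      by blast
    show ?thesis
      using levy_representation_bounded_below[OF assms(2,3) L J(1), of x \<gamma> \<sigma>] J(2) unfolding f by blast
  qed
  have repr: "\<exists>\<gamma>\<in>int_span X. \<exists>l :: real \<Rightarrow> real. (\<lambda>u. \<bar>l u\<bar>) summable_on UNIV \<and> (\<forall>u. l u \<noteq> 0 \<longrightarrow> u \<in> int_span X) \<and>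
    (\<forall>t. f t = cis (t * \<gamma>) * exp (\<Sum>\<^sub>\<infinity>u. of_real (l u) * (cis (t * u) - 1)))"
    if "\<exists>\<mu>>0. \<forall>t. \<mu> \<le> cmod (f t)"
    using that hermitian_exponential_form[OF G apf _ _ f0 herm] by blast
  have QID: "quasi_infinitely_divisible F" if lower: "\<exists>\<mu>>0. \<forall>t. \<mu> \<le> cmod (f t)"
  proof -
    obtain \<gamma> l where l: "(\<lambda>u. \<bar>l u\<bar>) summable_on UNIV"
      and fl: "\<And>t. f t = cis (t * \<gamma>) * exp (\<Sum>\<^sub>\<infinity>u. of_real (l u) * (cis (t * u) - 1))"
      using repr[OF lower] by blast
    \<comment> \<open>the drift compensating the terms \<open>\<i> t sin u\<close> of the kernel\<close>
    define \<gamma>' where "\<gamma>' = \<gamma> + (\<Sum>\<^sub>\<infinity>u. l u * sin u)"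
    have "\<exists>I. has_stieltjes_integral_off_0 (levy_kernel t) (jump_function l) I \<and>
        char M t = exp (\<i> * of_real (t * \<gamma>') - of_real (0\<^sup>2 * t\<^sup>2 / 2) + I)" for t
    proof (intro exI conjI)
      show "has_stieltjes_integral_off_0 (levy_kernel t) (jump_function l)
          ((\<Sum>\<^sub>\<infinity>u. of_real (l u) * (cis (t * u) - 1)) - \<i> * of_real (t * (\<Sum>\<^sub>\<infinity>u. l u * sin u)))"
        by (rule levy_kernel_integral_jump_function[OF l])
      show "char M t = exp (\<i> * of_real (t * \<gamma>') - of_real (0\<^sup>2 * t\<^sup>2 / 2) +
          ((\<Sum>\<^sub>\<infinity>u. of_real (l u) * (cis (t * u) - 1)) - \<i> * of_real (t * (\<Sum>\<^sub>\<infinity>u. l u * sin u))))"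
        unfolding M(3) fl cis_conv_exp exp_add[symmetric] \<gamma>'_def
        by (rule arg_cong[of _ _ exp]) (simp add: algebra_simps)
    qed
    then show ?thesis
      unfolding quasi_infinitely_divisible_def
      using M(1,2) levy_spectral_function_jump_function[OF l] by blast
  qed
  have inf: "(INF t. cmod (f t)) > 0 \<longleftrightarrow> (\<exists>\<mu>>0. \<forall>t. cmod (f t) \<ge> \<mu>)"
  proof
    assume pos: "(INF t. cmod (f t)) > 0"
    have "(INF t. cmod (f t)) \<le> cmod (f t)" for t
      by (rule cINF_lower) (auto intro: bdd_belowI[of _ 0])
    with pos show "\<exists>\<mu>>0. \<forall>t. cmod (f t) \<ge> \<mu>" by blast
  next
    assume "\<exists>\<mu>>0. \<forall>t. cmod (f t) \<ge> \<mu>"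
    then obtain \<mu> where \<mu>: "\<mu> > 0" "\<And>t. \<mu> \<le> cmod (f t)" by blast
    have "\<mu> \<le> (INF t. cmod (f t))" by (rule cINF_greatest) (use \<mu>(2) in auto)
    with \<mu>(1) show "(INF t. cmod (f t)) > 0" by linarith
  qed
  have final: "\<exists>\<gamma>\<^sub>0 \<in> int_span X. \<exists>l :: real \<Rightarrow> real.
         (\<lambda>u. \<bar>l u\<bar>) summable_on (int_span X - {0}) \<and>
         (\<forall>t. f t = exp (\<i> * of_real (t * \<gamma>\<^sub>0) +
                (\<Sum>\<^sub>\<infinity>u\<in>int_span X - {0}. of_real (l u) * (iexp (t * u) - 1))))"
    if Q: "quasi_infinitely_divisible F"
  proof -
    obtain \<gamma> l where \<gamma>: "\<gamma> \<in> int_span X" and l: "(\<lambda>u. \<bar>l u\<bar>) summable_on UNIV" "\<And>u. l u \<noteq> 0 \<Longrightarrow> u \<in> int_span X"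
      and fl: "\<And>t. f t = cis (t * \<gamma>) * exp (\<Sum>\<^sub>\<infinity>u. of_real (l u) * (cis (t * u) - 1))"
      using repr[OF bounded[OF Q]] by blast
    \<comment> \<open>the term at \<open>u = 0\<close> vanishes, whatever \<open>l 0\<close> is\<close>
    have "(\<Sum>\<^sub>\<infinity>u. of_real (l u) * (cis (t * u) - 1))
        = (\<Sum>\<^sub>\<infinity>u\<in>int_span X - {0}. of_real (l u) * (iexp (t * u) - 1))" for t
      unfolding e by (rule infsum_cong_neutral) (use l(2) in auto)
    then have "f t = exp (\<i> * of_real (t * \<gamma>) + (\<Sum>\<^sub>\<infinity>u\<in>int_span X - {0}. of_real (l u) * (iexp (t * u) - 1)))" for t
      unfolding fl exp_add by (simp only: e)
    then show ?thesis
      using \<gamma> summable_on_real_subset(1)[OF l(1)] by blast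
  qed
  show ?thesis
    using bounded QID inf final by blast
qed

end
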